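(* Let $n\ge 3$, let $\Omega\subset\mathbb{R}^n$ be a bounded domain with smooth boundary containing the origin, and let $d>0$, $c\in\mathbb{R}$. Let $u$ be a solution to $$-\Delta u=d\,|\partial\Omega|\,\delta_0\ \text{ in }\Omega,\qquad u=c\ \text{ on }\partial\Omega,$$ satisfying $$|Du|=d\ \text{ on }\partial\Omega\qquad\text{and}\qquad \sup_{\partial\Omega}\frac{H}{n-1}\ge\left(\frac{|\mathbb{S}^{n-1}|}{|\partial\Omega|}\right)^{\frac1{n-1}} .$$ Then $\Omega$ is a ball and $u$ is rotationally symmetric.
   Context: $D$ and $\Delta$ are the Euclidean gradient and Laplacian; $|\partial\Omega|$ is the $(n-1)$-dimensional area of $\partial\Omega$, and $|\mathbb{S}^{n-1}|$ the area of the unit sphere in $\mathbb{R}^n$. $\delta_0$ is the Dirac distribution at the origin and the equation is understood in the sense of distributions; $u$ is smooth in $\overline\Omega\setminus\{0\}$. $H$ is the mean curvature of $\partial\Omega$ with respect to the normal pointing towards the exterior of $\Omega$: the sum of the $n-1$ principal curvatures (not their average), with the sign convention that a round sphere with its outward normal has positive mean curvature. Rotationally symmetric means depending only on the distance to the center of the ball $\Omega$. *)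

theory Defs
  imports "HOL-Analysis.Analysis"
begin

section \<open>Differential operators and smoothness\<close>

definition partial :: "'a::euclidean_space \<Rightarrow> ('a \<Rightarrow> real) \<Rightarrow> 'a \<Rightarrow> real" where
  "partial b f x = frechet_derivative f (at x) b"

definition grad :: "('a::euclidean_space \<Rightarrow> real) \<Rightarrow> 'a \<Rightarrow> 'a" where
  "grad f x = (\<Sum>b\<in>Basis. partial b f x *\<^sub>R b)"

definition laplacian :: "('a::euclidean_space \<Rightarrow> real) \<Rightarrow> 'a \<Rightarrow> real" where
  "laplacian f x = (\<Sum>b\<in>Basis. partial b (partial b f) x)"

text \<open>Meaningful for open sets only.\<close>

primrec C_k_on :: "nat \<Rightarrow> 'a::euclidean_space set \<Rightarrow> ('a \<Rightarrow> real) \<Rightarrow> bool" where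
  "C_k_on 0 U f \<longleftrightarrow> continuous_on U f"
| "C_k_on (Suc k) U f \<longleftrightarrow>
     (\<forall>x\<in>U. f differentiable (at x)) \<and> (\<forall>b\<in>Basis. C_k_on k U (partial b f))"

text \<open>
  Smoothness on an arbitrary set means that there is a smooth extension to an open
  neighbourhood. For open \<open>S\<close> this is ordinary smoothness, and for the closure
  of a smooth domain it is smoothness up to the boundary. The values of \<open>f\<close> outside
  \<open>S\<close> are irrelevant.
\<close>

definition smooth_on :: "'a::euclidean_space set \<Rightarrow> ('a \<Rightarrow> real) \<Rightarrow> bool" where
  "smooth_on S f \<longleftrightarrow>
     (\<exists>U g. open U \<and> S \<subseteq> U \<and> (\<forall>k. C_k_on k U g) \<and> (\<forall>x\<in>S. g x = f x))"


section \<open>Area\<close>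

text \<open>
  The Hausdorff (outer) measure of dimension \<open>s > 0\<close>. The factor
  \<open>unit_ball_vol s\<close> is the usual normalisation, under which the measure is the
  \<open>s\<close>-dimensional area when \<open>s\<close> is an integer. Boundedness of the covering sets is
  required because \<open>diameter\<close> is real-valued.
\<close>

definition hausdorff_premeasure :: "real \<Rightarrow> real \<Rightarrow> 'a::metric_space set \<Rightarrow> ennreal" where
  "hausdorff_premeasure \<delta> s A =
     (INF C \<in> {C :: nat \<Rightarrow> 'a set.
                A \<subseteq> (\<Union>i. C i) \<and> (\<forall>i. bounded (C i) \<and> diameter (C i) \<le> \<delta>)}.
        \<Sum>i. ennreal (unit_ball_vol s * (diameter (C i) / 2) powr s))"

definition hausdorff_measure :: "real \<Rightarrow> 'a::metric_space set \<Rightarrow> ennreal" where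
  "hausdorff_measure s A = (SUP \<delta>\<in>{0<..}. hausdorff_premeasure \<delta> s A)"

definition hypersurface_area :: "'a::euclidean_space set \<Rightarrow> real" where
  "hypersurface_area S = enn2real (hausdorff_measure (real (DIM('a) - 1)) S)"


section \<open>Domains with smooth boundary\<close>

definition local_defining_function ::
    "'a::euclidean_space set \<Rightarrow> 'a set \<Rightarrow> ('a \<Rightarrow> real) \<Rightarrow> bool" where
  "local_defining_function \<Omega> U \<rho> \<longleftrightarrow>
     open U \<and> smooth_on U \<rho> \<and> (\<forall>y\<in>U. grad \<rho> y \<noteq> 0) \<and> \<Omega> \<inter> U = {y\<in>U. \<rho> y < 0}"

definition smooth_boundary :: "'a::euclidean_space set \<Rightarrow> bool" where
  "smooth_boundary \<Omega> \<longleftrightarrow>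
     (\<forall>x\<in>frontier \<Omega>. \<exists>U \<rho>. x \<in> U \<and> local_defining_function \<Omega> U \<rho>)"

definition outer_normal :: "'a::euclidean_space set \<Rightarrow> 'a \<Rightarrow> 'a" where
  "outer_normal \<Omega> x =
     (THE \<nu>. \<exists>U \<rho>. x \<in> U \<and> local_defining_function \<Omega> U \<rho> \<and> \<nu> = sgn (grad \<rho> x))"

text \<open>
  \<open>B\<close> is an orthonormal basis of the tangent space at \<open>x\<close> consisting of principal
  directions, i.e. eigenvectors of the differential of the Gauss map, and \<open>\<kappa>\<close> gives the
  corresponding principal curvatures. The derivative \<open>L\<close> of the normal along the boundary
  is determined only on the tangent space, and it is used only there. No minus sign
  appears because the normal points outwards: a sphere of radius \<open>r\<close> has
  principal curvatures \<open>1/r\<close>.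
\<close>

definition principal_frame ::
    "'a::euclidean_space set \<Rightarrow> 'a \<Rightarrow> 'a set \<Rightarrow> ('a \<Rightarrow> real) \<Rightarrow> bool" where
  "principal_frame \<Omega> x B \<kappa> \<longleftrightarrow>
     pairwise orthogonal B \<and> (\<forall>b\<in>B. norm b = 1) \<and>
     span B = {v. v \<bullet> outer_normal \<Omega> x = 0} \<and>
     (\<exists>L. (outer_normal \<Omega> has_derivative L) (at x within frontier \<Omega>) \<and>
          (\<forall>b\<in>B. L b = \<kappa> b *\<^sub>R b))"

text \<open>
  The sum (not the average) of the principal curvatures with multiplicity. It is the trace of
  the differential of the Gauss map and hence does not depend on the frame.
\<close>

definition mean_curvature :: "'a::euclidean_space set \<Rightarrow> 'a \<Rightarrow> real" where
  "mean_curvature \<Omega> x = (THE h. \<exists>B \<kappa>. principal_frame \<Omega> x B \<kappa> \<and> h = (\<Sum>b\<in>B. \<kappa> b))"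


section \<open>The equation in the sense of distributions\<close>

definition test_function :: "'a::euclidean_space set \<Rightarrow> ('a \<Rightarrow> real) \<Rightarrow> bool" where
  "test_function \<Omega> \<phi> \<longleftrightarrow>
     smooth_on UNIV \<phi> \<and> compact (closure {x. \<phi> x \<noteq> 0}) \<and> closure {x. \<phi> x \<noteq> 0} \<subseteq> \<Omega>"

definition locally_integrable_on :: "'a::euclidean_space set \<Rightarrow> ('a \<Rightarrow> real) \<Rightarrow> bool" where
  "locally_integrable_on \<Omega> u \<longleftrightarrow> (\<forall>K. compact K \<and> K \<subseteq> \<Omega> \<longrightarrow> set_integrable lborel K u)"

text \<open>\<open>-\<Delta>u = m \<delta>\<^sub>0\<close> in \<open>\<Omega>\<close>, where \<open>\<delta>\<^sub>0\<close> is the Dirac distribution at the origin.\<close>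

definition neg_laplacian_eq_dirac ::
    "'a::euclidean_space set \<Rightarrow> ('a \<Rightarrow> real) \<Rightarrow> real \<Rightarrow> bool" where
  "neg_laplacian_eq_dirac \<Omega> u m \<longleftrightarrow>
     locally_integrable_on \<Omega> u \<and>
     (\<forall>\<phi>. test_function \<Omega> \<phi> \<longrightarrow>
        - (LINT x:\<Omega>|lborel. u x * laplacian \<phi> x) = m * \<phi> 0)"

end

theory Submission
  imports Defs
begin

text \<open>
  The method of moving planes. Near the boundary \<open>\<Omega>\<close> is a superlevel set of \<open>u\<close>. For a unit
  vector \<open>e\<close> let \<open>R\<close> be the reflection in the plane \<open>x \<bullet> e = \<mu>\<close>. As \<open>\<mu>\<close> decreases from
  infinity, the reflection of the cap \<open>x \<bullet> e > \<mu>\<close> stays inside \<open>\<Omega>\<close> as long as \<open>\<mu> > 0\<close>: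
  there \<open>w = u - u \<circ> R\<close> is superharmonic, and positive by the minimum principle, because \<open>u\<close>
  is bounded below near its pole and the pole has not been crossed. If the reflected cap touched
  the boundary, the gradients of \<open>u\<close> and \<open>u \<circ> R\<close> would agree at the point of contact, against
  Hopf's lemma. If the plane met the boundary orthogonally, \<open>w\<close> would vanish to second order in
  the corner, because \<open>|Du|\<close> is constant on the boundary, against Serrin's corner lemma. In the
  limit \<open>\<mu> = 0\<close>, using \<open>e\<close> and \<open>-e\<close>, both \<open>\<Omega>\<close> and \<open>u\<close> are symmetric in every plane
  through the origin.
\<close>

section \<open>Superharmonic functions and the minimum principle\<close>

text \<open>The equation is reduced to two properties of a smooth extension \<open>G\<close> of
  \<open>u\<close>: harmonicity off the origin and a lower bound near it. No expansion at the pole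
  is derived. The bound comes from comparing averages of \<open>u\<close> over shells of two sizes
  around points near the origin, the sign of the Dirac mass giving the inequality. In the minimum
  principles the puncture is then absorbed by \<epsilon> / |x|, which is superharmonic because n
  \<ge> 3.

  Strict positivity of \<open>w\<close> is delicate because the reflected cap may be disconnected: a
  zero of \<open>w\<close> has to be propagated across the plane to all of \<Omega>, until the pole
  meets a regular value. That \<open>G\<close> is unbounded at the pole follows from the maximum
  principle: otherwise \<open>G\<close> would not exceed \<open>c\<close>, although |Du| = d > 0
  makes it larger than \<open>c\<close> next to the boundary.

  At a right-angled corner there is no touching interior ball for Hopf's lemma. A product of two
  distances serves as barrier and gives a quadratic lower bound, to be set against w = o(t^2) on the
  diagonal.\<close>

definition has_hessian ::
    "('a::euclidean_space \<Rightarrow> real) \<Rightarrow> ('a \<Rightarrow> 'a) \<Rightarrow> ('a \<Rightarrow> 'a \<Rightarrow> 'a) \<Rightarrow> 'a set \<Rightarrow> bool" where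
  "has_hessian f F A S \<longleftrightarrow>
     (\<forall>x\<in>S. (f has_derivative (\<lambda>h. F x \<bullet> h)) (at x) \<and> (F has_derivative A x) (at x))"

definition lin_trace :: "('a::euclidean_space \<Rightarrow> 'a) \<Rightarrow> real" where
  "lin_trace L = (\<Sum>b\<in>Basis. L b \<bullet> b)"

text \<open>Second derivatives are taken pointwise and without continuity, because the sign of the
  trace is only used at a minimum. Gradient and Hessian are hidden in an existential so that sums
  and multiples can be formed without tracking them.\<close>

definition superharmonic_on :: "('a::euclidean_space \<Rightarrow> real) \<Rightarrow> 'a set \<Rightarrow> bool" where
  "superharmonic_on f S \<longleftrightarrow> (\<exists>F A. has_hessian f F A S \<and> (\<forall>x\<in>S. lin_trace (A x) \<le> 0))"

lemma has_hessian_subset: "has_hessian f F A S \<Longrightarrow> T \<subseteq> S \<Longrightarrow> has_hessian f F A T"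
  by (auto simp: has_hessian_def)

lemma superharmonic_on_subset: "superharmonic_on f S \<Longrightarrow> T \<subseteq> S \<Longrightarrow> superharmonic_on f T"
  unfolding superharmonic_on_def using has_hessian_subset by blast

lemma has_hessian_add:
  assumes "has_hessian f F A S" "has_hessian g G B S"
  shows "has_hessian (\<lambda>x. f x + g x) (\<lambda>x. F x + G x) (\<lambda>x h. A x h + B x h) S"
  using assms unfolding has_hessian_def
  by (auto intro!: derivative_eq_intros simp: inner_add_left)

lemma has_hessian_cmult:
  assumes "has_hessian f F A S"
  shows "has_hessian (\<lambda>x. c * f x) (\<lambda>x. c *\<^sub>R F x) (\<lambda>x h. c *\<^sub>R A x h) S"
  using assms unfolding has_hessian_def
  by (auto intro!: derivative_eq_intros)

lemma has_hessian_continuous_on: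
  assumes "has_hessian f F A S"
  shows "continuous_on S f" "continuous_on S F"
proof -
  show "continuous_on S f"
    using assms unfolding has_hessian_def
    by (meson continuous_at_imp_continuous_on has_derivative_continuous)
  show "continuous_on S F"
    using assms unfolding has_hessian_def
    by (meson continuous_at_imp_continuous_on has_derivative_continuous)
qed

lemma has_hessian_linear:
  assumes "has_hessian f F A S" "x \<in> S"
  shows "linear (A x)"
  using assms unfolding has_hessian_def
  by (meson bounded_linear.linear has_derivative_bounded_linear)

lemma lin_trace_add: "lin_trace (\<lambda>h. L h + M h) = lin_trace L + lin_trace M"
  by (simp add: lin_trace_def inner_add_left sum.distrib)

lemma lin_trace_cmult: "lin_trace (\<lambda>h. c *\<^sub>R L h) = c * lin_trace L"
  by (simp add: lin_trace_def sum_distrib_left)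

lemma superharmonic_on_add:
  assumes "superharmonic_on f S" "superharmonic_on g S"
  shows "superharmonic_on (\<lambda>x. f x + g x) S"
proof -
  obtain F A where 1: "has_hessian f F A S" "\<forall>x\<in>S. lin_trace (A x) \<le> 0"
    using assms(1) unfolding superharmonic_on_def by blast
  obtain G B where 2: "has_hessian g G B S" "\<forall>x\<in>S. lin_trace (B x) \<le> 0"
    using assms(2) unfolding superharmonic_on_def by blast
  have "\<forall>x\<in>S. lin_trace (\<lambda>h. A x h + B x h) \<le> 0"
    using 1(2) 2(2) by (simp add: lin_trace_add add_nonpos_nonpos)
  then show ?thesis
    unfolding superharmonic_on_def using has_hessian_add[OF 1(1) 2(1)]
    by blast
qed

lemma superharmonic_on_cmult:
  assumes "superharmonic_on f S" "0 \<le> c"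
  shows "superharmonic_on (\<lambda>x. c * f x) S"
proof -
  obtain F A where 1: "has_hessian f F A S" "\<forall>x\<in>S. lin_trace (A x) \<le> 0"
    using assms(1) unfolding superharmonic_on_def by blast
  have "\<forall>x\<in>S. lin_trace (\<lambda>h. c *\<^sub>R A x h) \<le> 0"
    using 1(2) assms(2) by (simp add: lin_trace_cmult mult_nonneg_nonpos)
  then show ?thesis
    unfolding superharmonic_on_def using has_hessian_cmult[OF 1(1)]
    by blast
qed

lemma superharmonic_on_const: "superharmonic_on (\<lambda>x. c) S"
proof -
  have "has_hessian (\<lambda>x::'a. c) (\<lambda>x. 0) (\<lambda>x h. 0) S"
    by (auto simp: has_hessian_def)
  then show ?thesis
    unfolding superharmonic_on_def by (force simp: lin_trace_def)
qed

lemma superharmonic_on_continuous: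
  "superharmonic_on f S \<Longrightarrow> continuous_on S f"
  unfolding superharmonic_on_def using has_hessian_continuous_on(1) by blast

lemma has_hessian_line:
  assumes "has_hessian f F A S" "x + t *\<^sub>R h \<in> S"
  shows "((\<lambda>t. f (x + t *\<^sub>R h)) has_real_derivative F (x + t *\<^sub>R h) \<bullet> h) (at t)"
    and "((\<lambda>t. F (x + t *\<^sub>R h) \<bullet> k) has_real_derivative A (x + t *\<^sub>R h) h \<bullet> k) (at t)"
proof -
  have g: "((\<lambda>t. x + t *\<^sub>R h) has_derivative (\<lambda>s. s *\<^sub>R h)) (at t)"
    by (auto intro!: derivative_eq_intros)
  have f: "(f has_derivative (\<lambda>h'. F (x + t *\<^sub>R h) \<bullet> h')) (at (x + t *\<^sub>R h))"
    and F: "(F has_derivative A (x + t *\<^sub>R h)) (at (x + t *\<^sub>R h))"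
    using assms unfolding has_hessian_def by auto
  have "((\<lambda>t. f (x + t *\<^sub>R h)) has_derivative (\<lambda>s. F (x + t *\<^sub>R h) \<bullet> (s *\<^sub>R h))) (at t)"
    using has_derivative_compose[OF g f] .
  then show "((\<lambda>t. f (x + t *\<^sub>R h)) has_real_derivative F (x + t *\<^sub>R h) \<bullet> h) (at t)"
    by (simp add: has_field_derivative_def mult_commute_abs)
  have "((\<lambda>t. F (x + t *\<^sub>R h)) has_derivative (\<lambda>s. A (x + t *\<^sub>R h) (s *\<^sub>R h))) (at t)"
    using has_derivative_compose[OF g F] .
  then have "((\<lambda>t. F (x + t *\<^sub>R h) \<bullet> k) has_derivative (\<lambda>s. A (x + t *\<^sub>R h) (s *\<^sub>R h) \<bullet> k)) (at t)"
    by (auto intro!: derivative_eq_intros)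
  moreover have "A (x + t *\<^sub>R h) (s *\<^sub>R h) = s *\<^sub>R A (x + t *\<^sub>R h) h" for s
    using has_hessian_linear[OF assms] by (simp add: linear_cmul)
  ultimately show "((\<lambda>t. F (x + t *\<^sub>R h) \<bullet> k) has_real_derivative A (x + t *\<^sub>R h) h \<bullet> k) (at t)"
    by (simp add: has_field_derivative_def mult_commute_abs)
qed

text \<open>On each coordinate line the first derivative vanishes at \<open>x\<close>; if the second
  were negative, the first would be negative just to the right and the function would drop below its
  minimum.\<close>

lemma trace_nonneg_at_local_min:
  assumes hess: "has_hessian f F A S" and "open S" "x \<in> S"
    and min: "\<forall>y\<in>S. f x \<le> f y"
  shows "0 \<le> lin_trace (A x)"
  unfolding lin_trace_def
proof (rule sum_nonneg)
  fix b :: 'a assume "b \<in> Basis"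
  obtain r where r: "r > 0" "ball x r \<subseteq> S"
    using assms(2,3) open_contains_ball by blast
  have nb: "norm b = 1" using \<open>b \<in> Basis\<close> by simp
  have inS: "x + t *\<^sub>R b \<in> S" if "\<bar>t\<bar> < r" for t
    using r(2) that nb by (intro subsetD[OF r(2)]) (simp add: dist_norm)
  let ?f = "\<lambda>t. f (x + t *\<^sub>R b)"
  let ?g = "\<lambda>t. F (x + t *\<^sub>R b) \<bullet> b"
  have d1: "(?f has_real_derivative ?g t) (at t)" if "\<bar>t\<bar> < r" for t
    using has_hessian_line(1)[OF hess inS[OF that]] .
  have d2: "(?g has_real_derivative A x b \<bullet> b) (at 0)"
    using has_hessian_line(2)[OF hess, of x 0 b b] assms(3) by simp
  have g0: "?g 0 = 0"
  proof (rule DERIV_local_min[of ?f])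
    show "(?f has_real_derivative ?g 0) (at 0)" using d1[of 0] r(1) by simp
    show "\<forall>y. \<bar>0 - y\<bar> < r \<longrightarrow> ?f 0 \<le> ?f y" using min inS by simp
  qed (use r in auto)
  show "0 \<le> A x b \<bullet> b"
  proof (rule ccontr)
    assume "\<not> 0 \<le> A x b \<bullet> b"
    then obtain e where e: "e > 0" "\<forall>h>0. h < e \<longrightarrow> ?g 0 > ?g (0 + h)"
      using DERIV_neg_dec_right[OF d2] by auto
    define t where "t = min e r / 2"
    have t: "0 < t" "t < e" "t < r" using e(1) r(1) by (auto simp: t_def)
    have "\<exists>z. 0 < z \<and> z < t \<and> ?f t - ?f 0 = (t - 0) * ?g z"
      using t by (intro MVT2) (auto intro!: d1)
    then obtain z where z: "0 < z" "z < t" "?f t - ?f 0 = t * ?g z" by auto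
    have "?g z < 0" using e(2) z t g0 by auto
    then have "?f t < ?f 0" using z(3) t(1) by (smt (verit) mult_pos_neg)
    then show False using min inS[of t] t by force
  qed
qed

lemma has_hessian_norm_sq:
  "has_hessian (\<lambda>x. (x - p) \<bullet> (x - p)) (\<lambda>x. 2 *\<^sub>R (x - p)) (\<lambda>x h. 2 *\<^sub>R h) S"
  unfolding has_hessian_def
  by (auto intro!: derivative_eq_intros simp: inner_commute)

lemma lin_trace_id: "lin_trace (\<lambda>h::'a::euclidean_space. h) = DIM('a)"
  by (simp add: lin_trace_def)

text \<open>The perturbation by a multiple of \<open>M - |x|\<^sup>2\<close> makes the trace strictly negative.\<close>

lemma minimum_principle:
  fixes f :: "'a::euclidean_space \<Rightarrow> real"
  assumes sh: "superharmonic_on f D" and "open D" "bounded D"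
    and bd: "\<And>z e. z \<in> frontier D \<Longrightarrow> e > 0 \<Longrightarrow> \<exists>\<delta>>0. \<forall>x\<in>D \<inter> ball z \<delta>. f x \<ge> - e"
    and "x0 \<in> D"
  shows "0 \<le> f x0"
proof (rule ccontr)
  assume neg: "\<not> 0 \<le> f x0"
  obtain F A where hf: "has_hessian f F A D" "\<forall>x\<in>D. lin_trace (A x) \<le> 0"
    using sh unfolding superharmonic_on_def by blast
  obtain B where B: "\<forall>x\<in>D. norm x \<le> B" using assms(3) bounded_iff by blast
  define M where "M = B\<^sup>2"
  have M: "x \<bullet> x \<le> M" if "x \<in> D" for x
    using B that by (metis M_def dot_square_norm norm_ge_zero power_mono)
  have M0: "M \<ge> 0" by (simp add: M_def)
  \<comment> \<open>Small enough that adding \<open>\<eta> * M\<close> uses up at most half of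
    \<open>- f x0\<close>, so the perturbed function is still negative at \<open>x0\<close>.\<close>
  define \<eta> where "\<eta> = - f x0 / (2 * (M + 1))"
  have \<eta>: "\<eta> > 0" using neg M0 by (simp add: \<eta>_def field_simps)
  define g where "g = (\<lambda>x. f x + \<eta> * M + (- \<eta>) * ((x - 0) \<bullet> (x - 0)))"
  have gf: "g x \<ge> f x" if "x \<in> D" for x
    using M[OF that] \<eta> by (simp add: g_def mult_left_mono)
  have g0: "g x0 < 0"
  proof -
    have "g x0 \<le> f x0 + \<eta> * M" using \<eta> by (simp add: g_def)
    also have "\<eta> * M \<le> - f x0 / 2" using neg M0 by (simp add: \<eta>_def field_simps)
    finally show ?thesis using neg by simp
  qed
  have "has_hessian (\<lambda>x. \<eta> * M) (\<lambda>x. 0) (\<lambda>x h. 0) D" by (auto simp: has_hessian_def)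
  from has_hessian_add[OF has_hessian_add[OF hf(1) this] has_hessian_cmult[OF has_hessian_norm_sq[of 0], of "-\<eta>"]]
  have hg: "has_hessian g (\<lambda>x. F x + 0 + (-\<eta>) *\<^sub>R (2 *\<^sub>R (x - 0))) (\<lambda>x h. A x h + 0 + (-\<eta>) *\<^sub>R (2 *\<^sub>R h)) D"
    unfolding g_def .
  have cont: "continuous_on D g" using has_hessian_continuous_on(1)[OF hg] .
  define K where "K = {x\<in>D. g x \<le> g x0}"
  \<comment> \<open>Near the frontier \<open>f\<close>, and hence \<open>g\<close>, is at least
    \<open>g x0 / 2 > g x0\<close>, so \<open>K\<close> stays away from the frontier. This gives
    compactness, and thus a minimum inside \<open>D\<close>, without boundary values of
    \<open>f\<close>.\<close>
  have "closed K"
    unfolding closed_sequential_limits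
  proof (intro allI impI)
    fix X z assume X: "(\<forall>n. X n \<in> K) \<and> X \<longlonglongrightarrow> z"
    then have XD: "\<forall>n. X n \<in> D" by (auto simp: K_def)
    then have "z \<in> closure D" using X closure_sequential by blast
    have "z \<in> D"
    proof (rule ccontr)
      assume "z \<notin> D"
      then have "z \<in> frontier D" using \<open>z \<in> closure D\<close> \<open>open D\<close> by (simp add: frontier_def interior_open)
      then obtain \<delta> where \<delta>: "\<delta> > 0" "\<forall>x\<in>D \<inter> ball z \<delta>. f x \<ge> g x0 / 2"
        using bd[of z "- g x0 / 2"] g0 by auto
      have "eventually (\<lambda>n. X n \<in> ball z \<delta>) sequentially"
        using X \<delta>(1) by (metis centre_in_ball open_ball topological_tendstoD)
      then obtain n where "X n \<in> ball z \<delta>" using eventually_sequentially by auto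
      then have "f (X n) \<ge> g x0 / 2" using \<delta> XD by auto
      moreover have "g (X n) \<le> g x0" using X by (auto simp: K_def)
      ultimately show False using gf[of "X n"] XD g0 by force
    qed
    moreover have "(\<lambda>n. g (X n)) \<longlonglongrightarrow> g z"
      by (rule continuous_on_tendsto_compose[OF cont]) (use X XD \<open>z \<in> D\<close> in auto)
    then have "g z \<le> g x0"
      using X by (intro LIMSEQ_le_const2) (auto simp: K_def)
    ultimately show "z \<in> K" by (simp add: K_def)
  qed
  moreover have "bounded K" using assms(3) by (rule bounded_subset) (auto simp: K_def)
  ultimately have "compact K" by (simp add: compact_eq_bounded_closed)
  moreover have "x0 \<in> K" using assms by (simp add: K_def)
  moreover have "continuous_on K g" using cont by (rule continuous_on_subset) (auto simp: K_def)
  ultimately obtain x where x: "x \<in> K" "\<forall>y\<in>K. g x \<le> g y"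
    using continuous_attains_inf by blast
  have xD: "x \<in> D" using x by (simp add: K_def)
  have "g x \<le> g y" if "y \<in> D" for y
    using x that by (cases "y \<in> K") (auto simp: K_def)
  then have "0 \<le> lin_trace (\<lambda>h. A x h + 0 + (-\<eta>) *\<^sub>R (2 *\<^sub>R h))"
    using trace_nonneg_at_local_min[OF hg \<open>open D\<close> xD] by auto
  also have "\<dots> = lin_trace (A x) + (-\<eta>) * (2 * real DIM('a))"
    using lin_trace_add[of "A x" "\<lambda>h. (-\<eta>) *\<^sub>R (2 *\<^sub>R h)"] lin_trace_cmult[of "-\<eta>" "\<lambda>h::'a. 2 *\<^sub>R h"]
      lin_trace_cmult[of 2 "\<lambda>h::'a. h"] by (simp add: lin_trace_id)
  also have "\<dots> < 0"
  proof (rule add_nonpos_neg)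
    show "lin_trace (A x) \<le> 0" using hf(2) xD by blast
    show "(-\<eta>) * (2 * real DIM('a)) < 0" using \<eta> by (simp add: mult_neg_pos)
  qed
  finally show False by simp
qed

section \<open>Hopf's lemma and the corner lemma\<close>

lemma lin_trace_rank_one: "lin_trace (\<lambda>h. (v \<bullet> h) *\<^sub>R w) = v \<bullet> w"
  unfolding lin_trace_def by (subst euclidean_inner) (simp add: inner_commute)

lemma has_hessian_mult:
  assumes "has_hessian f F A S" "has_hessian g G B S"
  shows "has_hessian (\<lambda>x. f x * g x) (\<lambda>x. g x *\<^sub>R F x + f x *\<^sub>R G x)
    (\<lambda>x h. (g x *\<^sub>R A x h + (G x \<bullet> h) *\<^sub>R F x) + (f x *\<^sub>R B x h + (F x \<bullet> h) *\<^sub>R G x)) S"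
  unfolding has_hessian_def
proof (intro ballI conjI)
  fix x assume "x \<in> S"
  then have d: "(f has_derivative (\<lambda>h. F x \<bullet> h)) (at x)" "(F has_derivative A x) (at x)"
    "(g has_derivative (\<lambda>h. G x \<bullet> h)) (at x)" "(G has_derivative B x) (at x)"
    using assms by (auto simp: has_hessian_def)
  show "((\<lambda>x. f x * g x) has_derivative (\<lambda>h. (g x *\<^sub>R F x + f x *\<^sub>R G x) \<bullet> h)) (at x)"
    by (rule has_derivative_eq_rhs[OF has_derivative_mult[OF d(1) d(3)]])
      (auto simp: inner_add_left algebra_simps)
  show "((\<lambda>x. g x *\<^sub>R F x + f x *\<^sub>R G x) has_derivative
      (\<lambda>h. (g x *\<^sub>R A x h + (G x \<bullet> h) *\<^sub>R F x) + (f x *\<^sub>R B x h + (F x \<bullet> h) *\<^sub>R G x))) (at x)"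
    by (rule has_derivative_eq_rhs[OF has_derivative_add[OF has_derivative_scaleR[OF d(3) d(2)]
          has_derivative_scaleR[OF d(1) d(4)]]]) auto
qed

lemma has_hessian_compose:
  assumes "has_hessian g G B S"
    and "\<And>x. x \<in> S \<Longrightarrow> (H has_real_derivative H' (g x)) (at (g x))"
    and "\<And>x. x \<in> S \<Longrightarrow> (H' has_real_derivative H'' (g x)) (at (g x))"
  shows "has_hessian (\<lambda>x. H (g x)) (\<lambda>x. H' (g x) *\<^sub>R G x)
    (\<lambda>x h. H' (g x) *\<^sub>R B x h + H'' (g x) *\<^sub>R ((G x \<bullet> h) *\<^sub>R G x)) S"
  unfolding has_hessian_def
proof (intro ballI conjI)
  fix x assume x: "x \<in> S"
  then have g: "(g has_derivative (\<lambda>h. G x \<bullet> h)) (at x)" and G: "(G has_derivative B x) (at x)"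
    using assms by (auto simp: has_hessian_def)
  have H: "(H has_derivative (\<lambda>t. H' (g x) * t)) (at (g x))"
    and H': "(H' has_derivative (\<lambda>t. H'' (g x) * t)) (at (g x))"
    using assms(2,3)[OF x] by (auto simp: has_field_derivative_def)
  show "((\<lambda>x. H (g x)) has_derivative (\<lambda>h. (H' (g x) *\<^sub>R G x) \<bullet> h)) (at x)"
    using has_derivative_compose[OF g H] by simp
  show "((\<lambda>x. H' (g x) *\<^sub>R G x) has_derivative
      (\<lambda>h. H' (g x) *\<^sub>R B x h + H'' (g x) *\<^sub>R ((G x \<bullet> h) *\<^sub>R G x))) (at x)"
    using has_derivative_scaleR[OF has_derivative_compose[OF g H'] G] by simp
qed

text \<open>Taking the squared distance t = |x-p|^2 as variable keeps everything differentiable at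
  the center. The Laplacian becomes \<open>2 * n * H' + 4 * t * H''\<close>, the formula behind the
  barriers and kernels below.\<close>

lemma has_hessian_radial:
  fixes p :: "'a::euclidean_space" and H' H'' :: "real \<Rightarrow> real"
  defines "A \<equiv> \<lambda>x h. H' ((x - p) \<bullet> (x - p)) *\<^sub>R (2 *\<^sub>R h) +
      H'' ((x - p) \<bullet> (x - p)) *\<^sub>R (((2 *\<^sub>R (x - p)) \<bullet> h) *\<^sub>R (2 *\<^sub>R (x - p)))"
  assumes "\<And>x. x \<in> S \<Longrightarrow> (H has_real_derivative H' ((x - p) \<bullet> (x - p))) (at ((x - p) \<bullet> (x - p)))"
    and "\<And>x. x \<in> S \<Longrightarrow> (H' has_real_derivative H'' ((x - p) \<bullet> (x - p))) (at ((x - p) \<bullet> (x - p)))"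
  shows "has_hessian (\<lambda>x. H ((x - p) \<bullet> (x - p))) (\<lambda>x. H' ((x - p) \<bullet> (x - p)) *\<^sub>R (2 *\<^sub>R (x - p))) A S"
    and "lin_trace (A x) = 2 * DIM('a) * H' ((x - p) \<bullet> (x - p)) + 4 * ((x - p) \<bullet> (x - p)) * H'' ((x - p) \<bullet> (x - p))"
proof -
  show "has_hessian (\<lambda>x. H ((x - p) \<bullet> (x - p))) (\<lambda>x. H' ((x - p) \<bullet> (x - p)) *\<^sub>R (2 *\<^sub>R (x - p))) A S"
    unfolding A_def by (rule has_hessian_compose[OF has_hessian_norm_sq]) (use assms(2,3) in auto)
  show "lin_trace (A x) = 2 * DIM('a) * H' ((x - p) \<bullet> (x - p)) + 4 * ((x - p) \<bullet> (x - p)) * H'' ((x - p) \<bullet> (x - p))"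
    unfolding A_def lin_trace_add lin_trace_cmult lin_trace_rank_one lin_trace_id by simp
qed

text \<open>With \<open>H t = t powr (-1/2)\<close> the trace is (3 - n) |x|^(-3). The exponent -1
  serves in every dimension n \<ge> 3: the barrier has to be positive, superharmonic and infinite at
  the origin.\<close>

lemma superharmonic_on_inverse_norm:
  assumes "DIM('a::euclidean_space) \<ge> 3" "0 \<notin> S"
  shows "superharmonic_on (\<lambda>x::'a. inverse (norm x)) S"
proof -
  define H where "H = (\<lambda>t. t powr (-1/2) :: real)"
  define H' where "H' = (\<lambda>t. (-1/2) * t powr (-3/2) :: real)"
  define H'' where "H'' = (\<lambda>t. (3/4) * t powr (-5/2) :: real)"
  have p: "x \<bullet> x > 0" if "x \<in> S" for x::'a using that assms(2) by auto
  have 1: "(H has_real_derivative H' t) (at t)" "(H' has_real_derivative H'' t) (at t)" if "t > 0" for t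
    unfolding H_def H'_def H''_def using that
    by (auto intro!: derivative_eq_intros)
  define A where "A = (\<lambda>x h::'a. H' ((x - 0) \<bullet> (x - 0)) *\<^sub>R (2 *\<^sub>R h) +
      H'' ((x - 0) \<bullet> (x - 0)) *\<^sub>R (((2 *\<^sub>R (x - 0)) \<bullet> h) *\<^sub>R (2 *\<^sub>R (x - 0))))"
  have 2: "has_hessian (\<lambda>x::'a. H ((x - 0) \<bullet> (x - 0))) (\<lambda>x. H' ((x - 0) \<bullet> (x - 0)) *\<^sub>R (2 *\<^sub>R (x - 0))) A S"
    unfolding A_def by (rule has_hessian_radial) (use 1 p in auto)
  have eq: "H ((x - 0) \<bullet> (x - 0)) = inverse (norm x)" for x :: 'a
  proof -
    have "H (x \<bullet> x) = inverse ((x \<bullet> x) powr (1/2))"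
      unfolding H_def by (simp add: powr_minus[symmetric])
    also have "(x \<bullet> x) powr (1/2) = norm x"
      by (simp add: powr_half_sqrt norm_eq_sqrt_inner)
    finally show ?thesis by simp
  qed
  have "lin_trace (A x) \<le> 0" if x: "x \<in> S" for x
  proof -
    let ?t = "x \<bullet> x"
    have "lin_trace (A x) = 2 * DIM('a) * H' ((x - 0) \<bullet> (x - 0)) + 4 * ((x - 0) \<bullet> (x - 0)) * H'' ((x - 0) \<bullet> (x - 0))"
      unfolding A_def by (rule has_hessian_radial(2)[of "{x}" H]) (use 1 p x in auto)
    also have "\<dots> = - DIM('a) * ?t powr (-3/2) + 3 * (?t powr 1 * ?t powr (-5/2))"
      using p[OF x] by (simp add: H'_def H''_def)
    also have "?t powr 1 * ?t powr (-5/2) = ?t powr (-3/2)"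
      by (subst powr_add[symmetric]) simp
    also have "- DIM('a) * ?t powr (-3/2) + 3 * ?t powr (-3/2) = (3 - real DIM('a)) * ?t powr (-3/2)"
      by (simp add: algebra_simps)
    also have "\<dots> \<le> 0" using assms(1) by (intro mult_nonpos_nonneg) auto
    finally show ?thesis .
  qed
  then show ?thesis using 2 unfolding superharmonic_on_def eq by blast
qed

text \<open>For \<alpha> > 0 the trace is nonnegative once |y-p|^2 \<ge> n / (2 \<alpha>), so a
  large \<alpha> makes the Gaussian subharmonic outside a small ball. The constant \<open>k\<close>
  lets it vanish on a prescribed sphere.\<close>

lemma gaussian_hessian:
  fixes p :: "'a::euclidean_space"
  shows "\<exists>A. has_hessian (\<lambda>y. exp (- \<alpha> * ((y - p) \<bullet> (y - p))) - k)
      (\<lambda>y. (- \<alpha> * exp (- \<alpha> * ((y - p) \<bullet> (y - p)))) *\<^sub>R (2 *\<^sub>R (y - p))) A S \<and>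
    (\<forall>y. lin_trace (A y) = exp (- \<alpha> * ((y - p) \<bullet> (y - p))) * (4 * \<alpha>\<^sup>2 * ((y - p) \<bullet> (y - p)) - 2 * \<alpha> * DIM('a)))"
proof -
  define H where "H = (\<lambda>t. exp (- \<alpha> * t) - k :: real)"
  define H' where "H' = (\<lambda>t. - \<alpha> * exp (- \<alpha> * t) :: real)"
  define H'' where "H'' = (\<lambda>t. \<alpha>\<^sup>2 * exp (- \<alpha> * t) :: real)"
  have 1: "(H has_real_derivative H' t) (at t)" "(H' has_real_derivative H'' t) (at t)" for t
    unfolding H_def H'_def H''_def
    by (auto intro!: derivative_eq_intros simp: power2_eq_square)
  note * = has_hessian_radial[of S H H' p H'', OF 1]
  show ?thesis
    apply (rule exI, rule conjI)
    apply (rule *(1)[unfolded H_def[THEN fun_cong] H'_def[THEN fun_cong]])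
    using *(2) by (simp add: H'_def H''_def algebra_simps)
qed

section \<open>Hopf's lemma with uniform constants, and the strong minimum principle\<close>

lemma exp_gap_lower:
  fixes \<alpha> :: real
  shows "exp (- \<alpha> * t) - exp (- \<alpha> * s) \<ge> exp (- \<alpha> * s) * (\<alpha> * (s - t))"
proof -
  have "exp (- \<alpha> * t) = exp (- \<alpha> * s) * exp (\<alpha> * (s - t))"
    by (simp add: exp_add[symmetric] algebra_simps)
  moreover have "exp (\<alpha> * (s - t)) \<ge> 1 + \<alpha> * (s - t)" by simp
  then have "exp (- \<alpha> * s) * exp (\<alpha> * (s - t)) \<ge> exp (- \<alpha> * s) * (1 + \<alpha> * (s - t))"
    by (intro mult_left_mono) auto
  ultimately show ?thesis by (simp add: distrib_left)
qed

text \<open>The barrier \<open>m * E\<close>, a Gaussian lowered so as to vanish on the sphere, lies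
  below \<open>f\<close> on a shell. The constant \<kappa> is fixed before center, function and
  \<open>m\<close>, since later the ball is slid along a flat piece of boundary.\<close>

lemma hopf_bound:
  fixes \<rho> :: real
  assumes "\<rho> > 0"
  shows "\<exists>\<kappa>>0. \<forall>(c::'a::euclidean_space) f m. superharmonic_on f (ball c \<rho>) \<longrightarrow> (\<forall>y\<in>ball c \<rho>. 0 \<le> f y) \<longrightarrow>
     0 \<le> m \<longrightarrow> (\<forall>y\<in>cball c (\<rho>/2). m \<le> f y) \<longrightarrow> (\<forall>y\<in>ball c \<rho>. f y \<ge> \<kappa> * m * (\<rho> - dist c y))"
proof -
  \<comment> \<open>Chosen so that \<open>4 * \<alpha>\<^sup>2 * (\<rho>/4)\<^sup>2 = 2 * \<alpha> *
    DIM('a)\<close>: the Gaussian is subharmonic from radius \<open>\<rho>/4\<close>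
    outwards.\<close>
  define \<alpha> where "\<alpha> = 8 * real DIM('a) / \<rho>\<^sup>2"
  have \<alpha>: "\<alpha> > 0" using assms by (simp add: \<alpha>_def)
  define e0 where "e0 = exp (- \<alpha> * \<rho>\<^sup>2)"
  \<comment> \<open>The first entry bounds the slope of the barrier on the outer shell; the second
    serves the inner ball, where \<open>f\<close> is at least \<open>m\<close> and the distance to
    the sphere at most \<rho>.\<close>
  define \<kappa> where "\<kappa> = min (e0 * \<alpha> * \<rho>) (1 / \<rho>)"
  have \<kappa>: "\<kappa> > 0" using assms \<alpha> by (simp add: \<kappa>_def e0_def)
  have "f y \<ge> \<kappa> * m * (\<rho> - dist c y)"
    if sh: "superharmonic_on f (ball c \<rho>)" and nn: "\<forall>y\<in>ball c \<rho>. 0 \<le> f y" and m: "0 \<le> m"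
      and fm: "\<forall>y\<in>cball c (\<rho>/2). m \<le> f y" and y: "y \<in> ball c \<rho>" for c :: 'a and f m y
  proof (cases "dist c y \<le> \<rho>/2")
    case True
    have "\<kappa> * (\<rho> - dist c y) \<le> (1/\<rho>) * \<rho>"
      using assms \<kappa> y by (intro mult_mono) (auto simp: \<kappa>_def)
    then have "\<kappa> * (\<rho> - dist c y) * m \<le> 1 * m" using assms m by (intro mult_right_mono) auto
    also have "\<dots> \<le> f y" using fm True by auto
    finally show ?thesis by (simp add: algebra_simps)
  next
    case False
    define E where "E = (\<lambda>y. exp (- \<alpha> * ((y - c) \<bullet> (y - c))) - e0)"
    \<comment> \<open>The inner radius is below \<open>\<rho>/2\<close>, so that each inner frontier
      point has a whole neighbourhood where \<open>m \<le> f\<close>, as the boundary condition of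
      \<open>minimum_principle\<close> asks.\<close>
    define D where "D = {y. \<rho>/4 < dist c y \<and> dist c y < \<rho>}"
    have sq: "(y - c) \<bullet> (y - c) = (dist c y)\<^sup>2" for y
      by (simp add: dot_square_norm dist_norm norm_minus_commute)
    obtain A where A: "has_hessian E (\<lambda>y. (- \<alpha> * exp (- \<alpha> * ((y - c) \<bullet> (y - c)))) *\<^sub>R (2 *\<^sub>R (y - c))) A D"
      "\<forall>y. lin_trace (A y) = exp (- \<alpha> * ((y - c) \<bullet> (y - c))) * (4 * \<alpha>\<^sup>2 * ((y - c) \<bullet> (y - c)) - 2 * \<alpha> * DIM('a))"
      unfolding E_def using gaussian_hessian by blast
    have "lin_trace (A y) \<ge> 0" if "y \<in> D" for y
    proof -
      have "(dist c y)\<^sup>2 \<ge> (\<rho>/4)\<^sup>2" using that assms by (intro power_mono) (auto simp: D_def)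
      then have "4 * \<alpha>\<^sup>2 * (dist c y)\<^sup>2 \<ge> 4 * \<alpha>\<^sup>2 * (\<rho>/4)\<^sup>2" by (intro mult_left_mono) auto
      also have "4 * \<alpha>\<^sup>2 * (\<rho>/4)\<^sup>2 = 2 * \<alpha> * DIM('a)"
        using assms by (simp add: \<alpha>_def power2_eq_square)
      finally show ?thesis unfolding A(2)[rule_format] sq by (intro mult_nonneg_nonneg) auto
    qed
    then have "superharmonic_on (\<lambda>x. (-m) * E x) D"
      using has_hessian_cmult[OF A(1), of "-m"] m unfolding superharmonic_on_def
      by (fastforce simp: lin_trace_cmult mult_nonneg_nonneg simp del: scaleR_minus_left)
    then have sh2: "superharmonic_on (\<lambda>x. f x + (-m) * E x) D"
      by (intro superharmonic_on_add superharmonic_on_subset[OF sh]) (auto simp: D_def)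
    have E1: "E x \<le> 1" for x
    proof -
      have "exp (- \<alpha> * ((x - c) \<bullet> (x - c))) \<le> 1" using \<alpha> by simp
      then show ?thesis unfolding E_def e0_def using exp_gt_zero[of "- \<alpha> * \<rho>\<^sup>2"] by linarith
    qed
    have contE: "continuous_on UNIV E" unfolding E_def by (intro continuous_intros)
    have D_eq: "D = ball c \<rho> - cball c (\<rho>/4)" by (auto simp: D_def)
    have oD: "open D" unfolding D_eq by auto
    have "0 \<le> f y + (-m) * E y"
    proof (rule minimum_principle[OF sh2])
      show "bounded D" unfolding D_eq by (meson Diff_subset bounded_ball bounded_subset)
      show "y \<in> D" using y False assms by (auto simp: D_def)
      fix z :: 'a and e :: real assume z: "z \<in> frontier D" and e: "e > 0"
      have "closed {y. dist c y \<le> \<rho> \<and> \<rho>/4 \<le> dist c y}"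
        by (intro closed_Collect_conj closed_Collect_le continuous_intros)
      then have "closure D \<subseteq> {y. dist c y \<le> \<rho> \<and> \<rho>/4 \<le> dist c y}"
        by (intro closure_minimal) (auto simp: D_def)
      then have z1: "dist c z \<le> \<rho>" using z by (auto simp: frontier_def)
      have "z \<notin> D" using z oD by (simp add: frontier_def interior_open)
      show "\<exists>\<delta>>0. \<forall>x\<in>D \<inter> ball z \<delta>. - e \<le> f x + (-m) * E x"
      proof (cases "dist c z < \<rho>/2")
        case True
        show ?thesis
        proof (intro exI[of _ "\<rho>/2 - dist c z"] conjI ballI)
          fix x assume "x \<in> D \<inter> ball z (\<rho>/2 - dist c z)"
          then have "x \<in> cball c (\<rho>/2)" using dist_triangle[of c x z] by (auto simp: dist_commute)
          then have "f x \<ge> m" using fm by blast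
          moreover have "m * E x \<le> m" using E1[of x] m by (simp add: mult_left_le)
          ultimately show "- e \<le> f x + (-m) * E x" using e by simp
        qed (use True in auto)
      next
        case False
        then have zr: "dist c z = \<rho>" using z1 \<open>z \<notin> D\<close> assms by (auto simp: D_def)
        then have Ez: "E z = 0" by (simp add: E_def e0_def sq)
        have "isCont E z" using contE by (simp add: continuous_on_eq_continuous_at)
        then obtain \<delta> where \<delta>: "\<delta> > 0" "\<forall>x. dist x z < \<delta> \<longrightarrow> dist (E x) (E z) < e / (m + 1)"
          unfolding continuous_at_eps_delta using divide_pos_pos[OF e, of "m + 1"] m by force
        show ?thesis
        proof (intro exI[of _ \<delta>] conjI ballI)
          fix x assume x: "x \<in> D \<inter> ball z \<delta>"
          then have "E x < e / (m + 1)" using \<delta>(2) Ez by (auto simp: dist_commute dist_real_def)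
          then have "m * E x \<le> m * (e / (m + 1))" using m by (intro mult_left_mono) auto
          also have "\<dots> \<le> e" using e m by (simp add: field_simps)
          finally show "- e \<le> f x + (-m) * E x" using nn x D_eq by force
        qed (use \<delta> in auto)
      qed
    qed (use oD in auto)
    then have "f y \<ge> m * E y" by simp
    moreover have "E y \<ge> \<kappa> * (\<rho> - dist c y)"
    proof -
      have "E y \<ge> e0 * (\<alpha> * (\<rho>\<^sup>2 - (dist c y)\<^sup>2))"
        using exp_gap_lower[of \<alpha> "\<rho>\<^sup>2" "(dist c y)\<^sup>2"] by (simp add: E_def e0_def sq)
      also have "\<rho>\<^sup>2 - (dist c y)\<^sup>2 = (\<rho> + dist c y) * (\<rho> - dist c y)"
        by (simp add: power2_eq_square algebra_simps)
      finally have "E y \<ge> (e0 * \<alpha> * (\<rho> + dist c y)) * (\<rho> - dist c y)" by (simp add: algebra_simps)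
      moreover have "\<kappa> \<le> e0 * \<alpha> * (\<rho> + dist c y)"
      proof -
        have "\<kappa> \<le> e0 * \<alpha> * \<rho>" by (simp add: \<kappa>_def)
        also have "\<dots> \<le> e0 * \<alpha> * (\<rho> + dist c y)" using \<alpha> by (intro mult_left_mono) (auto simp: e0_def)
        finally show ?thesis .
      qed
      then have "\<kappa> * (\<rho> - dist c y) \<le> (e0 * \<alpha> * (\<rho> + dist c y)) * (\<rho> - dist c y)"
        using y by (intro mult_right_mono) auto
      ultimately show ?thesis by simp
    qed
    then have "m * E y \<ge> m * (\<kappa> * (\<rho> - dist c y))" using m by (rule mult_left_mono)
    ultimately show ?thesis by (simp add: algebra_simps)
  qed
  then show ?thesis using \<kappa> by blast
qed

lemma derivative_lower_bound:
  assumes "(\<phi> has_real_derivative D) (at 0)" "\<phi> 0 = 0" "\<delta> > 0"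
    and "\<And>t. 0 < t \<Longrightarrow> t < \<delta> \<Longrightarrow> k * t \<le> \<phi> t"
  shows "k \<le> D"
proof -
  have "((\<lambda>h. \<phi> h / h) \<longlongrightarrow> D) (at_right 0)"
    using assms(1,2) unfolding DERIV_def by (simp add: filterlim_at_split)
  moreover have "eventually (\<lambda>h. k \<le> \<phi> h / h) (at_right 0)"
    unfolding eventually_at_right_field
    using assms(3,4) by (intro exI[of _ \<delta>]) (auto simp: field_simps)
  ultimately show ?thesis
    by (intro tendsto_lowerbound[where F = "at_right 0"]) auto
qed

text \<open>Apply \<open>hopf_bound\<close> with \<open>m\<close> the minimum over the concentric
  closed ball of half the radius, which is positive by compactness. The linear lower bound along the
  radius passes to the derivative.\<close>

lemma hopf_normal_derivative:
  fixes p :: "'a::euclidean_space"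
  assumes sh: "superharmonic_on f (ball p \<rho>)" and pos: "\<And>y. y \<in> ball p \<rho> \<Longrightarrow> 0 < f y"
    and "\<rho> > 0" "dist p z = \<rho>" "f z = 0"
    and d: "((\<lambda>t. f (z + t *\<^sub>R (p - z))) has_real_derivative D) (at 0)"
  shows "0 < D"
proof -
  obtain \<kappa> where \<kappa>: "\<kappa> > 0" "\<And>(c::'a) f m y. superharmonic_on f (ball c \<rho>) \<Longrightarrow> (\<forall>y\<in>ball c \<rho>. 0 \<le> f y) \<Longrightarrow>
     0 \<le> m \<Longrightarrow> (\<forall>y\<in>cball c (\<rho>/2). m \<le> f y) \<Longrightarrow> y\<in>ball c \<rho> \<Longrightarrow> f y \<ge> \<kappa> * m * (\<rho> - dist c y)"
    using hopf_bound[OF \<open>\<rho> > 0\<close>, where 'a='a] by blast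
  have sub: "cball p (\<rho>/2) \<subseteq> ball p \<rho>" using assms(3) by auto
  have "continuous_on (cball p (\<rho>/2)) f"
    using superharmonic_on_continuous[OF sh] sub continuous_on_subset by blast
  then obtain x where x: "x \<in> cball p (\<rho>/2)" "\<forall>y\<in>cball p (\<rho>/2). f x \<le> f y"
    using continuous_attains_inf[of "cball p (\<rho>/2)" f] assms(3) by force
  have fx: "f x > 0" using x sub pos by auto
  have "\<kappa> * f x * \<rho> \<le> D"
  proof (rule derivative_lower_bound[OF d, of 1])
    fix t :: real assume t: "0 < t" "t < 1"
    have "p - (z + t *\<^sub>R (p - z)) = (1 - t) *\<^sub>R (p - z)" by (simp add: algebra_simps)
    then have dd: "dist p (z + t *\<^sub>R (p - z)) = (1 - t) * \<rho>"
      using assms(4) t by (metis abs_of_pos diff_gt_0_iff_gt dist_norm norm_scaleR)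
    have "(1 - t) * \<rho> < \<rho>" using t assms(3) by simp
    then have "f (z + t *\<^sub>R (p - z)) \<ge> \<kappa> * f x * (\<rho> - (1 - t) * \<rho>)"
      using \<kappa>(2)[OF sh, of "f x" "z + t *\<^sub>R (p - z)"] pos x(2) fx dd by (simp add: less_imp_le)
    then show "\<kappa> * f x * \<rho> * t \<le> f (z + t *\<^sub>R (p - z))" by (simp add: algebra_simps)
  qed (use assms in auto)
  moreover have "\<kappa> * f x * \<rho> > 0" using \<kappa>(1) fx assms(3) by simp
  ultimately show ?thesis by simp
qed

text \<open>If \<open>f p\<close> were positive, the largest zero-free ball around \<open>p\<close>
  would touch a zero \<open>z\<close>. There \<open>f\<close> has an interior minimum, so its
  gradient vanishes, while Hopf's lemma makes the derivative towards \<open>p\<close>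
  positive.\<close>

lemma strong_minimum_principle:
  fixes q :: "'a::euclidean_space"
  assumes sh: "superharmonic_on f (ball q R)" and nn: "\<And>y. y \<in> ball q R \<Longrightarrow> 0 \<le> f y"
    and "f q = 0" and p: "p \<in> ball q (R/2)"
  shows "f p = 0"
proof (rule ccontr)
  assume "f p \<noteq> 0"
  have pR2: "dist q p < R/2" using p by simp
  moreover from this have "R > 0" using zero_le_dist[of q p] by linarith
  ultimately have pR: "p \<in> ball q R" "dist q p < R/2" "R > 0" by auto
  have fp: "f p > 0" using nn[OF pR(1)] \<open>f p \<noteq> 0\<close> by simp
  \<comment> \<open>The radius is twice \<open>dist q p\<close>: then \<open>q\<close> itself is a
    zero in \<open>Z\<close>, so \<open>\<rho> \<le> dist q p\<close>, and
    \<open>ball p \<rho>\<close> does not leave the region in which zeros are recorded. This is why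
    \<open>p\<close> is taken in the ball of radius \<open>R/2\<close>.\<close>
  define Z where "Z = {y\<in>cball q (2 * dist q p). f y = 0}"
  have sub: "cball q (2 * dist q p) \<subseteq> ball q R" using pR by auto
  have cont: "continuous_on (ball q R) f" using superharmonic_on_continuous[OF sh] .
  have "closed Z"
    unfolding Z_def
    by (rule continuous_closed_preimage_constant[OF continuous_on_subset[OF cont sub] closed_cball])
  moreover have "q \<in> Z" using assms(3) by (simp add: Z_def)
  ultimately obtain z where z: "z \<in> Z" "\<And>y. y \<in> Z \<Longrightarrow> dist p z \<le> dist p y"
    using distance_attains_inf[of Z p] by blast
  define \<rho> where "\<rho> = dist p z"
  have \<rho>: "\<rho> > 0" using z(1) fp by (auto simp: \<rho>_def Z_def)
  have \<rho>le: "\<rho> \<le> dist q p" using z(2)[OF \<open>q \<in> Z\<close>] by (simp add: \<rho>_def dist_commute)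
  have bsub: "ball p \<rho> \<subseteq> cball q (2 * dist q p)"
  proof
    fix y assume "y \<in> ball p \<rho>"
    then show "y \<in> cball q (2 * dist q p)" using \<rho>le dist_triangle[of q y p] by auto
  qed
  have zR: "z \<in> ball q R" using z(1) sub by (auto simp: Z_def)
  obtain F A where FA: "has_hessian f F A (ball q R)" using sh unfolding superharmonic_on_def by blast
  have d: "((\<lambda>t. f (z + t *\<^sub>R (p - z))) has_real_derivative F z \<bullet> (p - z)) (at 0)"
    using has_hessian_line(1)[OF FA, of z 0 "p - z"] zR by simp
  have fz: "f z = 0" using z(1) by (simp add: Z_def)
  obtain r where r: "r > 0" "ball z r \<subseteq> ball q R" using zR open_contains_ball by blast
  have "F z \<bullet> (p - z) = 0"
  proof (rule DERIV_local_min[OF d])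
    show "0 < r / \<rho>" using r \<rho> by simp
    show "\<forall>t. \<bar>0 - t\<bar> < r/\<rho> \<longrightarrow> f (z + 0 *\<^sub>R (p - z)) \<le> f (z + t *\<^sub>R (p - z))"
    proof (intro allI impI)
      fix t :: real assume "\<bar>0 - t\<bar> < r/\<rho>"
      then have "\<bar>t\<bar> * \<rho> < r" using \<rho> by (simp add: field_simps)
      then have "z + t *\<^sub>R (p - z) \<in> ball z r" by (simp add: dist_norm \<rho>_def)
      then show "f (z + 0 *\<^sub>R (p - z)) \<le> f (z + t *\<^sub>R (p - z))" using r nn fz by auto
    qed
  qed
  moreover have "0 < F z \<bullet> (p - z)"
  proof (rule hopf_normal_derivative[OF _ _ \<rho> _ fz d])
    show "superharmonic_on f (ball p \<rho>)" using superharmonic_on_subset[OF sh] bsub sub by blast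
    fix y assume y: "y \<in> ball p \<rho>"
    then have "y \<notin> Z" using z(2) by (force simp: \<rho>_def)
    then have "f y \<noteq> 0" using y bsub by (auto simp: Z_def)
    moreover have "f y \<ge> 0" using y bsub sub nn by blast
    ultimately show "0 < f y" by simp
  qed (simp add: \<rho>_def)
  ultimately show False by simp
qed

section \<open>Growth at a right-angled corner\<close>

text \<open>A point close to the flat part is put into a ball of the fixed radius \<open>r/8\<close>
  that touches the plane of the flat part from inside. Its inner half lies in a fixed compact set,
  where \<open>f\<close> has a positive minimum, so \<open>hopf_bound\<close> applies with the same
  constants for all positions.\<close>

lemma half_ball_linear_bound:
  fixes p e :: "'a::euclidean_space"
  assumes e: "norm e = 1" and r: "r > 0" and H: "H = {y\<in>ball p r. (y - p) \<bullet> e < 0}"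
    and sh: "superharmonic_on f H" and pos: "\<And>y. y \<in> H \<Longrightarrow> 0 < f y"
  shows "\<exists>k>0. \<forall>y\<in>H. dist p y \<le> 3*r/4 \<longrightarrow> k * (- ((y - p) \<bullet> e)) \<le> f y"
proof -
  define \<rho> where "\<rho> = r/8"
  have \<rho>: "\<rho> > 0" using r by (simp add: \<rho>_def)
  obtain \<kappa> where \<kappa>: "\<kappa> > 0" "\<And>(c::'a) f m y. superharmonic_on f (ball c \<rho>) \<Longrightarrow> (\<forall>y\<in>ball c \<rho>. 0 \<le> f y) \<Longrightarrow>
     0 \<le> m \<Longrightarrow> (\<forall>y\<in>cball c (\<rho>/2). m \<le> f y) \<Longrightarrow> y\<in>ball c \<rho> \<Longrightarrow> f y \<ge> \<kappa> * m * (\<rho> - dist c y)"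
    using hopf_bound[OF \<rho>, where 'a='a] by blast
  \<comment> \<open>The radii add up: \<open>3*r/4\<close> for the point, \<open>r/8\<close> for the
    shift to the center, \<open>r/16\<close> for the half ball give \<open>15*r/16\<close>; the
    center has depth \<open>r/8\<close>, so the half ball has depth at least
    \<open>r/16\<close>.\<close>
  define K where "K = cball p (15*r/16) \<inter> {y. (y - p) \<bullet> e \<le> - (r/16)}"
  have "closed {y. (y - p) \<bullet> e \<le> - (r/16)}" by (intro closed_Collect_le continuous_intros)
  then have cK: "compact K" unfolding K_def by (intro compact_Int_closed compact_cball)
  have KH: "K \<subseteq> H" using r by (auto simp: K_def H)
  have ee: "e \<bullet> e = 1" using e by (simp add: dot_square_norm)
  have "p - (r/2) *\<^sub>R e \<in> K" using r e by (simp add: K_def dist_norm ee)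
  then obtain x where x: "x \<in> K" "\<forall>y\<in>K. f x \<le> f y"
    using continuous_attains_inf[OF cK] continuous_on_subset[OF superharmonic_on_continuous[OF sh] KH]
    by blast
  define m where "m = f x"
  have m: "m > 0" using pos x(1) KH by (auto simp: m_def)
  have ie: "v \<bullet> e \<le> norm v" "- norm v \<le> v \<bullet> e" for v
    using Cauchy_Schwarz_ineq2[of v e] e by auto
  define k where "k = min (\<kappa> * m) (m / r)"
  have k: "k > 0" using \<kappa>(1) m r by (simp add: k_def)
  have "k * (- ((y - p) \<bullet> e)) \<le> f y" if y: "y \<in> H" "dist p y \<le> 3*r/4" for y
  proof -
    define s where "s = - ((y - p) \<bullet> e)"
    have s: "s > 0" using y by (simp add: s_def H)
    show ?thesis
    proof (cases "s < \<rho>")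
      case False
      then have "y \<in> K" using y r by (auto simp: K_def s_def \<rho>_def)
      then have "m \<le> f y" using x by (simp add: m_def)
      moreover have "k * s \<le> (m / r) * r"
        using ie(2)[of "y - p"] y r m s
        by (intro mult_mono) (auto simp: k_def s_def dist_norm norm_minus_commute)
      ultimately show ?thesis using r by (simp add: s_def)
    next
      case True
      define c where "c = y - (\<rho> - s) *\<^sub>R e"
      have dcy: "dist c y = \<rho> - s" using True e by (simp add: c_def dist_norm)
      have cp: "(c - p) \<bullet> e = - \<rho>" by (simp add: c_def s_def inner_diff_left ee)
      have split: "(x - p) \<bullet> e = (x - c) \<bullet> e + (c - p) \<bullet> e" for x by (simp add: inner_diff_left)
      have tri: "dist p x \<le> dist p y + dist c y + dist c x" for x
        using dist_triangle[of p x y] dist_triangle[of y x c] by (simp add: dist_commute)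
      have b1: "ball c \<rho> \<subseteq> H"
      proof
        fix x assume x: "x \<in> ball c \<rho>"
        have "(x - p) \<bullet> e < 0" using ie(1)[of "x - c"] x cp split[of x]
          by (simp add: dist_norm norm_minus_commute)
        moreover have "dist p x < r" using tri[of x] x y dcy s by (auto simp: \<rho>_def)
        ultimately show "x \<in> H" by (simp add: H)
      qed
      have b2: "cball c (\<rho>/2) \<subseteq> K"
      proof
        fix x assume x: "x \<in> cball c (\<rho>/2)"
        have "(x - p) \<bullet> e \<le> - (\<rho>/2)" using ie(1)[of "x - c"] x cp split[of x]
          by (simp add: dist_norm norm_minus_commute)
        moreover have "dist p x \<le> 15*r/16" using tri[of x] x y dcy s by (auto simp: \<rho>_def)
        ultimately show "x \<in> K" by (simp add: K_def \<rho>_def)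
      qed
      have "f y \<ge> \<kappa> * m * (\<rho> - dist c y)"
      proof (rule \<kappa>(2))
        show "superharmonic_on f (ball c \<rho>)" using superharmonic_on_subset[OF sh b1] .
        show "\<forall>y\<in>ball c \<rho>. 0 \<le> f y" using b1 pos by (auto intro: less_imp_le)
        show "\<forall>y\<in>cball c (\<rho>/2). m \<le> f y" using b2 x by (auto simp: m_def)
      qed (use m dcy s in auto)
      then have "f y \<ge> \<kappa> * m * s" by (simp add: dcy)
      moreover have "k * s \<le> \<kappa> * m * s" using s by (intro mult_right_mono) (auto simp: k_def)
      ultimately show ?thesis by (simp add: s_def)
    qed
  qed
  then show ?thesis using k by blast
qed

text \<open>The barrier is the Gaussian one of Hopf's lemma, multiplied by the distance to the flat part.\<close>

lemma corner_bound:
  fixes p e :: "'a::euclidean_space"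
  assumes e: "norm e = 1" and r: "r > 0" and H: "H = {y\<in>ball p r. (y - p) \<bullet> e < 0}"
    and sh: "superharmonic_on f H" and pos: "\<And>y. y \<in> H \<Longrightarrow> 0 < f y"
  shows "\<exists>k>0. \<forall>y\<in>H. r/2 < dist p y \<longrightarrow> k * (- ((y - p) \<bullet> e)) * (r - dist p y) \<le> f y"
proof -
  obtain k0 where k0: "k0 > 0" "\<And>y. y \<in> H \<Longrightarrow> dist p y \<le> 3*r/4 \<Longrightarrow> k0 * (- ((y - p) \<bullet> e)) \<le> f y"
    using half_ball_linear_bound[OF e r H sh pos] by blast
  \<comment> \<open>The cross term of the product \<open>s * E\<close> replaces the dimension by
    \<open>DIM('a) + 2\<close> in the trace, and \<alpha> is chosen so that
    \<open>2 * \<alpha> * (r/2)\<^sup>2\<close> equals exactly that: the barrier is subharmonic from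
    radius \<open>r/2\<close> outwards.\<close>
  define \<alpha> where "\<alpha> = 2 * (real DIM('a) + 2) / r\<^sup>2"
  have \<alpha>: "\<alpha> > 0" using r by (simp add: \<alpha>_def add_nonneg_pos)
  define e0 where "e0 = exp (- \<alpha> * r\<^sup>2)"
  define E where "E = (\<lambda>y. exp (- \<alpha> * ((y - p) \<bullet> (y - p))) - e0)"
  define s where "s = (\<lambda>y. - ((y - p) \<bullet> e))"
  define D where "D = {y. (r/2 < dist p y \<and> dist p y < r) \<and> (y - p) \<bullet> e < 0}"
  have sq: "(y - p) \<bullet> (y - p) = (dist p y)\<^sup>2" for y
    by (simp add: dot_square_norm dist_norm norm_minus_commute)
  obtain B where B: "has_hessian E (\<lambda>y. (- \<alpha> * exp (- \<alpha> * ((y - p) \<bullet> (y - p)))) *\<^sub>R (2 *\<^sub>R (y - p))) B D"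
    "\<forall>y. lin_trace (B y) = exp (- \<alpha> * ((y - p) \<bullet> (y - p))) * (4 * \<alpha>\<^sup>2 * ((y - p) \<bullet> (y - p)) - 2 * \<alpha> * DIM('a))"
    unfolding E_def using gaussian_hessian by blast
  have hs: "has_hessian s (\<lambda>y. - e) (\<lambda>y h. 0) D"
    unfolding has_hessian_def s_def
    by (auto intro!: derivative_eq_intros simp: inner_commute)
  note hm = has_hessian_mult[OF hs B(1)]
  have tr: "0 \<le> lin_trace (\<lambda>h. (E y *\<^sub>R 0 + (((- \<alpha> * exp (- \<alpha> * ((y - p) \<bullet> (y - p)))) *\<^sub>R (2 *\<^sub>R (y - p))) \<bullet> h) *\<^sub>R (- e)) +
      (s y *\<^sub>R B y h + (- e \<bullet> h) *\<^sub>R ((- \<alpha> * exp (- \<alpha> * ((y - p) \<bullet> (y - p)))) *\<^sub>R (2 *\<^sub>R (y - p)))))"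
    (is "0 \<le> ?T") if y: "y \<in> D" for y
  proof -
    let ?q = "(y - p) \<bullet> (y - p)" let ?x = "exp (- \<alpha> * ?q)"
    have "?T = 2 * (((- \<alpha> * ?x) *\<^sub>R (2 *\<^sub>R (y - p))) \<bullet> (- e)) + s y * lin_trace (B y)"
      unfolding lin_trace_add lin_trace_cmult lin_trace_rank_one
      by (simp add: lin_trace_def inner_commute)
    also have "\<dots> = 4 * \<alpha> * ?x * ((y - p) \<bullet> e) + s y * lin_trace (B y)" by simp
    also have "\<dots> = s y * ?x * (2 * \<alpha> * (2 * \<alpha> * ?q - (real DIM('a) + 2)))"
      unfolding B(2)[rule_format] by (simp add: s_def power2_eq_square algebra_simps)
    also have "\<dots> \<ge> 0"
    proof -
      have "(r/2)\<^sup>2 \<le> ?q" unfolding sq using y r by (intro power_mono) (auto simp: D_def)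
      then have "2 * \<alpha> * (r/2)\<^sup>2 \<le> 2 * \<alpha> * ?q" using \<alpha> by (intro mult_left_mono) auto
      moreover have "2 * \<alpha> * (r/2)\<^sup>2 = real DIM('a) + 2" using r by (simp add: \<alpha>_def power2_eq_square)
      ultimately have "0 \<le> 2 * \<alpha> * ?q - (real DIM('a) + 2)" by simp
      moreover have "0 \<le> s y" using y by (simp add: s_def D_def)
      ultimately show ?thesis using \<alpha> by simp
    qed
    finally show ?thesis .
  qed
  have "superharmonic_on (\<lambda>y. (- k0) * (s y * E y)) D"
    unfolding superharmonic_on_def
    apply (rule exI, rule exI, rule conjI, rule has_hessian_cmult[OF hm])
    unfolding lin_trace_cmult using tr k0(1) by (auto intro: mult_nonneg_nonneg)
  then have sh2: "superharmonic_on (\<lambda>y. f y + (- k0) * (s y * E y)) D"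
    by (intro superharmonic_on_add superharmonic_on_subset[OF sh]) (auto simp: D_def H)
  have E1: "E x \<le> 1" for x
  proof -
    have "exp (- \<alpha> * ((x - p) \<bullet> (x - p))) \<le> 1" using \<alpha> by simp
    then show ?thesis unfolding E_def e0_def using exp_gt_zero[of "- \<alpha> * r\<^sup>2"] by linarith
  qed
  have oD: "open D" unfolding D_def
    by (intro open_Collect_conj open_Collect_less continuous_intros)
  \<comment> \<open>Below radius \<open>3*r/4\<close> the linear bound takes over because
    \<open>E \<le> 1\<close>; this overlaps with \<open>D\<close>, so inner frontier points have a
    full neighbourhood. At the other frontier points \<open>s * E\<close> vanishes: \<open>E\<close>
    on the sphere, \<open>s\<close> on the flat part.\<close>
  have key: "0 \<le> f y + (- k0) * (s y * E y)" if y: "y \<in> D" for y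
  proof (rule minimum_principle[OF sh2 oD _ _ y])
    show "bounded D" by (rule bounded_subset[OF bounded_ball[of p r]]) (auto simp: D_def)
    fix z :: 'a and \<epsilon> :: real assume z: "z \<in> frontier D" and \<epsilon>: "\<epsilon> > 0"
    have "closed {y. (r/2 \<le> dist p y \<and> dist p y \<le> r) \<and> (y - p) \<bullet> e \<le> 0}"
      by (intro closed_Collect_conj closed_Collect_le continuous_intros)
    then have "closure D \<subseteq> {y. (r/2 \<le> dist p y \<and> dist p y \<le> r) \<and> (y - p) \<bullet> e \<le> 0}"
      by (intro closure_minimal) (auto simp: D_def)
    then have z1: "dist p z \<le> r" "(z - p) \<bullet> e \<le> 0" using z by (auto simp: frontier_def)
    have zD: "z \<notin> D" using z oD by (simp add: frontier_def interior_open)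
    show "\<exists>\<delta>>0. \<forall>x\<in>D \<inter> ball z \<delta>. - \<epsilon> \<le> f x + (- k0) * (s x * E x)"
    proof (cases "dist p z < 3*r/4")
      case True
      show ?thesis
      proof (intro exI[of _ "3*r/4 - dist p z"] conjI ballI)
        fix x assume x: "x \<in> D \<inter> ball z (3*r/4 - dist p z)"
        then have "dist p x \<le> 3*r/4" using dist_triangle[of p x z] by (auto simp: dist_commute)
        moreover have "x \<in> H" using x by (auto simp: D_def H)
        ultimately have "k0 * s x \<le> f x" using k0(2) by (simp add: s_def)
        moreover have "0 \<le> s x" using x by (auto simp: s_def D_def)
        then have "k0 * (s x * E x) \<le> k0 * (s x * 1)"
          using k0(1) E1[of x] by (intro mult_left_mono) auto
        ultimately show "- \<epsilon> \<le> f x + (- k0) * (s x * E x)" using \<epsilon> by simp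
      qed (use True in auto)
    next
      case False
      then have "dist p z = r \<or> (z - p) \<bullet> e = 0" using z1 zD r by (auto simp: D_def)
      then have z0: "k0 * (s z * E z) = 0" by (auto simp: E_def e0_def sq s_def)
      have "continuous_on UNIV (\<lambda>x. k0 * (s x * E x))" unfolding E_def s_def by (intro continuous_intros)
      then have "isCont (\<lambda>x. k0 * (s x * E x)) z" by (simp add: continuous_on_eq_continuous_at)
      then obtain \<delta> where \<delta>: "\<delta> > 0"
        "\<forall>x. dist x z < \<delta> \<longrightarrow> dist (k0 * (s x * E x)) (k0 * (s z * E z)) < \<epsilon>"
        unfolding continuous_at_eps_delta using \<epsilon> by blast
      show ?thesis
      proof (intro exI[of _ \<delta>] conjI ballI)
        fix x assume x: "x \<in> D \<inter> ball z \<delta>"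
        then have "dist (k0 * (s x * E x)) 0 < \<epsilon>"
          using \<delta>(2)[rule_format, of x] z0 by (simp add: dist_commute)
        then have "k0 * (s x * E x) < \<epsilon>" by (simp add: dist_real_def)
        moreover have "0 < f x" using pos x by (auto simp: D_def H)
        ultimately show "- \<epsilon> \<le> f x + (- k0) * (s x * E x)" by simp
      qed (use \<delta> in auto)
    qed
  qed
  define k where "k = k0 * (e0 * \<alpha> * r)"
  have k: "k > 0" using k0(1) \<alpha> r by (simp add: k_def e0_def)
  have "k * (- ((y - p) \<bullet> e)) * (r - dist p y) \<le> f y" if y: "y \<in> H" "r/2 < dist p y" for y
  proof -
    have yD: "y \<in> D" using y by (simp add: H D_def)
    have s0: "0 \<le> s y" using y by (simp add: s_def H)
    have "E y \<ge> e0 * (\<alpha> * (r\<^sup>2 - (dist p y)\<^sup>2))"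
      using exp_gap_lower[of \<alpha> "r\<^sup>2" "(dist p y)\<^sup>2"] by (simp add: E_def e0_def sq)
    also have "r\<^sup>2 - (dist p y)\<^sup>2 = (r + dist p y) * (r - dist p y)"
      by (simp add: power2_eq_square algebra_simps)
    finally have "E y \<ge> e0 * \<alpha> * (r + dist p y) * (r - dist p y)" by (simp add: algebra_simps)
    moreover have "e0 * \<alpha> * r * (r - dist p y) \<le> e0 * \<alpha> * (r + dist p y) * (r - dist p y)"
      using \<alpha> y by (intro mult_right_mono mult_left_mono) (auto simp: e0_def H)
    ultimately have "e0 * \<alpha> * r * (r - dist p y) \<le> E y" by simp
    then have "k0 * (s y * (e0 * \<alpha> * r * (r - dist p y))) \<le> k0 * (s y * E y)"
      using s0 k0(1) by (intro mult_left_mono) auto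
    also have "\<dots> \<le> f y" using key[OF yD] by simp
    finally show ?thesis by (simp add: k_def s_def algebra_simps)
  qed
  then show ?thesis using k by blast
qed

section \<open>Second-order expansions and interior balls of superlevel sets\<close>

lemma gradient_expansion:
  assumes "has_hessian f F A S" "x \<in> S" "e > 0"
  shows "\<exists>\<delta>>0. \<forall>y. norm (y - x) < \<delta> \<longrightarrow> norm (F y - F x - A x (y - x)) \<le> e * norm (y - x)"
  using assms unfolding has_hessian_def has_derivative_at_alt by auto

text \<open>The mean value theorem in direction \<open>h\<close> turns the second difference into a
  difference of gradients at two nearby points, and differentiability of \<open>F\<close> at
  \<open>x\<close> evaluates it to first order in \<open>t\<close>.\<close>

lemma second_difference:
  assumes hess: "has_hessian f F A S" and "open S" "x \<in> S" "e > 0"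
  shows "\<exists>\<delta>>0. \<forall>t. 0 < t \<and> t < \<delta> \<longrightarrow>
    \<bar>f (x + t *\<^sub>R k + t *\<^sub>R h) - f (x + t *\<^sub>R h) - f (x + t *\<^sub>R k) + f x - t * t * (A x k \<bullet> h)\<bar> \<le> e * (t * t)"
proof -
  define C where "C = norm k + norm h + 1"
  have C: "C > 0" unfolding C_def by (intro add_nonneg_pos add_nonneg_nonneg) auto
  \<comment> \<open>Each of the two remainders of \<open>F\<close> is at most
    \<open>e' * t * C\<close>; pairing with \<open>h\<close> and multiplying by \<open>t\<close>
    gives \<open>2 * e' * C * C * t * t\<close>, which is to equal \<open>e * t * t\<close>.\<close>
  define e' where "e' = e / (2 * C * C)"
  have e': "e' > 0" using assms(4) C by (simp add: e'_def)
  obtain \<delta> where \<delta>: "\<delta> > 0" "\<And>y. norm (y - x) < \<delta> \<Longrightarrow> norm (F y - F x - A x (y - x)) \<le> e' * norm (y - x)"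
    using gradient_expansion[OF hess assms(3) e'] by blast
  obtain r where r: "r > 0" "ball x r \<subseteq> S" using assms(2,3) open_contains_ball by blast
  have lin: "linear (A x)" using has_hessian_linear[OF hess assms(3)] .
  define \<delta>' where "\<delta>' = min \<delta> r / C"
  have "\<bar>f (x + t *\<^sub>R k + t *\<^sub>R h) - f (x + t *\<^sub>R h) - f (x + t *\<^sub>R k) + f x - t * t * (A x k \<bullet> h)\<bar> \<le> e * (t * t)"
    if t: "0 < t" "t < \<delta>'" for t
  proof -
    have tC: "t * C < \<delta>" "t * C < r"
      using t C by (auto simp: \<delta>'_def min_def field_simps split: if_splits)
    have n1: "norm (t *\<^sub>R k + s *\<^sub>R h) \<le> t * C" "norm (s *\<^sub>R h) \<le> t * C" if "0 \<le> s" "s \<le> t" for s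
    proof -
      have "norm (s *\<^sub>R h) \<le> t * norm h" using that by (simp add: mult_right_mono)
      moreover have "norm (t *\<^sub>R k + s *\<^sub>R h) \<le> t * norm k + norm (s *\<^sub>R h)"
        using norm_triangle_ineq[of "t *\<^sub>R k" "s *\<^sub>R h"] t by simp
      moreover have "0 \<le> t * norm k" using t by simp
      moreover have "t * C = t * norm k + t * norm h + t" by (simp add: C_def algebra_simps)
      ultimately show "norm (t *\<^sub>R k + s *\<^sub>R h) \<le> t * C" "norm (s *\<^sub>R h) \<le> t * C"
        using t by linarith+
    qed
    have inS: "x + t *\<^sub>R k + s *\<^sub>R h \<in> S" "x + s *\<^sub>R h \<in> S" if "0 \<le> s" "s \<le> t" for s
    proof -
      have "norm (t *\<^sub>R k + s *\<^sub>R h) < r" "norm (s *\<^sub>R h) < r" using n1[OF that] tC(2) by linarith+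
      moreover have "x + w \<in> ball x r" if "norm w < r" for w using that by (simp add: dist_norm)
      ultimately have "x + (t *\<^sub>R k + s *\<^sub>R h) \<in> ball x r" "x + s *\<^sub>R h \<in> ball x r" by blast+
      then show "x + t *\<^sub>R k + s *\<^sub>R h \<in> S" "x + s *\<^sub>R h \<in> S" using r(2) by (auto simp: add.assoc)
    qed
    let ?\<psi> = "\<lambda>s. f (x + t *\<^sub>R k + s *\<^sub>R h) - f (x + s *\<^sub>R h)"
    have "\<exists>z. 0 < z \<and> z < t \<and> ?\<psi> t - ?\<psi> 0 = (t - 0) * (F (x + t *\<^sub>R k + z *\<^sub>R h) \<bullet> h - F (x + z *\<^sub>R h) \<bullet> h)"
      using t inS
      by (intro MVT2) (auto intro!: DERIV_diff has_hessian_line(1)[OF hess])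
    then obtain s where s: "0 < s" "s < t"
      "?\<psi> t - ?\<psi> 0 = t * (F (x + t *\<^sub>R k + s *\<^sub>R h) \<bullet> h - F (x + s *\<^sub>R h) \<bullet> h)" by auto
    define u where "u = F (x + t *\<^sub>R k + s *\<^sub>R h) - F x - A x (t *\<^sub>R k + s *\<^sub>R h)"
    define v where "v = F (x + s *\<^sub>R h) - F x - A x (s *\<^sub>R h)"
    have u: "norm u \<le> e' * (t * C)"
    proof -
      have "norm u \<le> e' * norm (t *\<^sub>R k + s *\<^sub>R h)"
        using \<delta>(2)[of "x + t *\<^sub>R k + s *\<^sub>R h"] n1(1)[of s] s tC by (simp add: u_def add.assoc)
      also have "\<dots> \<le> e' * (t * C)" using n1(1)[of s] s e' by (intro mult_left_mono) auto
      finally show ?thesis .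
    qed
    have v: "norm v \<le> e' * (t * C)"
    proof -
      have "norm v \<le> e' * norm (s *\<^sub>R h)"
        using \<delta>(2)[of "x + s *\<^sub>R h"] n1(2)[of s] s tC by (simp add: v_def)
      also have "\<dots> \<le> e' * (t * C)" using n1(2)[of s] s e' by (intro mult_left_mono) auto
      finally show ?thesis .
    qed
    have "F (x + t *\<^sub>R k + s *\<^sub>R h) - F (x + s *\<^sub>R h) = t *\<^sub>R A x k + u - v"
      using lin by (simp add: u_def v_def linear_add linear_cmul)
    then have "?\<psi> t - ?\<psi> 0 = t * ((t *\<^sub>R A x k + u - v) \<bullet> h)"
      using s(3) by (metis inner_diff_left)
    then have "?\<psi> t - ?\<psi> 0 - t * t * (A x k \<bullet> h) = t * ((u - v) \<bullet> h)"
      by (simp add: inner_add_left inner_diff_left algebra_simps)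
    moreover have "\<bar>(u - v) \<bullet> h\<bar> \<le> (2 * (e' * (t * C))) * C"
    proof -
      have "\<bar>(u - v) \<bullet> h\<bar> \<le> norm (u - v) * norm h" by (rule Cauchy_Schwarz_ineq2)
      also have "\<dots> \<le> (2 * (e' * (t * C))) * C"
        using norm_triangle_ineq4[of u v] u v e' t C
        by (intro mult_mono) (auto simp: C_def)
      finally show ?thesis .
    qed
    then have "t * \<bar>(u - v) \<bullet> h\<bar> \<le> t * ((2 * (e' * (t * C))) * C)" using t by (intro mult_left_mono) auto
    moreover have "t * ((2 * (e' * (t * C))) * C) = e * (t * t)" using C by (simp add: e'_def)
    moreover have "\<bar>t * ((u - v) \<bullet> h)\<bar> = t * \<bar>(u - v) \<bullet> h\<bar>" using t by (simp add: abs_mult)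
    moreover have "f (x + t *\<^sub>R k + t *\<^sub>R h) - f (x + t *\<^sub>R h) - f (x + t *\<^sub>R k) + f x = ?\<psi> t - ?\<psi> 0"
      by simp
    ultimately show ?thesis by metis
  qed
  moreover have "\<delta>' > 0" using \<delta> r C by (simp add: \<delta>'_def)
  ultimately show ?thesis by blast
qed

text \<open>The second difference does not change when \<open>h\<close> and \<open>k\<close> are
  exchanged, and it approximates both sides to any precision; a third of a supposed gap is
  enough.\<close>

lemma hessian_symmetric:
  assumes "has_hessian f F A S" "open S" "x \<in> S"
  shows "A x h \<bullet> k = A x k \<bullet> h"
proof (rule ccontr)
  assume "A x h \<bullet> k \<noteq> A x k \<bullet> h"
  define e where "e = \<bar>A x h \<bullet> k - A x k \<bullet> h\<bar> / 3"
  have e: "e > 0" using \<open>A x h \<bullet> k \<noteq> A x k \<bullet> h\<close> by (simp add: e_def)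
  obtain d1 where d1: "d1 > 0" "\<And>t. 0 < t \<and> t < d1 \<Longrightarrow>
    \<bar>f (x + t *\<^sub>R k + t *\<^sub>R h) - f (x + t *\<^sub>R h) - f (x + t *\<^sub>R k) + f x - t * t * (A x k \<bullet> h)\<bar> \<le> e * (t * t)"
    using second_difference[OF assms e] by blast
  obtain d2 where d2: "d2 > 0" "\<And>t. 0 < t \<and> t < d2 \<Longrightarrow>
    \<bar>f (x + t *\<^sub>R h + t *\<^sub>R k) - f (x + t *\<^sub>R k) - f (x + t *\<^sub>R h) + f x - t * t * (A x h \<bullet> k)\<bar> \<le> e * (t * t)"
    using second_difference[OF assms e] by blast
  define t where "t = min d1 d2 / 2"
  have t: "0 < t" "t < d1" "t < d2" using d1 d2 by (auto simp: t_def)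
  have eq: "x + t *\<^sub>R h + t *\<^sub>R k = x + t *\<^sub>R k + t *\<^sub>R h" by (simp add: algebra_simps)
  have "\<bar>t * t * (A x h \<bullet> k) - t * t * (A x k \<bullet> h)\<bar> \<le> 2 * (e * (t * t))"
    using d1(2)[of t] d2(2)[of t] t unfolding eq by linarith
  moreover have "t * t * (A x h \<bullet> k) - t * t * (A x k \<bullet> h) = t * t * (A x h \<bullet> k - A x k \<bullet> h)"
    by (simp add: algebra_simps)
  moreover have "\<bar>t * t * (A x h \<bullet> k - A x k \<bullet> h)\<bar> = t * t * (3 * e)" by (simp add: abs_mult e_def)
  ultimately have "t * t * (3 * e) \<le> t * t * (2 * e)" by (simp add: mult.commute mult.left_commute)
  then show False using t e by simp
qed

text \<open>In a ball of radius \<open>r\<close> touching \<open>x\<close> with inward normal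
  \<open>n\<close>, a displacement \<open>h\<close> satisfies |h|^2 < 2 r (h . n). The second-order
  error, of size K |h|^2, is therefore dominated by the first-order gain |F x| (h . n) once
  \<open>r\<close> is at most |F x| / (4 K).\<close>

lemma interior_ball:
  fixes f :: "'a::euclidean_space \<Rightarrow> real"
  assumes hess: "has_hessian f F A S" and "open S" "x \<in> S" and nz: "F x \<noteq> 0"
  shows "\<exists>r0>0. \<forall>r. 0 < r \<and> r \<le> r0 \<longrightarrow> (\<forall>y\<in>ball (x + r *\<^sub>R sgn (F x)) r. f x < f y)"
proof -
  obtain \<delta> where \<delta>: "\<delta> > 0" "\<And>y. norm (y - x) < \<delta> \<Longrightarrow> norm (F y - F x - A x (y - x)) \<le> 1 * norm (y - x)"
    using gradient_expansion[OF hess assms(3), of 1] by auto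
  obtain r1 where r1: "r1 > 0" "ball x r1 \<subseteq> S" using assms(2,3) open_contains_ball by blast
  have "bounded_linear (A x)" using hess assms(3) unfolding has_hessian_def
    using has_derivative_bounded_linear by blast
  then obtain B where B: "B > 0" "\<And>h. norm (A x h) \<le> norm h * B"
    using bounded_linear.pos_bounded by blast
  define K where "K = B + 1"
  have FK: "norm (F y - F x) \<le> K * norm (y - x)" if "norm (y - x) < \<delta>" for y
    using \<delta>(2)[OF that] B(2)[of "y - x"] norm_triangle_ineq[of "F y - F x - A x (y - x)" "A x (y - x)"]
    by (simp add: K_def algebra_simps)
  define n where "n = sgn (F x)"
  have n: "norm n = 1" using nz by (simp add: n_def norm_sgn)
  have Fn: "F x = norm (F x) *\<^sub>R n" using nz by (simp add: n_def sgn_div_norm)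
  define r0 where "r0 = min (min \<delta> r1 / 4) (norm (F x) / (4 * K))"
  have K: "K > 0" using B by (simp add: K_def)
  have "f x < f y" if r: "0 < r" "r \<le> r0" and y: "y \<in> ball (x + r *\<^sub>R n) r" for r y
  proof -
    define h where "h = y - x"
    have rr: "2 * r < \<delta>" "2 * r < r1" "4 * K * r \<le> norm (F x)"
      using r \<delta>(1) r1(1) K by (auto simp: r0_def field_simps)
    have hn: "norm (h - r *\<^sub>R n) < r" using y by (simp add: h_def dist_norm norm_minus_commute algebra_simps)
    have "norm h \<le> norm (h - r *\<^sub>R n) + norm (r *\<^sub>R n)" using norm_triangle_ineq[of "h - r *\<^sub>R n" "r *\<^sub>R n"] by simp
    then have h2: "norm h < 2 * r" using hn n r by simp
    have "(norm (h - r *\<^sub>R n))\<^sup>2 < r\<^sup>2" using hn r by (intro power_strict_mono) auto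
    moreover have "(norm (h - r *\<^sub>R n))\<^sup>2 = (norm h)\<^sup>2 - 2 * r * (h \<bullet> n) + r\<^sup>2"
      using n unfolding power2_norm_eq_inner norm_eq_1
      by (simp add: inner_diff_left inner_diff_right inner_commute[of n h] power2_eq_square[of r]
          algebra_simps)
    ultimately have hh: "(norm h)\<^sup>2 < 2 * r * (h \<bullet> n)" by simp
    have hpos: "h \<bullet> n > 0"
    proof (rule ccontr)
      assume "\<not> h \<bullet> n > 0"
      then have "2 * r * (h \<bullet> n) \<le> 0" using r by (simp add: mult_nonneg_nonpos)
      then show False using hh zero_le_power2[of "norm h"] by linarith
    qed
    have inS: "x + s *\<^sub>R h \<in> S" and nd: "norm (x + s *\<^sub>R h - x) < \<delta>" if "0 \<le> s" "s \<le> 1" for s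
    proof -
      have "norm (s *\<^sub>R h) \<le> norm h" using that by (simp add: mult_left_le_one_le)
      then have "norm (s *\<^sub>R h) < r1" "norm (s *\<^sub>R h) < \<delta>" using h2 rr by linarith+
      then show "x + s *\<^sub>R h \<in> S" "norm (x + s *\<^sub>R h - x) < \<delta>"
        using r1(2) by (auto intro!: subsetD[OF r1(2)] simp: dist_norm)
    qed
    have "\<exists>z. 0 < z \<and> z < 1 \<and> f (x + 1 *\<^sub>R h) - f (x + 0 *\<^sub>R h) = (1 - 0) * (F (x + z *\<^sub>R h) \<bullet> h)"
      using inS by (intro MVT2[where f = "\<lambda>s. f (x + s *\<^sub>R h)"]) (auto intro!: has_hessian_line(1)[OF hess])
    then obtain s where s: "0 < s" "s < 1" "f y - f x = F (x + s *\<^sub>R h) \<bullet> h" by (auto simp: h_def)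
    have "\<bar>(F (x + s *\<^sub>R h) - F x) \<bullet> h\<bar> \<le> norm (F (x + s *\<^sub>R h) - F x) * norm h"
      by (rule Cauchy_Schwarz_ineq2)
    also have "\<dots> \<le> (K * norm h) * norm h"
    proof (rule mult_right_mono)
      have "norm (F (x + s *\<^sub>R h) - F x) \<le> K * norm (x + s *\<^sub>R h - x)" by (rule FK) (use nd[of s] s in simp)
      also have "\<dots> \<le> K * norm h" using s K by (simp add: mult_left_le_one_le)
      finally show "norm (F (x + s *\<^sub>R h) - F x) \<le> K * norm h" .
    qed simp
    also have "\<dots> = K * (norm h)\<^sup>2" by (simp add: power2_eq_square)
    also have "\<dots> \<le> K * (2 * r * (h \<bullet> n))" using hh K by (intro mult_left_mono) auto
    also have "\<dots> = (4 * K * r) * (h \<bullet> n) / 2" by simp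
    also have "\<dots> \<le> norm (F x) * (h \<bullet> n) / 2" using rr(3) hpos by (intro divide_right_mono mult_right_mono) auto
    finally have "F (x + s *\<^sub>R h) \<bullet> h \<ge> F x \<bullet> h - norm (F x) * (h \<bullet> n) / 2"
      unfolding inner_diff_left by linarith
    moreover have "F x \<bullet> h = norm (F x) * (h \<bullet> n)" by (subst Fn) (simp add: inner_commute)
    moreover have "norm (F x) * (h \<bullet> n) > 0" using nz hpos by simp
    ultimately show ?thesis using s(3) by linarith
  qed
  moreover have "r0 > 0" using \<delta> r1 nz K by (simp add: r0_def)
  ultimately show ?thesis unfolding n_def by blast
qed

section \<open>Reflections\<close>

text \<open>Adding \<epsilon> / |x| makes the function positive near the origin, whatever the lower
  bound \<open>C\<close>, so the origin becomes a harmless frontier point. The added term disappears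
  as \<epsilon> tends to 0 with \<open>x0\<close> fixed.\<close>

lemma minimum_principle_punctured:
  fixes f :: "'a::euclidean_space \<Rightarrow> real"
  assumes dim: "DIM('a) \<ge> 3" and sh: "superharmonic_on f (D - {0})" and D: "open D" "bounded D"
    and bd: "\<And>z e. z \<in> frontier D \<Longrightarrow> z \<noteq> 0 \<Longrightarrow> e > 0 \<Longrightarrow> \<exists>\<delta>>0. \<forall>x\<in>(D - {0}) \<inter> ball z \<delta>. f x \<ge> - e"
    and low: "r > 0" "\<And>x. x \<in> D - {0} \<Longrightarrow> norm x < r \<Longrightarrow> C \<le> f x"
    and x0: "x0 \<in> D - {0}"
  shows "0 \<le> f x0"
proof -
  have "- \<epsilon> * inverse (norm x0) \<le> f x0" if \<epsilon>: "\<epsilon> > 0" for \<epsilon>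
  proof -
    have "0 \<le> f x0 + \<epsilon> * inverse (norm x0)"
    proof (rule minimum_principle[where D = "D - {0}"])
      show "superharmonic_on (\<lambda>x. f x + \<epsilon> * inverse (norm x)) (D - {0})"
        using \<epsilon> by (intro superharmonic_on_add sh superharmonic_on_cmult superharmonic_on_inverse_norm dim) auto
      show "open (D - {0})" "bounded (D - {0})" using D by (auto intro: bounded_subset)
      fix z :: 'a and e :: real assume z: "z \<in> frontier (D - {0})" and e: "e > 0"
      show "\<exists>\<delta>>0. \<forall>x\<in>(D - {0}) \<inter> ball z \<delta>. - e \<le> f x + \<epsilon> * inverse (norm x)"
      proof (cases "z = 0")
        case True
        show ?thesis
        \<comment> \<open>Within this radius \<epsilon> / |x| exceeds
          \<open>\<bar>C\<bar> + 1\<close> and outweighs the lower bound \<open>C\<close>.\<close>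
        proof (intro exI[of _ "min r (\<epsilon> / (\<bar>C\<bar> + 1))"] conjI ballI)
          fix x assume x: "x \<in> (D - {0}) \<inter> ball z (min r (\<epsilon> / (\<bar>C\<bar> + 1)))"
          then have "norm x < r" "norm x < \<epsilon> / (\<bar>C\<bar> + 1)" "norm x > 0" using True by auto
          then have "\<bar>C\<bar> + 1 < \<epsilon> * inverse (norm x)" by (simp add: field_simps)
          moreover have "C \<le> f x" using low(2) x \<open>norm x < r\<close> by blast
          ultimately show "- e \<le> f x + \<epsilon> * inverse (norm x)" using e by linarith
        qed (use low(1) \<epsilon> in auto)
      next
        case False
        have "z \<notin> D - {0}" using z \<open>open (D - {0})\<close> by (simp add: frontier_def interior_open)
        moreover have "z \<in> closure D" using z closure_mono[of "D - {0}" D] by (auto simp: frontier_def)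
        ultimately have "z \<in> frontier D" using False D(1) by (simp add: frontier_def interior_open)
        then obtain \<delta> where \<delta>: "\<delta> > 0" "\<forall>x\<in>(D - {0}) \<inter> ball z \<delta>. f x \<ge> - e"
          using bd False e by blast
        have "\<forall>x\<in>(D - {0}) \<inter> ball z \<delta>. - e \<le> f x + \<epsilon> * inverse (norm x)"
        proof
          fix x assume "x \<in> (D - {0}) \<inter> ball z \<delta>"
          then have "f x \<ge> - e" using \<delta> by blast
          moreover have "\<epsilon> * inverse (norm x) \<ge> 0" using \<epsilon> by simp
          ultimately show "- e \<le> f x + \<epsilon> * inverse (norm x)" by linarith
        qed
        then show ?thesis using \<delta>(1) by blast
      qed
    qed (use x0 in auto)
    then show ?thesis by simp
  qed
  note * = this
  show ?thesis
  proof (rule ccontr)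
    assume "\<not> 0 \<le> f x0"
    define \<epsilon> where "\<epsilon> = - f x0 * norm x0 / 2"
    have "\<epsilon> > 0" using \<open>\<not> 0 \<le> f x0\<close> x0 by (simp add: \<epsilon>_def mult_neg_pos)
    from *[OF this] show False using \<open>\<not> 0 \<le> f x0\<close> x0 by (simp add: \<epsilon>_def field_simps)
  qed
qed

text \<open>The zero set is open by the local version and its complement is open by
  continuity.\<close>

lemma strong_minimum_principle_connected:
  fixes S :: "'a::euclidean_space set"
  assumes sh: "superharmonic_on f S" and S: "open S" "connected S"
    and nn: "\<And>y. y \<in> S \<Longrightarrow> 0 \<le> f y" and q: "q \<in> S" "f q = 0" and p: "p \<in> S"
  shows "f p = 0"
proof (rule ccontr)
  assume "f p \<noteq> 0"
  have cont: "continuous_on S f" using superharmonic_on_continuous[OF sh] .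
  define P where "P = {x\<in>S. f x \<noteq> 0}"
  define Z where "Z = {x\<in>S. f x = 0}"
  have "P = S \<inter> f -` (- {0})" by (auto simp: P_def)
  then have oP: "open P" using continuous_open_preimage[OF cont S(1) open_Compl[OF closed_singleton[of 0]]] by simp
  have oZ: "open Z"
    unfolding open_contains_ball
  proof
    fix x assume x: "x \<in> Z"
    then have "x \<in> S" by (simp add: Z_def)
    then obtain R where R: "R > 0" "ball x R \<subseteq> S" using S(1) open_contains_ball by blast
    have "ball x (R/2) \<subseteq> Z"
    proof
      fix y assume y: "y \<in> ball x (R/2)"
      have "f y = 0"
        by (rule strong_minimum_principle[OF superharmonic_on_subset[OF sh R(2)] _ _ y])
          (use nn R x in \<open>auto simp: Z_def\<close>)
      moreover have "y \<in> S" using y R by auto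
      ultimately show "y \<in> Z" by (simp add: Z_def)
    qed
    then show "\<exists>e>0. ball x e \<subseteq> Z" using R(1) half_gt_zero by blast
  qed
  have "P \<inter> Z \<inter> S = {}" "S \<subseteq> P \<union> Z" by (auto simp: P_def Z_def)
  then have "P \<inter> S = {} \<or> Z \<inter> S = {}" using connectedD[OF S(2) oP oZ] by blast
  moreover have "p \<in> P" using p \<open>f p \<noteq> 0\<close> by (simp add: P_def)
  moreover have "q \<in> Z" using q by (simp add: Z_def)
  ultimately show False using p q by blast
qed

section \<open>Reflection in a hyperplane and its linear part\<close>

definition refl_vec :: "'a::euclidean_space \<Rightarrow> 'a \<Rightarrow> 'a" where
  "refl_vec e v = v - (2 * (v \<bullet> e)) *\<^sub>R e"

definition reflect :: "'a::euclidean_space \<Rightarrow> real \<Rightarrow> 'a \<Rightarrow> 'a" where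
  "reflect e \<mu> x = x + (2 * (\<mu> - x \<bullet> e)) *\<^sub>R e"

lemma reflect_add: "reflect e \<mu> (x + v) = reflect e \<mu> x + refl_vec e v"
  by (simp add: reflect_def refl_vec_def algebra_simps)

lemma refl_vec_scaleR: "refl_vec e (t *\<^sub>R v) = t *\<^sub>R refl_vec e v"
  by (simp add: refl_vec_def algebra_simps)

lemma reflect_fixed: "x \<bullet> e = \<mu> \<Longrightarrow> reflect e \<mu> x = x"
  by (simp add: reflect_def)

context
  fixes e :: "'a::euclidean_space"
  assumes e: "norm e = 1"
begin

lemma inner_unit_self: "e \<bullet> e = 1" using e by (simp add: dot_square_norm)

lemma refl_vec_inner: "refl_vec e v \<bullet> w = v \<bullet> refl_vec e w"
  by (simp add: refl_vec_def inner_diff_left inner_diff_right inner_commute)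

lemma refl_vec_refl_vec: "refl_vec e (refl_vec e v) = v"
  by (simp add: refl_vec_def algebra_simps inner_unit_self)

lemma norm_refl_vec: "norm (refl_vec e v) = norm v"
  using refl_vec_inner[of v "refl_vec e v"] by (simp add: refl_vec_refl_vec norm_eq_sqrt_inner)

lemma reflect_reflect: "reflect e \<mu> (reflect e \<mu> x) = x"
  by (simp add: reflect_def algebra_simps inner_unit_self)

lemma reflect_inner: "reflect e \<mu> x \<bullet> e = 2 * \<mu> - x \<bullet> e"
  by (simp add: reflect_def algebra_simps inner_unit_self)

lemma reflect_diff: "reflect e \<mu> x - reflect e \<mu> y = refl_vec e (x - y)"
  by (simp add: reflect_def refl_vec_def algebra_simps)

lemma dist_reflect: "dist (reflect e \<mu> x) (reflect e \<mu> y) = dist x y"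
  by (simp add: dist_norm reflect_diff norm_refl_vec)

lemma bounded_linear_refl_vec: "bounded_linear (refl_vec e)"
  unfolding refl_vec_def by (intro bounded_linear_intros)

text \<open>Invariance of the trace under conjugation by an orthogonal involution, by direct
  expansion: the correction terms sum to -2, -2 and +4 times \<open>B e \<bullet> e\<close>. It
  makes \<open>G\<close> composed with the reflection harmonic again.\<close>

lemma lin_trace_refl_vec:
  assumes "linear B"
  shows "lin_trace (\<lambda>h. refl_vec e (B (refl_vec e h))) = lin_trace B"
proof -
  have "refl_vec e (B (refl_vec e b)) \<bullet> b =
     B b \<bullet> b - 2 * ((b \<bullet> e) * (B b \<bullet> e)) - 2 * ((e \<bullet> b) * (B e \<bullet> b)) + 4 * ((e \<bullet> b) * (e \<bullet> b)) * (B e \<bullet> e)" for b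
  proof -
    have 1: "refl_vec e (B (refl_vec e b)) \<bullet> b = B (refl_vec e b) \<bullet> refl_vec e b"
      by (rule refl_vec_inner)
    have 2: "B (refl_vec e b) = B b - (2 * (b \<bullet> e)) *\<^sub>R B e"
      using assms by (simp add: refl_vec_def linear_diff linear_cmul)
    have "(B b - (2 * (b \<bullet> e)) *\<^sub>R B e) \<bullet> refl_vec e b =
        B b \<bullet> b - 2 * ((b \<bullet> e) * (B b \<bullet> e)) - 2 * ((e \<bullet> b) * (B e \<bullet> b)) + 4 * ((e \<bullet> b) * (e \<bullet> b)) * (B e \<bullet> e)"
      by (simp add: refl_vec_def inner_diff_left inner_diff_right inner_commute algebra_simps)
    with 1 2 show ?thesis by metis
  qed
  moreover have "(\<Sum>b\<in>Basis. (b \<bullet> e) * (B b \<bullet> e)) = B e \<bullet> e"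
  proof -
    have "B e = B (\<Sum>b\<in>Basis. (e \<bullet> b) *\<^sub>R b)" by (simp add: euclidean_representation)
    also have "\<dots> = (\<Sum>b\<in>Basis. (e \<bullet> b) *\<^sub>R B b)"
      using assms by (simp add: linear_sum linear_cmul)
    finally have "B e \<bullet> e = (\<Sum>b\<in>Basis. (e \<bullet> b) *\<^sub>R B b) \<bullet> e" by simp
    then show ?thesis by (simp only: inner_sum_left inner_scaleR_left inner_commute[of e])
  qed
  moreover have "(\<Sum>b\<in>Basis. (e \<bullet> b) * (B e \<bullet> b)) = B e \<bullet> e"
    by (metis euclidean_inner inner_commute)
  moreover have "(\<Sum>b\<in>Basis. (e \<bullet> b) * (e \<bullet> b)) = 1"
    by (metis euclidean_inner inner_unit_self)
  ultimately show ?thesis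
    by (simp add: lin_trace_def sum.distrib sum_subtractf sum_distrib_left[symmetric] sum_distrib_right[symmetric])
qed

lemma has_derivative_reflect: "(reflect e \<mu> has_derivative refl_vec e) (at x)"
  unfolding reflect_def[abs_def] refl_vec_def[abs_def]
  by (auto intro!: derivative_eq_intros simp: algebra_simps)

lemma continuous_on_reflect: "continuous_on S (reflect e \<mu>)"
  unfolding reflect_def[abs_def] by (intro continuous_intros)

lemma has_hessian_reflect:
  assumes "has_hessian f F A S" "\<And>x. x \<in> T \<Longrightarrow> reflect e \<mu> x \<in> S"
  shows "has_hessian (\<lambda>x. f (reflect e \<mu> x)) (\<lambda>x. refl_vec e (F (reflect e \<mu> x)))
     (\<lambda>x h. refl_vec e (A (reflect e \<mu> x) (refl_vec e h))) T"
  unfolding has_hessian_def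
proof (intro ballI conjI)
  fix x assume "x \<in> T"
  then have f: "(f has_derivative (\<lambda>h. F (reflect e \<mu> x) \<bullet> h)) (at (reflect e \<mu> x))"
    and F: "(F has_derivative A (reflect e \<mu> x)) (at (reflect e \<mu> x))"
    using assms unfolding has_hessian_def by auto
  show "((\<lambda>x. f (reflect e \<mu> x)) has_derivative (\<lambda>h. refl_vec e (F (reflect e \<mu> x)) \<bullet> h)) (at x)"
    unfolding refl_vec_inner using has_derivative_compose[OF has_derivative_reflect f] .
  show "((\<lambda>x. refl_vec e (F (reflect e \<mu> x))) has_derivative
      (\<lambda>h. refl_vec e (A (reflect e \<mu> x) (refl_vec e h)))) (at x)"
    using bounded_linear.has_derivative[OF bounded_linear_refl_vec has_derivative_compose[OF has_derivative_reflect F]] .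
qed

end

section \<open>The overdetermined problem\<close>

text \<open>\<open>G\<close> stands for an extension of \<open>u\<close> across the boundary, with
  gradient \<open>F\<close> and Hessian \<open>A\<close>; the equation survives as
  \<open>harmonic\<close> and \<open>lower\<close>. The gradient condition is left to a second
  locale, because showing that the boundary is a level set already uses \<open>G_ge\<close>.\<close>

locale green_domain =
  fixes \<Omega> :: "'a::euclidean_space set" and U :: "'a set" and G :: "'a \<Rightarrow> real" and F :: "'a \<Rightarrow> 'a"
    and A :: "'a \<Rightarrow> 'a \<Rightarrow> 'a" and c :: real
  assumes dim: "DIM('a) \<ge> 3"
    and open_\<Omega>: "open \<Omega>" and connected_\<Omega>: "connected \<Omega>" and bounded_\<Omega>: "bounded \<Omega>" and zero_in: "0 \<in> \<Omega>"
    and open_U: "open U" and closure_U: "closure \<Omega> - {0} \<subseteq> U" and hess: "has_hessian G F A U"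
    and harmonic: "\<And>x. x \<in> \<Omega> - {0} \<Longrightarrow> lin_trace (A x) = 0"
    and lower: "\<exists>r>0. \<exists>C. \<forall>x\<in>ball 0 r - {0}. C \<le> G x"
    and boundary_value: "\<And>x. x \<in> frontier \<Omega> \<Longrightarrow> G x = c"
begin

lemma frontier_iff: "x \<in> frontier \<Omega> \<longleftrightarrow> x \<in> closure \<Omega> \<and> x \<notin> \<Omega>"
  using open_\<Omega> by (simp add: frontier_def interior_open)

lemma frontier_nz: "x \<in> frontier \<Omega> \<Longrightarrow> x \<noteq> 0"
  using zero_in frontier_iff by auto

lemma frontier_U: "x \<in> frontier \<Omega> \<Longrightarrow> x \<in> U"
  using closure_U frontier_nz frontier_iff by auto

lemma \<Omega>_U: "x \<in> \<Omega> \<Longrightarrow> x \<noteq> 0 \<Longrightarrow> x \<in> U"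
  using closure_U closure_subset by blast

lemma frontier_nonempty: "frontier \<Omega> \<noteq> {}"
  using bounded_\<Omega> zero_in by (metis empty_iff frontier_eq_empty not_bounded_UNIV)

lemma superharmonic_G: "superharmonic_on G (\<Omega> - {0})"
  unfolding superharmonic_on_def
  using has_hessian_subset[OF hess, of "\<Omega> - {0}"] harmonic \<Omega>_U by fastforce

lemma superharmonic_minus_G: "superharmonic_on (\<lambda>x. (-1) * G x) (\<Omega> - {0})"
  unfolding superharmonic_on_def
  apply (rule exI, rule exI, rule conjI, rule has_hessian_cmult[OF has_hessian_subset[OF hess]])
  unfolding lin_trace_cmult using harmonic \<Omega>_U by auto

lemma isCont_G: "x \<in> U \<Longrightarrow> isCont G x"
  using has_hessian_continuous_on(1)[OF hess] open_U continuous_on_eq_continuous_at by blast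

lemma isCont_F: "x \<in> U \<Longrightarrow> isCont F x"
  using has_hessian_continuous_on(2)[OF hess] open_U continuous_on_eq_continuous_at by blast

lemma G_ge: "x \<in> closure \<Omega> \<Longrightarrow> x \<noteq> 0 \<Longrightarrow> c \<le> G x"
proof -
  have "c \<le> G x" if x: "x \<in> \<Omega> - {0}" for x
  proof -
    obtain r C where rC: "r > 0" "\<forall>x\<in>ball 0 r - {0}. C \<le> G x" using lower by blast
    have "0 \<le> G x + (- c)"
    proof (rule minimum_principle_punctured[OF dim _ open_\<Omega> bounded_\<Omega> _ rC(1) _ x])
      show "superharmonic_on (\<lambda>x. G x + (- c)) (\<Omega> - {0})"
        by (intro superharmonic_on_add superharmonic_G superharmonic_on_const)
      fix z :: 'a and e :: real assume z: "z \<in> frontier \<Omega>" "e > 0"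
      obtain \<delta> where \<delta>: "\<delta> > 0" "\<And>x. dist x z < \<delta> \<Longrightarrow> dist (G x) (G z) < e"
        using isCont_G[OF frontier_U[OF z(1)]] z(2) unfolding continuous_at_eps_delta by blast
      show "\<exists>\<delta>>0. \<forall>x\<in>(\<Omega> - {0}) \<inter> ball z \<delta>. - e \<le> G x + (- c)"
      proof (intro exI[of _ \<delta>] conjI ballI)
        fix x assume "x \<in> (\<Omega> - {0}) \<inter> ball z \<delta>"
        then have "dist (G x) c < e" using \<delta>(2)[of x] boundary_value[OF z(1)] by (auto simp: dist_commute)
        then show "- e \<le> G x + (- c)" unfolding dist_real_def by linarith
      qed (use \<delta> in auto)
    next
      fix x assume "x \<in> \<Omega> - {0}" "norm x < r"
      then show "C - c \<le> G x + - c" using rC(2) by simp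
    qed
    then show ?thesis by simp
  qed
  moreover assume "x \<in> closure \<Omega>" "x \<noteq> 0"
  ultimately show ?thesis using boundary_value frontier_iff by (cases "x \<in> \<Omega>") auto
qed

end

text \<open>\<open>local_level\<close> encodes the smooth boundary: together with
  \<open>boundary_gradient\<close> it makes the boundary locally a regular level set of
  \<open>G\<close> with inward normal \<open>F / d\<close>, so no separate defining function is
  carried along.\<close>

locale overdetermined = green_domain +
  fixes d :: real
  assumes d: "d > 0"
    and boundary_gradient: "\<And>x. x \<in> frontier \<Omega> \<Longrightarrow> norm (F x) = d"
    and local_level: "\<And>x. x \<in> frontier \<Omega> \<Longrightarrow>
      \<exists>r>0. \<forall>y\<in>ball x r. (y \<in> \<Omega> \<longleftrightarrow> c < G y) \<and> (y \<in> frontier \<Omega> \<longleftrightarrow> G y = c)"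
begin

lemma level:
  assumes "x \<in> frontier \<Omega>"
  obtains r where "r > 0" "ball x r \<subseteq> U - {0}"
    "\<And>y. y \<in> ball x r \<Longrightarrow> y \<in> \<Omega> \<longleftrightarrow> c < G y"
    "\<And>y. y \<in> ball x r \<Longrightarrow> y \<in> frontier \<Omega> \<longleftrightarrow> G y = c"
    "\<And>y. y \<in> ball x r \<Longrightarrow> y \<in> closure \<Omega> \<longleftrightarrow> c \<le> G y"
proof -
  obtain r1 where r1: "r1 > 0" "\<forall>y\<in>ball x r1. (y \<in> \<Omega> \<longleftrightarrow> c < G y) \<and> (y \<in> frontier \<Omega> \<longleftrightarrow> G y = c)"
    using local_level[OF assms] by blast
  have "open (U - {0})" using open_U by auto
  then obtain r2 where r2: "r2 > 0" "ball x r2 \<subseteq> U - {0}"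
    using frontier_U[OF assms] frontier_nz[OF assms] open_contains_ball by (metis Diff_iff singletonD)
  show ?thesis
  proof (rule that[of "min r1 r2"])
    show "ball x (min r1 r2) \<subseteq> U - {0}" by (rule order_trans[OF _ r2(2)]) auto
    fix y assume "y \<in> ball x (min r1 r2)"
    then have y: "y \<in> ball x r1" by auto
    then show "y \<in> \<Omega> \<longleftrightarrow> c < G y" "y \<in> frontier \<Omega> \<longleftrightarrow> G y = c" using r1 by auto
    have "y \<in> closure \<Omega> \<longleftrightarrow> y \<in> \<Omega> \<or> y \<in> frontier \<Omega>" using closure_subset frontier_iff by auto
    then show "y \<in> closure \<Omega> \<longleftrightarrow> c \<le> G y" using r1 y by auto
  qed (use r1 r2 in auto)
qed

lemma F_nz: "x \<in> frontier \<Omega> \<Longrightarrow> F x \<noteq> 0"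
  using boundary_gradient d by fastforce

lemma direction_inward:
  assumes x: "x \<in> frontier \<Omega>" and h: "F x \<bullet> h > 0"
  shows "\<exists>\<delta>>0. \<forall>t. 0 < t \<and> t < \<delta> \<longrightarrow> x + t *\<^sub>R h \<in> \<Omega>"
proof -
  obtain r where r: "r > 0" "\<And>y. y \<in> ball x r \<Longrightarrow> y \<in> \<Omega> \<longleftrightarrow> c < G y" using level[OF x] by metis
  have "((\<lambda>t. G (x + t *\<^sub>R h)) has_real_derivative F x \<bullet> h) (at 0)"
    using has_hessian_line(1)[OF hess, of x 0 h] frontier_U[OF x] by simp
  from DERIV_pos_inc_right[OF this h] obtain \<delta> where
    \<delta>: "\<delta> > 0" "\<And>t. 0 < t \<Longrightarrow> t < \<delta> \<Longrightarrow> G x < G (x + t *\<^sub>R h)" by auto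
  have hn: "norm h > 0" using h by auto
  show ?thesis
  proof (intro exI[of _ "min \<delta> (r / norm h)"] conjI allI impI)
    fix t assume t: "0 < t \<and> t < min \<delta> (r / norm h)"
    then have "x + t *\<^sub>R h \<in> ball x r" using hn by (simp add: dist_norm field_simps)
    then show "x + t *\<^sub>R h \<in> \<Omega>" using r(2) \<delta>(2)[of t] t boundary_value[OF x] by simp
  qed (use \<delta> r hn in auto)
qed

lemma direction_outward:
  assumes x: "x \<in> frontier \<Omega>" and h: "F x \<bullet> h < 0"
  shows "\<exists>\<delta>>0. \<forall>t. 0 < t \<and> t < \<delta> \<longrightarrow> x + t *\<^sub>R h \<notin> closure \<Omega>"
proof -
  obtain r where r: "r > 0" "\<And>y. y \<in> ball x r \<Longrightarrow> y \<in> closure \<Omega> \<longleftrightarrow> c \<le> G y" using level[OF x] by metis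
  have "((\<lambda>t. G (x + t *\<^sub>R h)) has_real_derivative F x \<bullet> h) (at 0)"
    using has_hessian_line(1)[OF hess, of x 0 h] frontier_U[OF x] by simp
  from DERIV_neg_dec_right[OF this h] obtain \<delta> where
    \<delta>: "\<delta> > 0" "\<And>t. 0 < t \<Longrightarrow> t < \<delta> \<Longrightarrow> G x > G (x + t *\<^sub>R h)" by auto
  have hn: "norm h > 0" using h by auto
  show ?thesis
  proof (intro exI[of _ "min \<delta> (r / norm h)"] conjI allI impI)
    fix t assume t: "0 < t \<and> t < min \<delta> (r / norm h)"
    then have "x + t *\<^sub>R h \<in> ball x r" using hn by (simp add: dist_norm field_simps)
    then show "x + t *\<^sub>R h \<notin> closure \<Omega>" using r(2) \<delta>(2)[of t] t boundary_value[OF x] by simp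
  qed (use \<delta> r hn in auto)
qed

text \<open>Stepping from a boundary point against the gradient leaves the closure, so \<Omega> is
  the interior of its closure. This upgrades weak inclusions obtained by limits.\<close>

lemma open_subset_closure:
  assumes "open V" "V \<subseteq> closure \<Omega>"
  shows "V \<subseteq> \<Omega>"
proof
  fix y assume y: "y \<in> V"
  show "y \<in> \<Omega>"
  proof (rule ccontr)
    assume "y \<notin> \<Omega>"
    then have f: "y \<in> frontier \<Omega>" using y assms frontier_iff by auto
    have "F y \<bullet> (- F y) < 0" using F_nz[OF f] by simp
    from direction_outward[OF f this] obtain \<delta> where
      \<delta>: "\<delta> > 0" "\<And>t. 0 < t \<Longrightarrow> t < \<delta> \<Longrightarrow> y + t *\<^sub>R (- F y) \<notin> closure \<Omega>" by blast
    obtain r where r: "r > 0" "ball y r \<subseteq> V" using assms(1) y open_contains_ball by blast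
    have n: "norm (F y) > 0" using F_nz[OF f] by simp
    obtain t where t: "0 < t" "t < \<delta>" "t < r / norm (F y)"
      using field_lbound_gt_zero[OF \<delta>(1), of "r / norm (F y)"] r(1) n by auto
    have "y + t *\<^sub>R (- F y) \<in> ball y r" using t n by (simp add: dist_norm field_simps)
    then show False using r(2) assms(2) \<delta>(2)[OF t(1,2)] by blast
  qed
qed

lemma interior_ball_\<Omega>:
  assumes x: "x \<in> frontier \<Omega>"
  shows "\<exists>r0>0. \<forall>r. 0 < r \<and> r \<le> r0 \<longrightarrow> ball (x + r *\<^sub>R sgn (F x)) r \<subseteq> \<Omega>"
proof -
  obtain r0 where r0: "r0 > 0" "\<And>r y. 0 < r \<Longrightarrow> r \<le> r0 \<Longrightarrow> y \<in> ball (x + r *\<^sub>R sgn (F x)) r \<Longrightarrow> G x < G y"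
    using interior_ball[OF hess open_U frontier_U[OF x] F_nz[OF x]] by blast
  obtain r1 where r1: "r1 > 0" "\<And>y. y \<in> ball x r1 \<Longrightarrow> y \<in> \<Omega> \<longleftrightarrow> c < G y" using level[OF x] by metis
  have "ball (x + r *\<^sub>R sgn (F x)) r \<subseteq> \<Omega>" if r: "0 < r" "r \<le> min r0 (r1/2)" for r
  proof
    fix y assume y: "y \<in> ball (x + r *\<^sub>R sgn (F x)) r"
    have "dist x y \<le> dist x (x + r *\<^sub>R sgn (F x)) + dist (x + r *\<^sub>R sgn (F x)) y" by (rule dist_triangle)
    also have "dist x (x + r *\<^sub>R sgn (F x)) = r" using F_nz[OF x] r by (simp add: dist_norm norm_sgn)
    finally have "y \<in> ball x r1" using y r by auto
    moreover have "c < G y" using r0(2)[of r y] r y boundary_value[OF x] by simp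
    ultimately show "y \<in> \<Omega>" using r1(2) by blast
  qed
  then show ?thesis using r0(1) r1(1) by (intro exI[of _ "min r0 (r1/2)"]) auto
qed

lemma near_boundary_point:
  obtains y where "y \<in> \<Omega> - {0}" "c < G y"
proof -
  obtain x where x: "x \<in> frontier \<Omega>" using frontier_nonempty by blast
  obtain r where r: "r > 0" "ball x r \<subseteq> U - {0}" "\<And>y. y \<in> ball x r \<Longrightarrow> y \<in> \<Omega> \<longleftrightarrow> c < G y"
    using level[OF x] by metis
  have "x \<in> closure \<Omega>" using x frontier_iff by blast
  then obtain y where "y \<in> \<Omega>" "dist y x < r" using r(1) closure_approachable by blast
  then have "y \<in> ball x r" by (simp add: dist_commute)
  then show thesis using that[of y] r(3)[of y] subsetD[OF r(2), of y] \<open>y \<in> \<Omega>\<close> by blast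
qed

lemma connected_punctured: "connected (\<Omega> - {0})"
  using connected_open_delete[OF open_\<Omega> connected_\<Omega>] dim by simp

lemma G_gt: "x \<in> \<Omega> \<Longrightarrow> x \<noteq> 0 \<Longrightarrow> c < G x"
proof (rule ccontr)
  assume x: "x \<in> \<Omega>" "x \<noteq> 0" "\<not> c < G x"
  obtain y where y: "y \<in> \<Omega> - {0}" "c < G y" using near_boundary_point by blast
  have "G y + (- c) = 0"
  proof (rule strong_minimum_principle_connected[OF _ _ connected_punctured, where q = x])
    show "superharmonic_on (\<lambda>x. G x + (- c)) (\<Omega> - {0})"
      by (intro superharmonic_on_add superharmonic_G superharmonic_on_const)
    show "open (\<Omega> - {0})" using open_\<Omega> by auto
    fix z assume z: "z \<in> \<Omega> - {0}"
    then show "0 \<le> G z + (- c)" using G_ge[of z] closure_subset by auto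
  next
    show "G x + - c = 0" using x G_ge[of x] closure_subset by force
  qed (use x y in auto)
  then show False using y by simp
qed

text \<open>A bound near the origin would allow the punctured minimum principle for
  \<open>- G\<close>, forcing \<open>G \<le> c\<close> in \<Omega>, against
  \<open>near_boundary_point\<close>. The pole is thus detected from the boundary behaviour.\<close>

lemma not_bounded_above: "r > 0 \<Longrightarrow> \<exists>x\<in>ball 0 r - {0}. C < G x"
proof (rule ccontr)
  assume r: "r > 0" and "\<not> (\<exists>x\<in>ball 0 r - {0}. C < G x)"
  then have C: "G x \<le> C" if "x \<in> ball 0 r - {0}" for x using that by (meson not_less)
  obtain y where y: "y \<in> \<Omega> - {0}" "c < G y" using near_boundary_point by blast
  have "0 \<le> (-1) * G y + c"
  proof (rule minimum_principle_punctured[OF dim _ open_\<Omega> bounded_\<Omega> _ r _ y(1)])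
    show "superharmonic_on (\<lambda>x. (-1) * G x + c) (\<Omega> - {0})"
      by (intro superharmonic_on_add superharmonic_minus_G superharmonic_on_const)
    fix z :: 'a and e :: real assume z: "z \<in> frontier \<Omega>" "e > 0"
    obtain \<delta> where \<delta>: "\<delta> > 0" "\<And>x. dist x z < \<delta> \<Longrightarrow> dist (G x) (G z) < e"
      using isCont_G[OF frontier_U[OF z(1)]] z(2) unfolding continuous_at_eps_delta by blast
    show "\<exists>\<delta>>0. \<forall>x\<in>(\<Omega> - {0}) \<inter> ball z \<delta>. - e \<le> (-1) * G x + c"
    proof (intro exI[of _ \<delta>] conjI ballI)
      fix x assume "x \<in> (\<Omega> - {0}) \<inter> ball z \<delta>"
      then have "dist (G x) c < e" using \<delta>(2)[of x] boundary_value[OF z(1)] by (auto simp: dist_commute)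
      then show "- e \<le> (-1) * G x + c" unfolding dist_real_def by linarith
    qed (use \<delta> in auto)
  next
    fix x assume "x \<in> \<Omega> - {0}" "norm x < r"
    then show "c - C \<le> (-1) * G x + c" using C[of x] by simp
  qed
  then show False using y by simp
qed

text \<open>
  Differentiating \<open>|\<nabla>u|\<^sup>2 = d\<^sup>2\<close> along the boundary: this is all that Serrin's corner argument
  needs to know about the Hessian.
\<close>

lemma hessian_tangential:
  assumes x: "x \<in> frontier \<Omega>" and tan: "F x \<bullet> e = 0"
  shows "A x e \<bullet> F x = 0"
proof (rule ccontr)
  assume nz: "A x e \<bullet> F x \<noteq> 0"
  define n where "n = F x"
  have xU: "x \<in> U" using frontier_U[OF x] .
  have nn: "F x \<bullet> n > 0" using F_nz[OF x] by (simp add: n_def)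
  have lin: "linear (A x)" using has_hessian_linear[OF hess xU] .
  define L where "L = (\<lambda>h. 2 * (A x h \<bullet> F x))"
  have Lder: "((\<lambda>y. F y \<bullet> F y) has_derivative L) (at x)"
  proof -
    have "(F has_derivative A x) (at x)" using hess xU by (simp add: has_hessian_def)
    from has_derivative_inner[OF this this] show ?thesis
      by (rule has_derivative_eq_rhs) (auto simp: L_def inner_commute)
  qed
  have Le: "L e \<noteq> 0" using nz by (simp add: L_def)
  have Llin: "L (a *\<^sub>R e + b *\<^sub>R n) = a * L e + b * L n" for a b
    using lin by (simp add: L_def linear_add linear_cmul inner_add_left algebra_simps)
  define C where "C = norm e + norm n + 1"
  have C: "C > 0" unfolding C_def by (intro add_nonneg_pos add_nonneg_nonneg) auto
  \<comment> \<open>The opening of the cone around \<open>e\<close> in which boundary points are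
    sought: narrow enough that the normal component changes \<open>L\<close> by at most half of
    \<open>\<bar>L e\<bar>\<close>.\<close>
  define \<eta> where "\<eta> = min 1 (\<bar>L e\<bar> / (2 * (\<bar>L n\<bar> + 1)))"
  have \<eta>: "0 < \<eta>" "\<eta> \<le> 1" "\<eta> * \<bar>L n\<bar> \<le> \<bar>L e\<bar> / 2"
  proof -
    show "0 < \<eta>" "\<eta> \<le> 1" using Le by (auto simp: \<eta>_def)
    have "\<eta> * \<bar>L n\<bar> \<le> (\<bar>L e\<bar> / (2 * (\<bar>L n\<bar> + 1))) * (\<bar>L n\<bar> + 1)"
      using Le \<open>0 < \<eta>\<close> by (intro mult_mono) (auto simp: \<eta>_def)
    also have "\<dots> = \<bar>L e\<bar> / 2" by (simp add: field_simps add_nonneg_eq_0_iff)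
    finally show "\<eta> * \<bar>L n\<bar> \<le> \<bar>L e\<bar> / 2" .
  qed
  have p1: "F x \<bullet> (e + \<eta> *\<^sub>R n) > 0" and p2: "F x \<bullet> (e - \<eta> *\<^sub>R n) < 0"
    using tan nn \<eta> by (simp_all add: inner_add_right inner_diff_right)
  obtain d1 where d1: "d1 > 0" "\<And>t. 0 < t \<Longrightarrow> t < d1 \<Longrightarrow> x + t *\<^sub>R (e + \<eta> *\<^sub>R n) \<in> \<Omega>"
    using direction_inward[OF x p1] by blast
  obtain d2 where d2: "d2 > 0" "\<And>t. 0 < t \<Longrightarrow> t < d2 \<Longrightarrow> x + t *\<^sub>R (e - \<eta> *\<^sub>R n) \<notin> closure \<Omega>"
    using direction_outward[OF x p2] by blast
  define \<epsilon> where "\<epsilon> = \<bar>L e\<bar> / (4 * C)"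
  have \<epsilon>: "\<epsilon> > 0" using Le C by (simp add: \<epsilon>_def)
  obtain d3 where d3: "d3 > 0" "\<And>y. norm (y - x) < d3 \<Longrightarrow>
      norm (F y \<bullet> F y - F x \<bullet> F x - L (y - x)) \<le> \<epsilon> * norm (y - x)"
    using Lder \<epsilon> unfolding has_derivative_at_alt by blast
  obtain t0 where t0: "0 < t0" "t0 < d1" "t0 < d2" using field_lbound_gt_zero[OF d1(1) d2(1)] by auto
  obtain t where t': "0 < t" "t < t0" "t < d3 / C"
    using field_lbound_gt_zero[OF t0(1), of "d3 / C"] d3(1) C by auto
  have t: "0 < t" "t < d1" "t < d2" "t * C < d3" using t0 t' C by (auto simp: field_simps)
  \<comment> \<open>\<open>a\<close> lies outside the closure and \<open>b\<close> inside \<Omega>,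
    so the segment between them meets the boundary. This gives boundary points \<open>y\<close> with
    \<open>y - x\<close> close to the direction \<open>e\<close>, without parametrising the
    boundary.\<close>
  define a where "a = x + t *\<^sub>R (e - \<eta> *\<^sub>R n)"
  define b where "b = x + t *\<^sub>R (e + \<eta> *\<^sub>R n)"
  have "closed_segment a b \<inter> frontier \<Omega> \<noteq> {}"
  proof (rule connected_Int_frontier)
    have "b \<in> \<Omega>" unfolding b_def by (rule d1(2)[OF t(1,2)])
    then show "closed_segment a b \<inter> \<Omega> \<noteq> {}" using ends_in_segment(2) by blast
    have "a \<notin> \<Omega>" using d2(2)[OF t(1,3)] closure_subset unfolding a_def by blast
    then show "closed_segment a b - \<Omega> \<noteq> {}" using ends_in_segment(1) by blast
  qed simp
  then obtain y where y: "y \<in> closed_segment a b" "y \<in> frontier \<Omega>" by blast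
  then obtain s where s: "0 \<le> s" "s \<le> 1" "y = (1 - s) *\<^sub>R a + s *\<^sub>R b"
    unfolding closed_segment_def by blast
  define \<sigma> where "\<sigma> = (2 * s - 1) * \<eta>"
  have \<sigma>: "\<bar>\<sigma>\<bar> \<le> \<eta>" unfolding \<sigma>_def abs_mult using s \<eta> by (simp add: mult_left_le_one_le abs_le_iff)
  have yx: "y - x = t *\<^sub>R e + (t * \<sigma>) *\<^sub>R n"
    unfolding s(3) a_def b_def \<sigma>_def
    by (simp add: algebra_simps) (simp add: scaleR_2[symmetric] mult.commute mult.left_commute)
  have "norm (y - x) \<le> t * norm e + t * \<bar>\<sigma>\<bar> * norm n"
    unfolding yx using norm_triangle_ineq[of "t *\<^sub>R e" "(t * \<sigma>) *\<^sub>R n"] t by (simp add: abs_mult)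
  also have "\<dots> \<le> t * norm e + t * 1 * norm n"
    using \<sigma> \<eta> t by (intro add_left_mono mult_right_mono mult_left_mono) auto
  also have "\<dots> < t * C" using t by (simp add: C_def algebra_simps)
  finally have nyx: "norm (y - x) < t * C" .
  have "F y \<bullet> F y = F x \<bullet> F x"
    using boundary_gradient[OF x] boundary_gradient[OF y(2)] by (simp add: dot_square_norm)
  then have "\<bar>L (y - x)\<bar> \<le> \<epsilon> * norm (y - x)" using d3(2)[of y] nyx t(4) by simp
  also have "\<dots> \<le> \<epsilon> * (t * C)" using nyx \<epsilon> by (intro mult_left_mono) auto
  also have "\<dots> = t * (\<bar>L e\<bar> / 4)" using C by (simp add: \<epsilon>_def)
  finally have up: "\<bar>L (y - x)\<bar> \<le> t * (\<bar>L e\<bar> / 4)" .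
  have "L (y - x) = t * (L e + \<sigma> * L n)" unfolding yx Llin by (simp add: algebra_simps)
  moreover have "\<bar>L e + \<sigma> * L n\<bar> \<ge> \<bar>L e\<bar> / 2"
  proof -
    have "\<bar>\<sigma> * L n\<bar> \<le> \<eta> * \<bar>L n\<bar>" unfolding abs_mult using \<sigma> by (intro mult_right_mono) auto
    then show ?thesis using \<eta>(3) by linarith
  qed
  ultimately have "\<bar>L (y - x)\<bar> \<ge> t * (\<bar>L e\<bar> / 2)" using t by (simp add: abs_mult)
  then have "t * (\<bar>L e\<bar> / 2) \<le> t * (\<bar>L e\<bar> / 4)" using up by linarith
  then show False using t Le by simp
qed

end

section \<open>Moving planes\<close>

text \<open>The situation when the plane, coming from infinity, has reached \<open>x \<bullet> e = \<mu>\<close>.\<close>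

locale moving_plane = overdetermined \<Omega> U G F A c d
  for \<Omega> :: "'a::euclidean_space set" and U G F A c d +
  fixes e :: 'a and \<mu> :: real
  assumes e: "norm e = 1" and \<mu>: "\<mu> > 0"
    and cap: "\<And>x. x \<in> closure \<Omega> \<Longrightarrow> x \<bullet> e > \<mu> \<Longrightarrow> reflect e \<mu> x \<in> closure \<Omega>"
    and slope: "\<And>x. x \<in> frontier \<Omega> \<Longrightarrow> x \<bullet> e = \<mu> \<Longrightarrow> F x \<bullet> e \<le> 0"
begin

abbreviation R where "R \<equiv> reflect e \<mu>"
abbreviation L where "L \<equiv> refl_vec e"
abbreviation w where "w y \<equiv> G y + (-1) * G (R y)"

lemmas RR = reflect_reflect[OF e, of \<mu>]
lemmas R_inner = reflect_inner[OF e, of \<mu>]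
lemmas dist_R = dist_reflect[OF e, of \<mu>]

text \<open>The reflected cap, written as a preimage so that openness is immediate. All its points
  have nonzero reflection, so only the origin itself can be a singularity of
  \<open>w\<close>.\<close>

definition D :: "'a set" where "D = {y. R y \<in> \<Omega> \<and> y \<bullet> e < \<mu>}"

lemma open_D: "open D"
proof -
  have "D = R -` \<Omega> \<inter> {y. y \<bullet> e < \<mu>}" by (auto simp: D_def)
  moreover have "open (R -` \<Omega>)" using open_\<Omega> continuous_on_reflect[OF e, of UNIV \<mu>]
    by (simp add: continuous_on_open_vimage open_vimage)
  moreover have "open {y. y \<bullet> e < \<mu>}" by (intro open_Collect_less continuous_intros)
  ultimately show ?thesis by auto
qed

lemma D_subset: "D \<subseteq> \<Omega>"
proof (rule open_subset_closure[OF open_D])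
  show "D \<subseteq> closure \<Omega>"
  proof
    fix y assume y: "y \<in> D"
    have "R (R y) \<in> closure \<Omega>"
    proof (rule cap)
      show "R y \<in> closure \<Omega>" using y closure_subset by (auto simp: D_def)
      show "R y \<bullet> e > \<mu>" using y R_inner[of y] by (simp add: D_def)
    qed
    then show "y \<in> closure \<Omega>" by (simp add: RR)
  qed
qed

lemma R_nz: "y \<bullet> e \<le> \<mu> \<Longrightarrow> R y \<noteq> 0"
  using R_inner[of y] \<mu> by auto

lemma D_facts: "y \<in> D \<Longrightarrow> y \<in> \<Omega> \<and> R y \<in> \<Omega> \<and> R y \<noteq> 0 \<and> y \<bullet> e < \<mu>"
  using D_subset R_nz[of y] by (auto simp: D_def)

lemma w_hessian:
  assumes "\<And>y. y \<in> S \<Longrightarrow> y \<in> U \<and> R y \<in> U"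
  shows "has_hessian w (\<lambda>y. F y + (-1) *\<^sub>R L (F (R y))) (\<lambda>y h. A y h + (-1) *\<^sub>R L (A (R y) (L h))) S"
proof -
  have "has_hessian (\<lambda>y. G (R y)) (\<lambda>y. L (F (R y))) (\<lambda>y h. L (A (R y) (L h))) S"
    by (rule has_hessian_reflect[OF e hess]) (use assms in auto)
  from has_hessian_add[OF has_hessian_subset[OF hess] has_hessian_cmult[OF this, of "-1"]] assms
  show ?thesis by blast
qed

lemma w_superharmonic:
  assumes "\<And>y. y \<in> S \<Longrightarrow> y \<in> \<Omega> - {0} \<and> R y \<in> \<Omega> - {0}"
  shows "superharmonic_on w S"
  unfolding superharmonic_on_def
proof (intro exI conjI ballI)
  show "has_hessian w (\<lambda>y. F y + (-1) *\<^sub>R L (F (R y))) (\<lambda>y h. A y h + (-1) *\<^sub>R L (A (R y) (L h))) S"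
    by (rule w_hessian) (use assms \<Omega>_U in auto)
  fix y assume y: "y \<in> S"
  have "linear (A (R y))" using has_hessian_linear[OF hess] \<Omega>_U assms[OF y] by auto
  then show "lin_trace (\<lambda>h. A y h + (-1) *\<^sub>R L (A (R y) (L h))) \<le> 0"
    unfolding lin_trace_add lin_trace_cmult using lin_trace_refl_vec[OF e, of "A (R y)"] harmonic assms[OF y]
    by simp
qed

lemma isCont_w: "y \<in> U \<Longrightarrow> R y \<in> U \<Longrightarrow> isCont w y"
  using w_hessian[of "{y}"] unfolding has_hessian_def by (blast intro: has_derivative_continuous)

text \<open>For \<open>y\<close> in \<open>D\<close> the reflection stays in the compact set
  \<open>K\<close>, on the far side of the plane from the pole; there \<open>G\<close> is bounded
  above, so \<open>w\<close> is bounded below near the origin. On the frontier either the point lies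
  on the plane and \<open>w = 0\<close>, or its reflection lies on the boundary and
  \<open>w = G z - c \<ge> 0\<close>.\<close>

lemma w_nonneg: "y \<in> D \<Longrightarrow> y \<noteq> 0 \<Longrightarrow> 0 \<le> w y"
proof -
  assume "y \<in> D" "y \<noteq> 0"
  obtain r C where rC: "r > 0" "\<forall>x\<in>ball 0 r - {0}. C \<le> G x" using lower by blast
  define K where "K = closure \<Omega> \<inter> {x. \<mu> \<le> x \<bullet> e}"
  have "closed {x. \<mu> \<le> x \<bullet> e}" by (intro closed_Collect_le continuous_intros)
  then have "compact K" unfolding K_def using bounded_\<Omega> by (intro compact_Int_closed) (auto simp: compact_closure)
  moreover have KU: "K \<subseteq> U" using closure_U \<mu> by (auto simp: K_def)
  moreover have "R y \<in> K" using D_facts[OF \<open>y \<in> D\<close>] closure_subset R_inner[of y] by (auto simp: K_def)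
  ultimately obtain k where k: "\<And>x. x \<in> K \<Longrightarrow> G x \<le> G k"
    using continuous_attains_sup[of K G] continuous_on_subset[OF has_hessian_continuous_on(1)[OF hess] KU]
    by (metis empty_iff)
  have bD: "bounded D" using bounded_\<Omega> D_subset bounded_subset by blast
  have sh: "superharmonic_on w (D - {0})" by (rule w_superharmonic) (use D_facts in auto)
  have yD: "y \<in> D - {0}" using \<open>y \<in> D\<close> \<open>y \<noteq> 0\<close> by simp
  show ?thesis
  proof (rule minimum_principle_punctured[OF dim sh open_D bD _ rC(1) _ yD])
    fix x assume x: "x \<in> D - {0}" "norm x < r"
    have "R x \<in> K" using D_facts[of x] x closure_subset R_inner[of x] by (auto simp: K_def)
    then have "G (R x) \<le> G k" by (rule k)
    moreover have "C \<le> G x" using rC(2) x by simp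
    ultimately show "C - G k \<le> w x" by linarith
  next
    fix z :: 'a and \<epsilon> :: real assume z: "z \<in> frontier D" "z \<noteq> 0" "\<epsilon> > 0"
    have zD: "z \<notin> D" "z \<in> closure D" using z(1) open_D by (auto simp: frontier_def interior_open)
    have z1: "z \<in> closure \<Omega>" using zD(2) closure_mono[OF D_subset] by blast
    have "closed {x. R x \<in> closure \<Omega> \<and> x \<bullet> e \<le> \<mu>}"
    proof (intro closed_Collect_conj)
      have "closed (R -` closure \<Omega>)" using continuous_on_reflect[OF e, of UNIV \<mu>]
        by (intro closed_vimage) auto
      then show "closed {x. R x \<in> closure \<Omega>}" by (simp add: vimage_def)
      show "closed {x. x \<bullet> e \<le> \<mu>}" by (intro closed_Collect_le continuous_intros)
    qed
    then have "closure D \<subseteq> {x. R x \<in> closure \<Omega> \<and> x \<bullet> e \<le> \<mu>}"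
      using closure_subset by (intro closure_minimal) (auto simp: D_def)
    then have z2: "R z \<in> closure \<Omega>" "z \<bullet> e \<le> \<mu>" using zD by auto
    have zU: "z \<in> U" "R z \<in> U" using z1 z2 z(2) R_nz[of z] closure_U by auto
    have wz: "0 \<le> w z"
    proof (cases "R z \<in> \<Omega>")
      case True
      then have "z \<bullet> e = \<mu>" using zD(1) z2 by (auto simp: D_def)
      then show ?thesis by (simp add: reflect_fixed)
    next
      case False
      then have "R z \<in> frontier \<Omega>" using z2 frontier_iff by auto
      then show ?thesis using boundary_value G_ge[OF z1 z(2)] by simp
    qed
    obtain \<delta> where \<delta>: "\<delta> > 0" "\<And>x. dist x z < \<delta> \<Longrightarrow> dist (w x) (w z) < \<epsilon>"
      using isCont_w[OF zU] z(3) unfolding continuous_at_eps_delta by blast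
    show "\<exists>\<delta>>0. \<forall>x\<in>(D - {0}) \<inter> ball z \<delta>. - \<epsilon> \<le> w x"
    proof (intro exI[of _ \<delta>] conjI ballI)
      fix x assume "x \<in> (D - {0}) \<inter> ball z \<delta>"
      then have "dist (w x) (w z) < \<epsilon>" using \<delta>(2)[of x] by (simp add: dist_commute)
      then show "- \<epsilon> \<le> w x" using wz unfolding dist_real_def by linarith
    qed (use \<delta> in auto)
  qed
qed

lemma w_zero_ball:
  assumes z: "z \<in> D - {0}" and wz: "w z = 0"
  shows "\<exists>r>0. ball z r \<subseteq> D - {0} \<and> (\<forall>y\<in>ball z r. w y = 0)"
proof -
  have "open (D - {0})" using open_D by auto
  then obtain r where r: "r > 0" "ball z r \<subseteq> D - {0}" using z open_contains_ball by blast
  have "w y = 0" if y: "y \<in> ball z r" for y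
  proof (rule strong_minimum_principle_connected[where f = w and q = z, OF _ open_ball connected_ball _ _ wz y])
    show "superharmonic_on w (ball z r)" by (rule w_superharmonic) (use D_facts r in blast)
    show "0 \<le> w x" if "x \<in> ball z r" for x using w_nonneg that r by blast
  qed (use r in auto)
  then show ?thesis using r by blast
qed

text \<open>
  If \<open>w\<close> vanished somewhere, \<open>u\<close> would be symmetric with respect to the plane. This is impossible
  since \<open>u\<close> is unbounded at the origin only, which does not lie on the plane.
\<close>

lemma w_pos:
  assumes "y0 \<in> D" "y0 \<noteq> 0"
  shows "0 < w y0"
proof (rule ccontr)
  assume "\<not> 0 < w y0"
  then have w0: "w y0 = 0" using w_nonneg[OF assms] by simp
  \<comment> \<open>\<open>D\<close> may be disconnected, so a zero of \<open>w\<close> must be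
    carried through the plane. The set \<open>V\<close>, from which both singularities of
    \<open>w\<close> are removed, is connected, and the coincidence set \<open>Z\<close> is followed
    there.\<close>
  define V where "V = \<Omega> - {0, R 0}"
  define Z where "Z = {x\<in>V. R x \<in> \<Omega> \<and> w x = 0}"
  have conV: "connected V" unfolding V_def
    using dim by (intro connected_open_delete_finite open_\<Omega> connected_\<Omega>) auto
  have oV: "open V" unfolding V_def using open_\<Omega> by (intro open_Diff) auto
  have R0: "R 0 \<bullet> e = 2 * \<mu>" using R_inner[of 0] by simp
  have DV: "y \<in> V" if "y \<in> D" "y \<noteq> 0" for y using D_facts[OF that(1)] that(2) R0 \<mu> by (auto simp: V_def)
  have RV: "R y \<in> V" if "y \<in> D" "y \<noteq> 0" for y
    using D_facts[OF that(1)] that(2) RR by (auto simp: V_def) (metis RR)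
  have DZ: "y \<in> Z" "R y \<in> Z" if "y \<in> D" "y \<noteq> 0" "w y = 0" for y
    using DV RV that D_facts[OF that(1)] by (auto simp: Z_def RR)
  have below: "z \<in> interior Z" if z: "z \<in> Z" "z \<bullet> e < \<mu>" for z
  proof -
    have "z \<in> D - {0}" "w z = 0" using z by (auto simp: Z_def V_def D_def)
    then obtain r where "r > 0" "ball z r \<subseteq> D - {0}" "\<forall>y\<in>ball z r. w y = 0"
      using w_zero_ball by blast
    then have "ball z r \<subseteq> Z" "z \<in> ball z r" using DZ(1) by auto
    then show ?thesis using interiorI open_ball by blast
  qed
  have above: "z \<in> interior Z" if z: "z \<in> Z" "z \<bullet> e > \<mu>" for z
  proof -
    have "R z \<noteq> 0" using z by (auto simp: Z_def V_def) (metis RR)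
    moreover have "R z \<in> D" using z R_inner[of z] by (auto simp: Z_def V_def D_def RR)
    moreover have "w (R z) = 0" using z by (simp add: Z_def RR)
    ultimately obtain r where r: "r > 0" "ball (R z) r \<subseteq> D - {0}" "\<forall>y\<in>ball (R z) r. w y = 0"
      using w_zero_ball[of "R z"] by blast
    have "ball z r \<subseteq> Z"
    proof
      fix y assume "y \<in> ball z r"
      then have y: "R y \<in> ball (R z) r" by (simp add: dist_R)
      then have "R (R y) \<in> Z" using r by (intro DZ(2)) blast+
      then show "y \<in> Z" by (simp add: RR)
    qed
    then show ?thesis using interiorI[OF open_ball] r(1) by (metis centre_in_ball)
  qed
  have closedZ: "z \<in> Z" if z: "z \<in> V" "z \<in> closure Z" for z
  proof -
    have "closed (R -` closure \<Omega>)" using continuous_on_reflect[OF e, of UNIV \<mu>] by (intro closed_vimage) auto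
    moreover have "Z \<subseteq> R -` closure \<Omega>" using closure_subset by (auto simp: Z_def)
    ultimately have Rz: "R z \<in> closure \<Omega>" using z(2) closure_minimal by blast
    have "R z \<noteq> 0" using z(1) by (auto simp: V_def) (metis RR)
    then have U: "z \<in> U" "R z \<in> U" using z(1) Rz closure_U \<Omega>_U by (auto simp: V_def)
    obtain X where X: "\<And>n. X n \<in> Z" "X \<longlonglongrightarrow> z" using z(2) closure_sequential by metis
    have "(\<lambda>n. w (X n)) \<longlonglongrightarrow> w z" using isCont_tendsto_compose[OF isCont_w[OF U] X(2)] .
    moreover have "(\<lambda>n. w (X n)) = (\<lambda>n. 0)" using X(1) by (auto simp: Z_def)
    ultimately have wz: "w z = 0" using LIMSEQ_unique tendsto_const by metis
    \<comment> \<open>The limit cannot have its reflection on the boundary: \<open>w z = 0\<close>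
      transfers the strict inequality \<open>c < G z\<close> to \<open>R z\<close>.\<close>
    have "c < G z" using z(1) G_gt by (auto simp: V_def)
    then have "c < G (R z)" using wz by simp
    then have "R z \<in> \<Omega>" using boundary_value frontier_iff Rz by force
    then show ?thesis using z(1) wz by (simp add: Z_def)
  qed
  \<comment> \<open>Points of \<open>V\<close> on the plane belong to \<open>Z\<close> trivially, so
    \<open>Z\<close> need not be open there; it is the interior of \<open>Z\<close> that is shown to
    be relatively closed. At a plane point, a zero in the lower half ball \<open>H\<close> spreads
    over \<open>H\<close>, and antisymmetry of \<open>w\<close> covers the other half.\<close>
  have closedW: "z \<in> interior Z" if z: "z \<in> V" "z \<in> closure (interior Z)" for z
  proof -
    have "z \<in> closure Z" using z(2) closure_mono[OF interior_subset] by blast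
    then have zZ: "z \<in> Z" using closedZ z(1) by blast
    show ?thesis
    proof (cases "z \<bullet> e = \<mu>")
      case False
      then show ?thesis using below[OF zZ] above[OF zZ] by linarith
    next
      case True
      then have fz: "R z = z" by (simp add: reflect_fixed)
      obtain r where r: "r > 0" "ball z r \<subseteq> V" using z(1) oV open_contains_ball by blast
      define H where "H = ball z r \<inter> {y. y \<bullet> e < \<mu>}"
      have RB: "R y \<in> ball z r" if "y \<in> ball z r" for y using dist_R[of z y] that fz by simp
      have HD: "y \<in> D \<and> y \<noteq> 0" if "y \<in> H" for y
        using that RB[of y] r(2) by (auto simp: H_def D_def V_def)
      obtain q where q: "q \<in> interior Z" "dist q z < r" using z(2) r(1) closure_approachable by blast
      \<comment> \<open>A point on the plane says nothing about \<open>H\<close>, so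
        \<open>q\<close> is moved along \<open>e\<close> inside the interior of \<open>Z\<close> if
        necessary.\<close>
      obtain q' where q': "q' \<in> Z" "q' \<in> ball z r" "q' \<bullet> e \<noteq> \<mu>"
      proof -
        have "open (interior Z \<inter> ball z r)" by auto
        moreover have "q \<in> interior Z \<inter> ball z r" using q by (simp add: dist_commute)
        ultimately obtain s where s: "s > 0" "ball q s \<subseteq> interior Z \<inter> ball z r"
          using open_contains_ball by blast
        have "q + (s/2) *\<^sub>R e \<in> ball q s" using s(1) e by (simp add: dist_norm)
        then have 1: "q + (s/2) *\<^sub>R e \<in> Z" "q + (s/2) *\<^sub>R e \<in> ball z r"
          using s(2) interior_subset[of Z] by blast+
        have 2: "(q + (s/2) *\<^sub>R e) \<bullet> e = q \<bullet> e + s/2" using inner_unit_self[OF e] by (simp add: inner_add_left)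
        show thesis
        proof (cases "q \<bullet> e = \<mu>")
          case True
          show ?thesis using that[OF 1] 2 True s(1) by simp
        next
          case False
          show ?thesis using that[of q] False q interior_subset by (auto simp: dist_commute)
        qed
      qed
      obtain p where p: "p \<in> H" "w p = 0"
      proof (cases "q' \<bullet> e < \<mu>")
        case True
        then show ?thesis using that[of q'] q' by (auto simp: H_def Z_def)
      next
        case False
        then show ?thesis using that[of "R q'"] q' RB[of q'] R_inner[of q'] by (auto simp: H_def Z_def RR)
      qed
      have oH: "open H" unfolding H_def by (intro open_Int open_ball open_Collect_less continuous_intros)
      have "convex {y. y \<bullet> e < \<mu>}" using convex_halfspace_lt[of e \<mu>] by (simp add: inner_commute)
      then have "connected H" unfolding H_def by (intro convex_connected convex_Int convex_ball)
      have wH: "w y = 0" if "y \<in> H" for y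
      proof (rule strong_minimum_principle_connected[where f = w, OF _ oH \<open>connected H\<close> _ p that])
        show "superharmonic_on w H" by (rule w_superharmonic) (use HD D_facts in blast)
        show "0 \<le> w x" if "x \<in> H" for x using w_nonneg HD[OF that] by blast
      qed
      have "ball z r \<subseteq> Z"
      proof
        fix y assume y: "y \<in> ball z r"
        then have yV: "y \<in> V" "R y \<in> V" using r(2) RB by auto
        have "w y = 0"
        proof (cases "y \<bullet> e" \<mu> rule: linorder_cases)
          case less
          then show ?thesis using wH y by (simp add: H_def)
        next
          case equal
          then show ?thesis by (simp add: reflect_fixed)
        next
          case greater
          then have "R y \<in> H" using RB[OF y] R_inner[of y] by (simp add: H_def)
          from wH[OF this] show ?thesis by (simp add: RR)
        qed
        then show "y \<in> Z" using yV by (auto simp: Z_def V_def)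
      qed
      then show ?thesis using interiorI[OF open_ball] r(1) by (metis centre_in_ball)
    qed
  qed
  have "y0 \<in> Z" using DZ(1) assms w0 by blast
  then have y0: "y0 \<in> interior Z" using below D_facts[OF assms(1)] by blast
  have "V \<subseteq> interior Z"
  proof (rule ccontr)
    assume "\<not> V \<subseteq> interior Z"
    have "V - interior Z = V - closure (interior Z)" using closedW closure_subset by blast
    then have o: "open (V - interior Z)" using oV by (metis closed_closure open_Diff)
    have "interior Z \<inter> V = {} \<or> (V - interior Z) \<inter> V = {}"
      by (rule connectedD[OF conV open_interior o]) auto
    moreover have "y0 \<in> V" using DV assms by blast
    ultimately show False using y0 \<open>\<not> V \<subseteq> interior Z\<close> by blast
  qed
  then have VZ: "V \<subseteq> Z" using interior_subset by blast
  have R0nz: "R 0 \<noteq> 0" using R0 \<mu> by auto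
  obtain r where r: "r > 0" "ball 0 r \<subseteq> \<Omega> - {R 0}"
    using open_delete[OF open_\<Omega>, of "R 0"] zero_in R0nz open_contains_ball
    by (metis DiffI empty_iff insert_iff)
  have bV: "x \<in> V" if "x \<in> ball 0 r - {0}" for x using that r(2) by (auto simp: V_def)
  \<comment> \<open>Points near the origin have their reflections in \<Omega>, so \<open>R 0\<close>
    is in the closure and \<open>G\<close> is continuous there. Then G(x) = G(R x) would be bounded
    near the origin.\<close>
  have "R 0 \<in> closure \<Omega>"
    unfolding closure_approachable
  proof (intro allI impI)
    fix \<epsilon> :: real assume "\<epsilon> > 0"
    obtain t where t: "0 < t" "t < r" "t < \<epsilon>" using field_lbound_gt_zero[OF r(1) \<open>\<epsilon> > 0\<close>] by blast
    have "t *\<^sub>R e \<in> ball 0 r - {0}" using t e by auto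
    then have "t *\<^sub>R e \<in> Z" using bV VZ by blast
    then have "R (t *\<^sub>R e) \<in> \<Omega>" by (simp add: Z_def)
    moreover have "dist (R (t *\<^sub>R e)) (R 0) < \<epsilon>" using t e dist_R[of "t *\<^sub>R e" 0] by simp
    ultimately show "\<exists>y\<in>\<Omega>. dist y (R 0) < \<epsilon>" by blast
  qed
  then have "R 0 \<in> U" using closure_U R0nz by auto
  then obtain \<delta> where \<delta>: "\<delta> > 0" "\<And>x. dist x (R 0) < \<delta> \<Longrightarrow> dist (G x) (G (R 0)) < 1"
    using isCont_G unfolding continuous_at_eps_delta by (metis zero_less_one)
  obtain s where s: "0 < s" "s < r" "s < \<delta>" using field_lbound_gt_zero[OF r(1) \<delta>(1)] by blast
  obtain x where x: "x \<in> ball 0 s - {0}" "G (R 0) + 1 < G x" using not_bounded_above[OF s(1)] by blast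
  have "x \<in> Z" using bV[of x] VZ x s by auto
  then have "G x = G (R x)" by (simp add: Z_def)
  moreover have "dist (G (R x)) (G (R 0)) < 1" using x s dist_R[of x 0] by (intro \<delta>(2)) auto
  ultimately show False using x(2) unfolding dist_real_def by linarith
qed

section \<open>Exclusion of tangency and of orthogonality\<close>

lemma w_gradient: "((\<lambda>t. w (z + t *\<^sub>R h)) has_real_derivative (F z - L (F (R z))) \<bullet> h) (at 0)"
  if "z \<in> U" "R z \<in> U"
  using has_hessian_line(1)[OF w_hessian[of "{z}"], of z 0 h] that by simp

text \<open>The boundary and the reflected boundary both pass through z = R x, and the reflected cap
  lies in \<Omega>, so they are tangent there. As both gradients have length \<open>d\<close>, they
  are equal, and the derivative of \<open>w\<close> along the inward normal is zero.\<close>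

lemma no_interior_tangency:
  assumes x: "x \<in> closure \<Omega>" "x \<bullet> e > \<mu>"
  shows "R x \<in> \<Omega>"
proof (rule ccontr)
  assume notin: "R x \<notin> \<Omega>"
  define z where "z = R x"
  have Rz: "R z = x" by (simp add: z_def RR)
  have ze: "z \<bullet> e < \<mu>" using x R_inner[of x] by (simp add: z_def)
  have zf: "z \<in> frontier \<Omega>" using cap[OF x] notin frontier_iff by (simp add: z_def)
  have "x \<notin> \<Omega>" using D_facts[of z] notin ze Rz by (auto simp: D_def z_def)
  then have xf: "x \<in> frontier \<Omega>" using x frontier_iff by auto
  define b where "b = L (F x)"
  have nb: "norm b = d" using boundary_gradient[OF xf] norm_refl_vec[OF e] by (simp add: b_def)
  \<comment> \<open>A direction entering the reflected cap, which is what
    \<open>b \<bullet> h > 0\<close> means, cannot leave the closure of \<Omega>.\<close>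
  have tang: "F z \<bullet> h \<ge> 0" if h: "b \<bullet> h > 0" for h
  proof (rule ccontr)
    assume "\<not> F z \<bullet> h \<ge> 0"
    then have "F z \<bullet> h < 0" by simp
    from direction_outward[OF zf this] obtain d1 where
      d1: "d1 > 0" "\<And>t. 0 < t \<Longrightarrow> t < d1 \<Longrightarrow> z + t *\<^sub>R h \<notin> closure \<Omega>" by blast
    have "F x \<bullet> L h > 0" using h refl_vec_inner[OF e] by (simp add: b_def)
    from direction_inward[OF xf this] obtain d2 where
      d2: "d2 > 0" "\<And>t. 0 < t \<Longrightarrow> t < d2 \<Longrightarrow> x + t *\<^sub>R L h \<in> \<Omega>" by blast
    define d3 where "d3 = (\<mu> - z \<bullet> e) / (\<bar>h \<bullet> e\<bar> + 1)"
    have d3: "d3 > 0" using ze by (simp add: d3_def add_nonneg_pos)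
    obtain t0 where t0: "0 < t0" "t0 < d1" "t0 < d2" using field_lbound_gt_zero[OF d1(1) d2(1)] by blast
    obtain t where t: "0 < t" "t < t0" "t < d3" using field_lbound_gt_zero[OF t0(1) d3] by blast
    have "R (z + t *\<^sub>R h) = x + t *\<^sub>R L h" by (simp add: reflect_add refl_vec_scaleR Rz)
    then have "R (z + t *\<^sub>R h) \<in> \<Omega>" using d2(2)[of t] t t0 by simp
    moreover have "(z + t *\<^sub>R h) \<bullet> e < \<mu>"
    proof -
      have "t * (\<bar>h \<bullet> e\<bar> + 1) < \<mu> - z \<bullet> e"
        using t(3) unfolding d3_def by (simp add: pos_less_divide_eq add_nonneg_pos)
      moreover have "t * (h \<bullet> e) \<le> t * (\<bar>h \<bullet> e\<bar> + 1)" using t by (intro mult_left_mono) auto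
      ultimately show ?thesis by (simp add: inner_add_left)
    qed
    ultimately have "z + t *\<^sub>R h \<in> D" by (simp add: D_def)
    then show False using D_subset closure_subset d1(2)[of t] t t0 by auto
  qed
  \<comment> \<open>Two half-spaces, one inside the other, with normals of equal length: if they
    differed, \<open>h = b - F z\<close> would have \<open>b \<bullet> h > 0\<close> but
    \<open>F z \<bullet> h < 0\<close>.\<close>
  have eq: "F z = b"
  proof (rule ccontr)
    assume "F z \<noteq> b"
    then have n0: "norm (F z - b) > 0" by simp
    have "(norm (F z - b))\<^sup>2 = d\<^sup>2 + d\<^sup>2 - 2 * (F z \<bullet> b)"
    proof -
      have "F z \<bullet> F z = d\<^sup>2" "b \<bullet> b = d\<^sup>2" using boundary_gradient[OF zf] nb by (simp_all add: dot_square_norm)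
      then show ?thesis unfolding power2_norm_eq_inner
        by (simp add: inner_diff_left inner_diff_right inner_commute)
    qed
    moreover have "(norm (F z - b))\<^sup>2 > 0" using n0 by simp
    ultimately have less: "F z \<bullet> b < d\<^sup>2" by simp
    have "b \<bullet> (b - F z) > 0" using less nb by (simp add: inner_diff_right dot_square_norm inner_commute)
    then have "F z \<bullet> (b - F z) \<ge> 0" by (rule tang)
    then show False using less boundary_gradient[OF zf] by (simp add: inner_diff_right dot_square_norm)
  qed
  obtain r0 where r0: "r0 > 0" "\<And>r. 0 < r \<Longrightarrow> r \<le> r0 \<Longrightarrow> ball (x + r *\<^sub>R sgn (F x)) r \<subseteq> \<Omega>"
    using interior_ball_\<Omega>[OF xf] by blast
  have znz: "norm z > 0" using frontier_nz[OF zf] by simp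
  \<comment> \<open>Points of \<open>ball p r\<close> are within \<open>2*r\<close> of
    \<open>z\<close>; the two bounds keep them below the plane and away from the pole.\<close>
  obtain r1 where r1: "0 < r1" "r1 < r0" "r1 < (\<mu> - z \<bullet> e) / 2"
    using field_lbound_gt_zero[OF r0(1), of "(\<mu> - z \<bullet> e) / 2"] ze by auto
  obtain r where r: "0 < r" "r < r1" "r < norm z / 2"
    using field_lbound_gt_zero[OF r1(1), of "norm z / 2"] znz by auto
  define n where "n = L (sgn (F x))"
  have nn: "norm n = 1" using F_nz[OF xf] norm_refl_vec[OF e] by (simp add: n_def norm_sgn)
  define p where "p = z + r *\<^sub>R n"
  have dpz: "dist p z = r" using nn r by (simp add: p_def dist_norm)
  have Rp: "R p = x + r *\<^sub>R sgn (F x)"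
    by (simp add: p_def n_def reflect_add refl_vec_scaleR Rz refl_vec_refl_vec[OF e])
  have ball_D: "y \<in> D \<and> y \<noteq> 0" if y: "y \<in> ball p r" for y
  proof -
    have "R y \<in> ball (R p) r" using y by (simp add: dist_R)
    then have "R y \<in> \<Omega>" using r0(2)[of r] r r1 Rp by auto
    have dzy: "dist z y < 2 * r" using dist_triangle[of z y p] dpz y by (simp add: dist_commute)
    have "(y - z) \<bullet> e \<le> norm (y - z) * norm e" by (rule norm_cauchy_schwarz)
    then have "(y - z) \<bullet> e < 2 * r" using dzy e by (simp add: dist_norm norm_minus_commute)
    then have "y \<bullet> e < \<mu>" using r r1 by (simp add: inner_diff_left)
    moreover have "y \<noteq> 0" using dzy r by auto
    ultimately show ?thesis using \<open>R y \<in> \<Omega>\<close> by (simp add: D_def)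
  qed
  have "0 < (F z - L (F (R z))) \<bullet> (p - z)"
  proof (rule hopf_normal_derivative[OF _ _ r(1) dpz])
    show "superharmonic_on w (ball p r)" by (rule w_superharmonic) (use ball_D D_facts in blast)
    show "0 < w y" if "y \<in> ball p r" for y using w_pos ball_D[OF that] by blast
    show "w z = 0" using boundary_value[OF zf] boundary_value[OF xf] Rz by simp
    show "((\<lambda>t. w (z + t *\<^sub>R (p - z))) has_real_derivative (F z - L (F (R z))) \<bullet> (p - z)) (at 0)"
      by (rule w_gradient) (use frontier_U zf xf Rz in auto)
  qed
  then show False using eq Rz by (simp add: b_def)
qed

text \<open>The interior ball of \<Omega> at \<open>x\<close> is centered on the plane, since its
  normal is orthogonal to \<open>e\<close>, and half of it lies in \<open>D\<close>;
  \<open>corner_bound\<close> gives w \<ge> k t^2 / 2 on the diagonal through the corner. There the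
  first-order term of \<open>w\<close> vanishes and the second-order one is a multiple of
  \<open>A x n \<bullet> e\<close>, which is zero by \<open>hessian_tangential\<close> and symmetry
  of the Hessian.\<close>

lemma no_orthogonality:
  assumes x: "x \<in> frontier \<Omega>" "x \<bullet> e = \<mu>"
  shows "F x \<bullet> e < 0"
proof (rule ccontr)
  assume "\<not> F x \<bullet> e < 0"
  then have Fe: "F x \<bullet> e = 0" using slope[OF x] by simp
  define n where "n = sgn (F x)"
  have Fn: "F x = d *\<^sub>R n" using boundary_gradient[OF x(1)] d by (simp add: n_def sgn_div_norm)
  have nn: "norm n = 1" using F_nz[OF x(1)] by (simp add: n_def norm_sgn)
  have ne: "n \<bullet> e = 0" using Fe d Fn by simp
  have xU: "x \<in> U" using frontier_U[OF x(1)] .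
  have "A x e \<bullet> F x = 0" by (rule hessian_tangential[OF x(1) Fe])
  then have Aen: "A x e \<bullet> n = 0" using Fn d by simp
  then have Ane: "A x n \<bullet> e = 0" using hessian_symmetric[OF hess open_U xU, of n e] by simp
  obtain r0 where r0: "r0 > 0" "\<And>r. 0 < r \<Longrightarrow> r \<le> r0 \<Longrightarrow> ball (x + r *\<^sub>R n) r \<subseteq> \<Omega>"
    using interior_ball_\<Omega>[OF x(1)] unfolding n_def by blast
  have xnz: "norm x > 0" using frontier_nz[OF x(1)] by simp
  obtain r where r: "0 < r" "r < r0" "r < norm x / 2"
    using field_lbound_gt_zero[OF r0(1), of "norm x / 2"] xnz by auto
  define p where "p = x + r *\<^sub>R n"
  have pe: "p \<bullet> e = \<mu>" using x ne by (simp add: p_def inner_add_left)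
  have Rp: "R p = p" by (rule reflect_fixed[OF pe])
  have bp: "ball p r \<subseteq> \<Omega>" using r0(2)[of r] r by (simp add: p_def)
  have dpx: "dist p x = r" unfolding p_def dist_norm using nn r by simp
  define H where "H = {y\<in>ball p r. (y - p) \<bullet> e < 0}"
  have HD: "y \<in> D \<and> y \<noteq> 0" if y: "y \<in> H" for y
  proof -
    have "dist x y < 2 * r" using dist_triangle[of x y p] dpx y by (simp add: dist_commute H_def)
    then have "y \<noteq> 0" using r by auto
    moreover have "R y \<in> ball p r" using y dist_R[of p y] Rp by (simp add: H_def)
    ultimately show ?thesis using y bp pe by (auto simp: H_def D_def inner_diff_left)
  qed
  have shw: "superharmonic_on w H" by (rule w_superharmonic) (use HD D_facts in blast)
  obtain k where k: "k > 0"
    "\<And>y. y \<in> H \<Longrightarrow> r/2 < dist p y \<Longrightarrow> k * (- ((y - p) \<bullet> e)) * (r - dist p y) \<le> w y"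
    using corner_bound[OF e r(1) H_def shw] w_pos HD by blast
  \<comment> \<open>On the diagonal the depth below the plane is exactly \<open>t\<close>, and
    \<open>r\<^sup>2 - (dist p ?y)\<^sup>2 = 2 * t * (r - t)\<close> makes the distance to the
    sphere at least \<open>t/2\<close>.\<close>
  have low: "k * t * t / 2 \<le> w (x + t *\<^sub>R (n - e))" if t: "0 < t" "t < r/2" for t
  proof -
    let ?y = "x + t *\<^sub>R (n - e)"
    have yp: "?y - p = (t - r) *\<^sub>R n - t *\<^sub>R e" by (simp add: p_def algebra_simps)
    have s: "(?y - p) \<bullet> e = - t" unfolding yp using ne inner_unit_self[OF e] by (simp add: inner_diff_left)
    have sq: "(dist p ?y)\<^sup>2 = (r - t)\<^sup>2 + t\<^sup>2"
    proof -
      have "(dist p ?y)\<^sup>2 = (?y - p) \<bullet> (?y - p)"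
        by (metis dist_commute dist_norm power2_norm_eq_inner)
      also have "\<dots> = (t - r)\<^sup>2 + t\<^sup>2" unfolding yp
        using ne inner_unit_self[OF e] inner_unit_self[OF nn] by (simp add: inner_diff_left inner_diff_right inner_commute power2_eq_square)
      finally show ?thesis by (simp add: power2_commute)
    qed
    have sq2: "r\<^sup>2 - (dist p ?y)\<^sup>2 = t * (2 * (r - t))" unfolding sq by (simp add: power2_eq_square algebra_simps)
    have "t * (2 * (r - t)) \<ge> t * r" using t by (intro mult_left_mono) auto
    then have gap: "t * r \<le> r\<^sup>2 - (dist p ?y)\<^sup>2" using sq2 by simp
    moreover have "0 < t * r" using t r by simp
    ultimately have "(dist p ?y)\<^sup>2 < r\<^sup>2" by linarith
    then have lt: "dist p ?y < r" using r by (meson less_eq_real_def power_less_imp_less_base)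
    have "(r/2)\<^sup>2 < (r - t)\<^sup>2" using t r by (intro power_strict_mono) auto
    then have "(r/2)\<^sup>2 < (dist p ?y)\<^sup>2" unfolding sq using zero_le_power2[of t] by linarith
    then have gt: "r/2 < dist p ?y" by (meson power_less_imp_less_base zero_le_dist)
    have "t * r \<le> (r - dist p ?y) * (r + dist p ?y)" using gap by (simp add: power2_eq_square algebra_simps)
    also have "\<dots> \<le> (r - dist p ?y) * (2 * r)" using lt by (intro mult_left_mono) auto
    finally have "r * (t/2) \<le> r * (r - dist p ?y)" by (simp add: mult.commute)
    then have half: "t/2 \<le> r - dist p ?y" using r by simp
    have "?y \<in> H" using lt s t by (simp add: H_def)
    from k(2)[OF this gt] have "k * t * (r - dist p ?y) \<le> w ?y" unfolding s by simp
    moreover have "k * t * (t/2) \<le> k * t * (r - dist p ?y)" using half k t by (intro mult_left_mono) auto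
    ultimately show ?thesis by simp
  qed
  \<comment> \<open>The derivative of \<open>w\<close> along the diagonal. It vanishes at 0 together
    with its own derivative, so one application of the mean value theorem yields w = o(t^2).\<close>
  define \<psi> where "\<psi> = (\<lambda>t. F (x + t *\<^sub>R (n - e)) \<bullet> (n - e) - F (x + t *\<^sub>R (n + e)) \<bullet> (n + e))"
  have \<psi>0: "\<psi> 0 = 0" using Fe by (simp add: \<psi>_def inner_diff_right inner_add_right)
  have lin: "linear (A x)" using has_hessian_linear[OF hess xU] .
  have "(\<psi> has_real_derivative A x (n - e) \<bullet> (n - e) - A x (n + e) \<bullet> (n + e)) (at 0)"
    unfolding \<psi>_def
    using has_hessian_line(2)[OF hess, of x 0 "n - e" "n - e"] has_hessian_line(2)[OF hess, of x 0 "n + e" "n + e"] xU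
    by (intro DERIV_diff) auto
  also have "A x (n - e) \<bullet> (n - e) - A x (n + e) \<bullet> (n + e) = 0"
    using lin Aen Ane by (simp add: linear_diff linear_add inner_diff_left inner_diff_right inner_add_left inner_add_right)
  finally have "((\<lambda>h. \<psi> h / h) \<longlongrightarrow> 0) (at 0)" using \<psi>0 unfolding DERIV_def by simp
  then have "eventually (\<lambda>h. dist (\<psi> h / h) 0 < k / 4) (at 0)" using k(1) by (intro tendstoD) auto
  then obtain d1 where d1: "d1 > 0" "\<And>h. h \<noteq> 0 \<Longrightarrow> dist h 0 < d1 \<Longrightarrow> dist (\<psi> h / h) 0 < k / 4"
    unfolding eventually_at by blast
  obtain r2 where r2: "r2 > 0" "ball x r2 \<subseteq> U" using open_U xU open_contains_ball by blast
  obtain t1 where t1: "0 < t1" "t1 < d1" "t1 < r/2" using field_lbound_gt_zero[OF d1(1), of "r/2"] r(1) by auto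
  obtain t where t: "0 < t" "t < t1" "t < r2 / 2" using field_lbound_gt_zero[OF t1(1), of "r2/2"] r2(1) by auto
  have inU: "x + s *\<^sub>R (n - e) \<in> U" "x + s *\<^sub>R (n + e) \<in> U" if "0 \<le> s" "s \<le> t" for s
  proof -
    have "norm (n - e) \<le> 2" "norm (n + e) \<le> 2"
      using norm_triangle_ineq4[of n e] norm_triangle_ineq[of n e] nn e by auto
    then have "s * norm (n - e) \<le> t * 2" "s * norm (n + e) \<le> t * 2" using that by (auto intro: mult_mono)
    then have b: "s * norm (n - e) < r2" "s * norm (n + e) < r2" using t by auto
    have "x + s *\<^sub>R h \<in> ball x r2" if "s * norm h < r2" for h using that \<open>0 \<le> s\<close> by (simp add: dist_norm)
    then show "x + s *\<^sub>R (n - e) \<in> U" "x + s *\<^sub>R (n + e) \<in> U" using b r2(2) by blast+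
  qed
  let ?\<phi> = "\<lambda>t. G (x + t *\<^sub>R (n - e)) - G (x + t *\<^sub>R (n + e))"
  have "\<exists>z. 0 < z \<and> z < t \<and> ?\<phi> t - ?\<phi> 0 = (t - 0) * \<psi> z"
    unfolding \<psi>_def using t inU by (intro MVT2) (auto intro!: DERIV_diff has_hessian_line(1)[OF hess])
  then obtain s where s: "0 < s" "s < t" "?\<phi> t - ?\<phi> 0 = t * \<psi> s" by auto
  have Rx: "R x = x" by (rule reflect_fixed[OF x(2)])
  have "L (n - e) = n + e" using ne inner_unit_self[OF e] by (simp add: refl_vec_def inner_diff_left scaleR_2)
  then have "R (x + t *\<^sub>R (n - e)) = x + t *\<^sub>R (n + e)" by (simp add: reflect_add refl_vec_scaleR Rx)
  then have "w (x + t *\<^sub>R (n - e)) = t * \<psi> s" using s(3) by simp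
  moreover have "\<psi> s < (k / 4) * t"
  proof -
    have "\<bar>\<psi> s / s\<bar> < k / 4" using d1(2)[of s] s t t1 by (simp add: dist_real_def)
    then have "\<psi> s / s < k / 4" by linarith
    then have "\<psi> s < (k / 4) * s" using s(1) by (simp add: field_simps)
    also have "\<dots> \<le> (k / 4) * t" using s k(1) by (intro mult_left_mono) auto
    finally show ?thesis .
  qed
  then have "t * \<psi> s < t * ((k / 4) * t)" using t(1) by (rule mult_strict_left_mono)
  moreover have "k * t * t / 2 \<le> w (x + t *\<^sub>R (n - e))" using low[of t] t t1 by simp
  moreover have "t * ((k / 4) * t) \<le> k * t * t / 2" using k(1) t(1) by simp
  ultimately show False by linarith
qed

end

section \<open>Continuation in the position of the plane\<close>

context overdetermined
begin

text \<open>Strict versions of \<open>cap\<close> and \<open>slope\<close> in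
  \<open>moving_plane\<close>. They survive small changes of \<mu>, whereas limits yield only the
  weak versions, which that locale turns back into strict ones.\<close>

definition admissible :: "'a \<Rightarrow> real \<Rightarrow> bool" where
  "admissible e \<mu> \<longleftrightarrow> (\<forall>x\<in>closure \<Omega>. x \<bullet> e > \<mu> \<longrightarrow> reflect e \<mu> x \<in> \<Omega>) \<and>
     (\<forall>x\<in>frontier \<Omega>. x \<bullet> e = \<mu> \<longrightarrow> F x \<bullet> e < 0)"

lemma reflect_tendsto:
  assumes "(a \<longlongrightarrow> \<mu>) net" "(X \<longlongrightarrow> x) net"
  shows "((\<lambda>n. reflect e (a n) (X n)) \<longlongrightarrow> reflect e \<mu> x) net"
  unfolding reflect_def using assms by (intro tendsto_intros)

lemma reflect_limit:
  assumes x: "x \<in> closure \<Omega>" "x \<bullet> e > \<mu>"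
    and adm: "\<And>\<nu>. \<nu> > \<mu> \<Longrightarrow> admissible e \<nu>"
  shows "reflect e \<mu> x \<in> closure \<Omega>"
proof (rule Lim_in_closed_set)
  show "((\<lambda>\<nu>. reflect e \<nu> x) \<longlongrightarrow> reflect e \<mu> x) (at_right \<mu>)"
    by (intro reflect_tendsto tendsto_intros)
  show "eventually (\<lambda>\<nu>. reflect e \<nu> x \<in> closure \<Omega>) (at_right \<mu>)"
    unfolding eventually_at_right_field
    using x adm subsetD[OF closure_subset[of \<Omega>]] by (intro exI[of _ "x \<bullet> e"]) (auto simp: admissible_def)
qed auto

text \<open>If \<open>G\<close> increased in direction \<open>e\<close> at \<open>x\<close>, then x
  + t e would be in \<Omega> for small \<open>t\<close> while its mirror image x - t e would be
  outside the closure.\<close>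

lemma slope_limit:
  assumes e: "norm e = 1" and x: "x \<in> frontier \<Omega>" "x \<bullet> e = \<mu>"
    and adm: "\<And>\<nu>. \<nu> > \<mu> \<Longrightarrow> admissible e \<nu>"
  shows "F x \<bullet> e \<le> 0"
proof (rule ccontr)
  assume "\<not> F x \<bullet> e \<le> 0"
  then have p: "F x \<bullet> e > 0" "F x \<bullet> (- e) < 0" by auto
  obtain d1 where d1: "d1 > 0" "\<And>t. 0 < t \<Longrightarrow> t < d1 \<Longrightarrow> x + t *\<^sub>R e \<in> \<Omega>"
    using direction_inward[OF x(1) p(1)] by blast
  obtain d2 where d2: "d2 > 0" "\<And>t. 0 < t \<Longrightarrow> t < d2 \<Longrightarrow> x + t *\<^sub>R (- e) \<notin> closure \<Omega>"
    using direction_outward[OF x(1) p(2)] by blast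
  obtain t where t: "0 < t" "t < d1" "t < d2" using field_lbound_gt_zero[OF d1(1) d2(1)] by blast
  have ip: "(x + t *\<^sub>R e) \<bullet> e = \<mu> + t" using x inner_unit_self[OF e] by (simp add: inner_add_left)
  have "reflect e \<mu> (x + t *\<^sub>R e) \<in> closure \<Omega>"
    by (rule reflect_limit[OF _ _ adm]) (use d1(2)[of t] t closure_subset ip in auto)
  moreover have "reflect e \<mu> (x + t *\<^sub>R e) = x + t *\<^sub>R (- e)"
    using ip by (simp add: reflect_def algebra_simps) (simp add: scaleR_2[symmetric])
  ultimately show False using d2(2)[of t] t by simp
qed

lemma moving_plane_limit:
  assumes "norm e = 1" "\<mu> > 0" "\<And>\<nu>. \<nu> > \<mu> \<Longrightarrow> admissible e \<nu>"
  shows "moving_plane \<Omega> U G F A c d e \<mu>"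
proof unfold_locales
  show "norm e = 1" "0 < \<mu>" using assms by auto
  show "\<And>x. x \<in> closure \<Omega> \<Longrightarrow> \<mu> < x \<bullet> e \<Longrightarrow> reflect e \<mu> x \<in> closure \<Omega>"
    using reflect_limit assms by blast
  show "\<And>x. x \<in> frontier \<Omega> \<Longrightarrow> x \<bullet> e = \<mu> \<Longrightarrow> F x \<bullet> e \<le> 0"
    using slope_limit assms by blast
qed

lemma admissible_closed:
  assumes "norm e = 1" "\<mu> > 0" "\<And>\<nu>. \<nu> > \<mu> \<Longrightarrow> admissible e \<nu>"
  shows "admissible e \<mu>"
proof -
  interpret moving_plane \<Omega> U G F A c d e \<mu> using moving_plane_limit[OF assms] .
  show ?thesis unfolding admissible_def using no_interior_tangency no_orthogonality by blast
qed

lemma compact_subsequence: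
  assumes "\<And>n. X n \<in> closure \<Omega>"
  obtains x and r :: "nat \<Rightarrow> nat" where "x \<in> closure \<Omega>" "strict_mono r" "(X \<circ> r) \<longlonglongrightarrow> x"
proof -
  have "compact (closure \<Omega>)" using bounded_\<Omega> compact_closure by blast
  then show thesis using assms that unfolding compact_def by metis
qed

lemma tendsto_below:
  fixes a :: "nat \<Rightarrow> real"
  assumes "\<And>n. \<mu> - inverse (real (Suc n)) < a n" "\<And>n. a n < \<mu>"
  shows "a \<longlonglongrightarrow> \<mu>"
proof (rule tendsto_sandwich)
  show "(\<lambda>n. \<mu> - inverse (real (Suc n))) \<longlonglongrightarrow> \<mu>"
    using tendsto_diff[OF tendsto_const[of \<mu>] LIMSEQ_inverse_real_of_nat] by simp
  show "(\<lambda>n. \<mu>) \<longlonglongrightarrow> \<mu>" by simp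
qed (use assms in \<open>auto intro!: eventuallyI less_imp_le\<close>)

text \<open>Violations for planes tending to \<mu> accumulate at a point that must lie on the plane,
  since off it the strict condition is open, and hence on the boundary. There \<open>G\<close>
  decreases strictly in direction \<open>e\<close>, so a point of the closure cannot lie above a
  reflection that is outside \<Omega>.\<close>

lemma cap_open:
  assumes adm: "admissible e \<mu>"
  shows "\<exists>\<delta>>0. \<forall>\<nu>. \<mu> - \<delta> < \<nu> \<and> \<nu> < \<mu> \<longrightarrow> (\<forall>x\<in>closure \<Omega>. x \<bullet> e > \<nu> \<longrightarrow> reflect e \<nu> x \<in> \<Omega>)"
proof (rule ccontr)
  assume neg: "\<not> ?thesis"
  have "\<exists>\<nu> x. \<mu> - inverse (real (Suc n)) < \<nu> \<and> \<nu> < \<mu> \<and> x \<in> closure \<Omega> \<and> x \<bullet> e > \<nu> \<and> reflect e \<nu> x \<notin> \<Omega>" for n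
  proof -
    have "inverse (real (Suc n)) > 0" by simp
    then show ?thesis using neg by blast
  qed
  then obtain a X where aX: "\<And>n. \<mu> - inverse (real (Suc n)) < a n" "\<And>n. a n < \<mu>"
    "\<And>n. X n \<in> closure \<Omega>" "\<And>n. X n \<bullet> e > a n" "\<And>n. reflect e (a n) (X n) \<notin> \<Omega>"
    by metis
  have a: "a \<longlonglongrightarrow> \<mu>" using tendsto_below aX(1,2) by blast
  obtain x r where x: "x \<in> closure \<Omega>" and r: "strict_mono r" "(X \<circ> r) \<longlonglongrightarrow> x"
    using compact_subsequence[of X] aX(3) by blast
  have ar: "(a \<circ> r) \<longlonglongrightarrow> \<mu>" using a r(1) LIMSEQ_subseq_LIMSEQ by blast
  have "(\<lambda>n. (X \<circ> r) n \<bullet> e) \<longlonglongrightarrow> x \<bullet> e" using r(2) by (intro tendsto_intros)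
  then have xe: "\<mu> \<le> x \<bullet> e"
    by (rule LIMSEQ_le[OF ar]) (use aX(4) in \<open>auto intro!: exI[of _ 0] less_imp_le\<close>)
  have R: "(\<lambda>n. reflect e ((a \<circ> r) n) ((X \<circ> r) n)) \<longlonglongrightarrow> reflect e \<mu> x"
    using reflect_tendsto[OF ar r(2)] .
  have "reflect e \<mu> x \<in> - \<Omega>"
    by (rule Lim_in_closed_set[OF _ _ _ R]) (use open_\<Omega> aX(5) in auto)
  then have Rx: "reflect e \<mu> x \<notin> \<Omega>" by simp
  then have xe2: "x \<bullet> e = \<mu>" using adm x xe unfolding admissible_def by force
  then have fx: "reflect e \<mu> x = x" by (rule reflect_fixed)
  then have xf: "x \<in> frontier \<Omega>" using Rx x frontier_iff by auto
  then have Fe: "F x \<bullet> e < 0" using adm xe2 unfolding admissible_def by blast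
  obtain \<rho> where \<rho>: "\<rho> > 0" "ball x \<rho> \<subseteq> U - {0}" "\<And>y. y \<in> ball x \<rho> \<Longrightarrow> y \<in> \<Omega> \<longleftrightarrow> c < G y"
    "\<And>y. y \<in> ball x \<rho> \<Longrightarrow> y \<in> closure \<Omega> \<longleftrightarrow> c \<le> G y" using level[OF xf] by metis
  have "isCont (\<lambda>y. F y \<bullet> e) x" using isCont_F[OF frontier_U[OF xf]] by (intro continuous_intros)
  moreover have "- (F x \<bullet> e) > 0" using Fe by simp
  ultimately obtain s where s: "s > 0" "\<And>y. dist y x < s \<Longrightarrow> dist (F y \<bullet> e) (F x \<bullet> e) < - (F x \<bullet> e)"
    unfolding continuous_at_eps_delta by blast
  have sF: "F y \<bullet> e < 0" if "dist y x < s" for y using s(2)[OF that] unfolding dist_real_def by linarith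
  define \<tau> where "\<tau> = min \<rho> s"
  have \<tau>: "\<tau> > 0" using \<rho>(1) s(1) by (simp add: \<tau>_def)
  have "eventually (\<lambda>n. dist ((X \<circ> r) n) x < \<tau>) sequentially" using r(2) \<tau> by (rule tendstoD)
  moreover have "eventually (\<lambda>n. dist (reflect e ((a \<circ> r) n) ((X \<circ> r) n)) x < \<tau>) sequentially"
    using tendstoD[OF R \<tau>] fx by simp
  ultimately have "eventually (\<lambda>n. dist ((X \<circ> r) n) x < \<tau> \<and> dist (reflect e ((a \<circ> r) n) ((X \<circ> r) n)) x < \<tau>) sequentially"
    by eventually_elim auto
  then obtain n where n: "dist (X (r n)) x < \<tau>" "dist (reflect e (a (r n)) (X (r n))) x < \<tau>"
    by (auto simp: eventually_sequentially)
  define y where "y = reflect e (a (r n)) (X (r n))"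
  define T where "T = 2 * (X (r n) \<bullet> e - a (r n))"
  have T: "T > 0" using aX(4)[of "r n"] by (simp add: T_def)
  have Xy: "X (r n) = y + T *\<^sub>R e" by (simp add: y_def T_def reflect_def algebra_simps)
  have "dist y x < \<tau>" using n(2) by (simp add: y_def)
  moreover have "dist (y + T *\<^sub>R e) x < \<tau>" using n(1) Xy by metis
  ultimately have yb: "y \<in> ball x \<tau>" "y + T *\<^sub>R e \<in> ball x \<tau>" by (simp_all add: dist_commute)
  have seg: "y + t *\<^sub>R e \<in> ball x \<tau>" if "0 \<le> t" "t \<le> T" for t
  proof -
    have "(1 - t/T) *\<^sub>R y + (t/T) *\<^sub>R (y + T *\<^sub>R e) \<in> ball x \<tau>"
      using yb that T by (intro convexD[OF convex_ball]) auto
    moreover have "(1 - t/T) *\<^sub>R y + (t/T) *\<^sub>R (y + T *\<^sub>R e) = y + t *\<^sub>R e" using T by (simp add: algebra_simps)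
    ultimately show ?thesis by simp
  qed
  \<comment> \<open>The segment from the reflection \<open>y\<close> up to \<open>X (r n)\<close>
    runs where \<open>F\<close> has negative \<open>e\<close>-component, so \<open>G\<close> is
    smaller at the upper end. But that end is in the closure, where \<open>G \<ge> c\<close>, and
    \<open>y\<close> is outside \<Omega>, where \<open>G \<le> c\<close>.\<close>
  have "\<exists>z. 0 < z \<and> z < T \<and> G (y + T *\<^sub>R e) - G (y + 0 *\<^sub>R e) = (T - 0) * (F (y + z *\<^sub>R e) \<bullet> e)"
  proof (intro MVT2[where f = "\<lambda>t. G (y + t *\<^sub>R e)"] T)
    fix t assume "0 \<le> t" "t \<le> T"
    then have "y + t *\<^sub>R e \<in> ball x \<rho>" using seg by (auto simp: \<tau>_def)
    then have "y + t *\<^sub>R e \<in> U" using \<rho>(2) by blast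
    then show "((\<lambda>t. G (y + t *\<^sub>R e)) has_real_derivative F (y + t *\<^sub>R e) \<bullet> e) (at t)"
      by (rule has_hessian_line(1)[OF hess])
  qed
  then obtain z where z: "0 < z" "z < T" "G (X (r n)) - G y = T * (F (y + z *\<^sub>R e) \<bullet> e)"
    using Xy by auto
  have "F (y + z *\<^sub>R e) \<bullet> e < 0" using seg[of z] z by (intro sF) (auto simp: \<tau>_def dist_commute)
  then have less: "G (X (r n)) < G y" using z(3) T using mult_pos_neg[of T] \<open>F (y + z *\<^sub>R e) \<bullet> e < 0\<close> by fastforce
  have "c \<le> G (X (r n))" using \<rho>(4)[of "X (r n)"] aX(3) n by (auto simp: \<tau>_def dist_commute)
  moreover have "G y \<le> c" using \<rho>(3)[of y] aX(5)[of "r n"] yb by (auto simp: \<tau>_def y_def[symmetric])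
  ultimately show False using less by simp
qed

lemma slope_open:
  assumes adm: "admissible e \<mu>"
  shows "\<exists>\<delta>>0. \<forall>\<nu>. \<mu> - \<delta> < \<nu> \<and> \<nu> < \<mu> \<longrightarrow> (\<forall>x\<in>frontier \<Omega>. x \<bullet> e = \<nu> \<longrightarrow> F x \<bullet> e < 0)"
proof (rule ccontr)
  assume neg: "\<not> ?thesis"
  have "\<exists>\<nu> x. \<mu> - inverse (real (Suc n)) < \<nu> \<and> \<nu> < \<mu> \<and> x \<in> frontier \<Omega> \<and> x \<bullet> e = \<nu> \<and> F x \<bullet> e \<ge> 0" for n
  proof -
    have "inverse (real (Suc n)) > 0" by simp
    then show ?thesis using neg by (meson not_less)
  qed
  then obtain a X where aX: "\<And>n. \<mu> - inverse (real (Suc n)) < a n" "\<And>n. a n < \<mu>"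
    "\<And>n. X n \<in> frontier \<Omega>" "\<And>n. X n \<bullet> e = a n" "\<And>n. F (X n) \<bullet> e \<ge> 0"
    by metis
  have a: "a \<longlonglongrightarrow> \<mu>" using tendsto_below aX(1,2) by blast
  have "X n \<in> closure \<Omega>" for n using aX(3)[of n] frontier_iff by blast
  then obtain x r where r: "strict_mono r" "(X \<circ> r) \<longlonglongrightarrow> x"
    using compact_subsequence[of X] by blast
  have ar: "(a \<circ> r) \<longlonglongrightarrow> \<mu>" using a r(1) LIMSEQ_subseq_LIMSEQ by blast
  have xf: "x \<in> frontier \<Omega>"
    by (rule Lim_in_closed_set[OF _ _ _ r(2)]) (use aX(3) in auto)
  have "(\<lambda>n. (X \<circ> r) n \<bullet> e) \<longlonglongrightarrow> x \<bullet> e" using r(2) by (intro tendsto_intros)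
  moreover have "(\<lambda>n. (X \<circ> r) n \<bullet> e) = a \<circ> r" using aX(4) by auto
  ultimately have "x \<bullet> e = \<mu>" using ar LIMSEQ_unique by metis
  then have Fe: "F x \<bullet> e < 0" using adm xf unfolding admissible_def by blast
  have "(\<lambda>n. F ((X \<circ> r) n) \<bullet> e) \<longlonglongrightarrow> F x \<bullet> e"
    using isCont_tendsto_compose[OF isCont_F[OF frontier_U[OF xf]] r(2)] by (intro tendsto_intros)
  then have "0 \<le> F x \<bullet> e" by (rule LIMSEQ_le_const) (use aX(5) in auto)
  then show False using Fe by simp
qed

lemma admissible_open:
  assumes adm: "admissible e \<mu>"
  shows "\<exists>\<delta>>0. \<forall>\<nu>. \<mu> - \<delta> < \<nu> \<and> \<nu> < \<mu> \<longrightarrow> admissible e \<nu>"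
proof -
  obtain d1 where d1: "d1 > 0" "\<And>\<nu>. \<mu> - d1 < \<nu> \<Longrightarrow> \<nu> < \<mu> \<Longrightarrow> (\<forall>x\<in>closure \<Omega>. x \<bullet> e > \<nu> \<longrightarrow> reflect e \<nu> x \<in> \<Omega>)"
    using cap_open[OF adm] by blast
  obtain d2 where d2: "d2 > 0" "\<And>\<nu>. \<mu> - d2 < \<nu> \<Longrightarrow> \<nu> < \<mu> \<Longrightarrow> (\<forall>x\<in>frontier \<Omega>. x \<bullet> e = \<nu> \<longrightarrow> F x \<bullet> e < 0)"
    using slope_open[OF adm] by blast
  show ?thesis
  proof (intro exI[of _ "min d1 d2"] conjI allI impI)
    fix \<nu> assume "\<mu> - min d1 d2 < \<nu> \<and> \<nu> < \<mu>"
    then have "\<mu> - d1 < \<nu>" "\<mu> - d2 < \<nu>" "\<nu> < \<mu>" by auto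
    then show "admissible e \<nu>" unfolding admissible_def using d1(2) d2(2) by blast
  qed (use d1 d2 in auto)
qed

text \<open>For planes beyond \<Omega> the conditions are vacuous; admissibility passes to the limit
  from above and persists slightly below.\<close>

lemma all_admissible:
  assumes e: "norm e = 1" and "\<mu> > 0"
  shows "admissible e \<mu>"
proof (rule ccontr)
  assume na: "\<not> admissible e \<mu>"
  obtain B where B: "\<And>x. x \<in> closure \<Omega> \<Longrightarrow> norm x \<le> B"
    using bounded_closure[OF bounded_\<Omega>] bounded_iff by blast
  have big: "admissible e \<nu>" if "\<nu> > B" for \<nu>
  proof -
    have "x \<bullet> e < \<nu>" if "x \<in> closure \<Omega>" for x
      using norm_cauchy_schwarz[of x e] e B[OF that] \<open>\<nu> > B\<close> by simp
    then show ?thesis unfolding admissible_def using frontier_iff by force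
  qed
  \<comment> \<open>Only positions from \<mu> on are collected, which keeps the supremum positive,
    as \<open>admissible_closed\<close> requires.\<close>
  define S where "S = {\<nu>. \<mu> \<le> \<nu> \<and> \<not> admissible e \<nu>}"
  have S: "\<mu> \<in> S" "bdd_above S"
    using na big by (auto simp: S_def intro!: bdd_aboveI[of _ B] leI)
  define s where "s = Sup S"
  have s: "\<mu> \<le> s" unfolding s_def using S by (intro cSup_upper)
  have above: "admissible e \<nu>" if "\<nu> > s" for \<nu>
  proof (rule ccontr)
    assume "\<not> admissible e \<nu>"
    then have "\<nu> \<in> S" using that s by (simp add: S_def)
    then show False using cSup_upper[OF _ S(2)] that by (force simp: s_def)
  qed
  have "admissible e s" using admissible_closed[OF e _ above] s assms by simp
  from admissible_open[OF this] obtain \<delta> where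
    \<delta>: "\<delta> > 0" "\<And>\<nu>. s - \<delta> < \<nu> \<Longrightarrow> \<nu> < s \<Longrightarrow> admissible e \<nu>" by blast
  have "\<nu> \<le> s - \<delta>" if "\<nu> \<in> S" for \<nu>
  proof (rule ccontr)
    assume "\<not> \<nu> \<le> s - \<delta>"
    then have "admissible e \<nu>" using \<delta>(2) above \<open>admissible e s\<close> by (cases \<nu> s rule: linorder_cases) auto
    then show False using that by (simp add: S_def)
  qed
  then have "s \<le> s - \<delta>" unfolding s_def using S by (intro cSup_least) auto
  then show False using \<delta>(1) by simp
qed

section \<open>The limiting plane through the origin\<close>

lemma reflect_ge:
  assumes e: "norm e = 1" and "\<mu> > 0" and x: "x \<in> closure \<Omega>" "x \<bullet> e > \<mu>" "reflect e \<mu> x \<noteq> 0"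
  shows "G x \<le> G (reflect e \<mu> x)"
proof -
  interpret moving_plane \<Omega> U G F A c d e \<mu>
    using moving_plane_limit[OF e \<open>\<mu> > 0\<close>] all_admissible[OF e] \<open>\<mu> > 0\<close> by simp
  show ?thesis
  proof (cases "x \<in> \<Omega>")
    case True
    then have "R x \<in> D" using x R_inner[of x] by (simp add: D_def RR)
    then show ?thesis using w_nonneg x by (force simp: RR)
  next
    case False
    then have "G x = c" using boundary_value frontier_iff x by blast
    then show ?thesis using G_ge cap x by simp
  qed
qed

text \<open>Let the position decrease to 0 in \<open>reflect_ge\<close>. The limit of the reflected
  points has a negative \<open>e\<close>-coordinate, so it is not the pole and \<open>G\<close> is
  continuous there.\<close>

lemma reflect_origin:
  assumes e: "norm e = 1" and x: "x \<in> closure \<Omega>" "x \<bullet> e > 0"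
  shows "reflect e 0 x \<in> closure \<Omega>" "G x \<le> G (reflect e 0 x)"
proof -
  have lim: "((\<lambda>\<nu>. reflect e \<nu> x) \<longlongrightarrow> reflect e 0 x) (at_right 0)"
    by (intro reflect_tendsto tendsto_intros)
  show cl: "reflect e 0 x \<in> closure \<Omega>"
    by (rule reflect_limit[OF x all_admissible[OF e]])
  have nz: "reflect e 0 x \<noteq> 0" using reflect_inner[OF e, of 0 x] x(2) by auto
  then have "reflect e 0 x \<in> U" using cl closure_U by auto
  then have "((\<lambda>\<nu>. G (reflect e \<nu> x)) \<longlongrightarrow> G (reflect e 0 x)) (at_right 0)"
    using isCont_tendsto_compose[OF isCont_G lim] by blast
  moreover have "eventually (\<lambda>\<nu>. reflect e \<nu> x \<noteq> 0) (at_right 0)"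
    using lim nz by (rule tendsto_imp_eventually_ne)
  then have "eventually (\<lambda>\<nu>. G x \<le> G (reflect e \<nu> x)) (at_right 0)"
    using eventually_at_right_less[of 0] order_tendstoD(2)[OF tendsto_ident_at x(2)]
  proof eventually_elim
    case (elim \<nu>)
    then show ?case using reflect_ge[OF e, of \<nu> x] x(1) by simp
  qed
  ultimately show "G x \<le> G (reflect e 0 x)"
    by (intro tendsto_lowerbound[where F = "at_right 0"]) auto
qed

text \<open>Two points of equal norm are mirror images in their bisecting plane, which passes
  through the origin; the normal is directed towards \<open>x\<close>, so that \<open>x\<close> lies
  in the cap. Exchanging \<open>x\<close> and \<open>y\<close> replaces \<open>e\<close> by
  \<open>- e\<close> and reverses the inequality.\<close>

lemma same_norm:
  assumes x: "x \<in> closure \<Omega>" and "norm y = norm x"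
  shows "y \<in> closure \<Omega>" "x \<noteq> 0 \<Longrightarrow> G x \<le> G y"
proof -
  have *: "y \<in> closure \<Omega> \<and> G x \<le> G y" if "x \<noteq> y"
  proof -
    define e where "e = sgn (x - y)"
    have e: "norm e = 1" using that by (simp add: e_def norm_sgn)
    have xx: "x \<bullet> x = y \<bullet> y" using assms(2) by (simp add: norm_eq)
    have sq: "(x - y) \<bullet> (x - y) = 2 * (x \<bullet> (x - y))"
      using xx by (simp add: inner_diff_left inner_diff_right inner_commute)
    have n: "norm (x - y) > 0" using that by simp
    have xe: "x \<bullet> e = norm (x - y) / 2"
    proof -
      have "x \<bullet> e = inverse (norm (x - y)) * (x \<bullet> (x - y))" by (simp add: e_def sgn_div_norm)
      also have "x \<bullet> (x - y) = (norm (x - y))\<^sup>2 / 2" using sq by (simp add: power2_norm_eq_inner)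
      finally show ?thesis using n by (simp add: power2_eq_square)
    qed
    have "reflect e 0 x = x - norm (x - y) *\<^sub>R e" by (simp add: reflect_def xe)
    also have "\<dots> = y" using n by (simp add: e_def sgn_div_norm)
    finally have "reflect e 0 x = y" .
    moreover have "x \<bullet> e > 0" using xe n by linarith
    ultimately show ?thesis using reflect_origin[OF e x] by simp
  qed
  then show "y \<in> closure \<Omega>" using x by (cases "x = y") auto
  show "G x \<le> G y" using * by (cases "x = y") auto
qed

text \<open>With \<open>e\<close> pointing towards \<open>x\<close> and the plane through the
  midpoint of \<open>x\<close> and \<open>t *\<^sub>R x\<close>, the reflection of \<open>x\<close>
  is \<open>t *\<^sub>R x\<close>. Admissibility thus gives star-shapedness, which turns spheres in
  the closure into balls in \<Omega>.\<close>

lemma shrink: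
  assumes x: "x \<in> closure \<Omega>" and t: "0 \<le> t" "t < 1"
  shows "t *\<^sub>R x \<in> \<Omega>"
proof (cases "x = 0")
  case False
  define e where "e = sgn x"
  have e: "norm e = 1" using False by (simp add: e_def norm_sgn)
  have xe: "x = norm x *\<^sub>R e" using False by (simp add: e_def sgn_div_norm)
  have ip: "x \<bullet> e = norm x" using False by (simp add: e_def sgn_div_norm dot_square_norm power2_eq_square)
  define \<mu> where "\<mu> = (1 + t) * norm x / 2"
  have n: "norm x > 0" using False by simp
  have \<mu>: "\<mu> > 0" using n t by (simp add: \<mu>_def)
  have "(1 + t) * norm x < 2 * norm x" using n t by (intro mult_strict_right_mono) auto
  then have "\<mu> < x \<bullet> e" using ip by (simp add: \<mu>_def)
  then have "reflect e \<mu> x \<in> \<Omega>" using all_admissible[OF e \<mu>] x unfolding admissible_def by blast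
  moreover have "reflect e \<mu> x = t *\<^sub>R x"
  proof -
    have "2 * (\<mu> - x \<bullet> e) = (t - 1) * norm x" by (simp add: ip \<mu>_def field_simps)
    then have "reflect e \<mu> x = x + ((t - 1) * norm x) *\<^sub>R e" by (simp only: reflect_def)
    also have "((t - 1) * norm x) *\<^sub>R e = (t - 1) *\<^sub>R x" by (metis xe scaleR_scaleR)
    finally show ?thesis by (simp add: algebra_simps)
  qed
  ultimately show ?thesis by simp
qed (use zero_in in simp)

theorem symmetry:
  "\<exists>r>0. \<Omega> = ball 0 r \<and> (\<forall>x\<in>closure \<Omega> - {0}. \<forall>y\<in>closure \<Omega> - {0}. norm x = norm y \<longrightarrow> G x = G y)"
proof -
  have "compact (closure \<Omega>)" using bounded_\<Omega> compact_closure by blast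
  moreover have "closure \<Omega> \<noteq> {}" using zero_in by auto
  moreover have "continuous_on (closure \<Omega>) norm" by (intro continuous_intros)
  ultimately obtain x0 where x0: "x0 \<in> closure \<Omega>" "\<And>x. x \<in> closure \<Omega> \<Longrightarrow> norm x \<le> norm x0"
    using continuous_attains_sup[of "closure \<Omega>" norm] by blast
  define r where "r = norm x0"
  obtain y where y: "y \<in> \<Omega> - {0}" using near_boundary_point by blast
  then have "norm y \<le> r" using x0(2) closure_subset by (auto simp: r_def)
  then have r: "r > 0" using y by (metis Diff_iff insertI1 less_le_trans zero_less_norm_iff)
  have sub: "ball 0 r \<subseteq> \<Omega>"
  proof
    fix z :: 'a assume z: "z \<in> ball 0 r"
    show "z \<in> \<Omega>"
    proof (cases "z = 0")
      case False
      define y where "y = (r / norm z) *\<^sub>R z"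
      have "norm y = norm x0" using False r by (simp add: y_def r_def[symmetric])
      then have "y \<in> closure \<Omega>" using same_norm(1)[OF x0(1)] by blast
      then have "(norm z / r) *\<^sub>R y \<in> \<Omega>" using z r by (intro shrink) auto
      moreover have "(norm z / r) *\<^sub>R y = z" using False r by (simp add: y_def)
      ultimately show ?thesis by simp
    qed (use zero_in in simp)
  qed
  have "\<Omega> \<subseteq> ball 0 r"
  proof
    fix z assume z: "z \<in> \<Omega>"
    have "\<Omega> \<subseteq> cball 0 r" using x0(2) subsetD[OF closure_subset[of \<Omega>]] by (auto simp: r_def)
    then have "\<Omega> \<subseteq> interior (cball 0 r)" using open_\<Omega> interior_maximal by blast
    then show "z \<in> ball 0 r" using z by auto
  qed
  then have "\<Omega> = ball 0 r" using sub by blast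
  moreover have "\<forall>x\<in>closure \<Omega> - {0}. \<forall>y\<in>closure \<Omega> - {0}. norm x = norm y \<longrightarrow> G x = G y"
    using same_norm(2) by (metis DiffE insertI1 order_antisym)
  ultimately show ?thesis using r by blast
qed

end

section \<open>Calculus of smooth functions\<close>

lemma partial_eq: "(f has_derivative D) (at x) \<Longrightarrow> partial b f x = D b"
  unfolding partial_def by (metis frechet_derivative_at)

lemma partial_cong:
  assumes "open U" "x \<in> U" "\<And>y. y \<in> U \<Longrightarrow> f y = g y"
  shows "partial b f x = partial b g x" "f differentiable (at x) \<longleftrightarrow> g differentiable (at x)"
proof -
  have *: "(f has_derivative D) (at x) \<longleftrightarrow> (g has_derivative D) (at x)" for D
    using has_derivative_transform_within_open[OF _ assms(1,2)] assms(3) by metis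
  then show "partial b f x = partial b g x" by (simp add: partial_def frechet_derivative_def)
  show "f differentiable (at x) \<longleftrightarrow> g differentiable (at x)" using * by (simp add: differentiable_def)
qed

lemma C_k_on_cong:
  assumes "open U" "\<And>y. y \<in> U \<Longrightarrow> f y = g y"
  shows "C_k_on k U f \<longleftrightarrow> C_k_on k U g"
  using assms(2)
proof (induction k arbitrary: f g)
  case 0
  then show ?case using continuous_on_cong[OF refl, of U f g] by simp
next
  case (Suc k)
  have "partial b f y = partial b g y" "f differentiable (at y) \<longleftrightarrow> g differentiable (at y)" if "y \<in> U" for b y
    using partial_cong[OF assms(1) that Suc.prems] by auto
  then show ?case using Suc.IH[of "partial _ f" "partial _ g"] by simp
qed

lemma C_k_on_subset: "C_k_on k U f \<Longrightarrow> V \<subseteq> U \<Longrightarrow> C_k_on k V f"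
  by (induction k arbitrary: f) (auto intro: continuous_on_subset)

lemma C_k_on_Un:
  "open U \<Longrightarrow> open V \<Longrightarrow> C_k_on k U f \<Longrightarrow> C_k_on k V f \<Longrightarrow> C_k_on k (U \<union> V) f"
  by (induction k arbitrary: f) (auto intro: continuous_on_open_Un)

lemma C_k_on_Suc_lower: "C_k_on (Suc k) U f \<Longrightarrow> C_k_on k U f"
proof (induction k arbitrary: f)
  case 0
  then show ?case
    by (auto intro!: continuous_at_imp_continuous_on differentiable_imp_continuous_within)
next
  case (Suc k)
  then show ?case by simp
qed

lemma C_k_on_lower: "C_k_on k U f \<Longrightarrow> j \<le> k \<Longrightarrow> C_k_on j U f"
  by (induction k) (auto simp: le_Suc_eq dest: C_k_on_Suc_lower simp del: C_k_on.simps)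

lemma C_k_on_SucI:
  assumes "open U" "\<And>x. x \<in> U \<Longrightarrow> (f has_derivative D x) (at x)"
    and "\<And>b. b \<in> Basis \<Longrightarrow> C_k_on k U (\<lambda>x. D x b)"
  shows "C_k_on (Suc k) U f"
proof -
  have "C_k_on k U (partial b f)" if "b \<in> Basis" for b
    using C_k_on_cong[OF assms(1), of "partial b f" "\<lambda>x. D x b" k] partial_eq[OF assms(2)] assms(3)[OF that]
    by auto
  then show ?thesis using assms(2) by (auto simp: differentiable_def)
qed

lemma C_k_on_frechet:
  "C_k_on (Suc k) U f \<Longrightarrow> x \<in> U \<Longrightarrow> (f has_derivative frechet_derivative f (at x)) (at x)"
  by (simp add: frechet_derivative_works[symmetric])

lemma C_k_on_derivative:
  assumes "C_k_on (Suc k) U f" "x \<in> U"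
  shows "(f has_derivative (\<lambda>h. grad f x \<bullet> h)) (at x)"
proof -
  have d: "(f has_derivative frechet_derivative f (at x)) (at x)"
    by (rule C_k_on_frechet[OF assms])
  then have lin: "linear (frechet_derivative f (at x))" using has_derivative_linear by blast
  have "frechet_derivative f (at x) h = grad f x \<bullet> h" for h
  proof -
    have "frechet_derivative f (at x) h = frechet_derivative f (at x) (\<Sum>b\<in>Basis. (h \<bullet> b) *\<^sub>R b)"
      by (simp add: euclidean_representation)
    also have "\<dots> = (\<Sum>b\<in>Basis. (h \<bullet> b) * partial b f x)"
      using lin by (simp add: linear_sum linear_cmul partial_def)
    finally show ?thesis unfolding grad_def inner_sum_left by (simp add: inner_commute mult.commute)
  qed
  then show ?thesis using d by (metis (no_types, lifting) ext)
qed

lemma C_k_on_const: "C_k_on k U (\<lambda>x. c)"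
proof (induction k arbitrary: c)
  case (Suc k)
  have "partial b (\<lambda>x. c) = (\<lambda>x. 0)" for b :: 'a
    using partial_eq[OF has_derivative_const] by auto
  then show ?case using Suc by simp
qed simp

lemma C_k_on_add:
  assumes "open U"
  shows "C_k_on k U f \<Longrightarrow> C_k_on k U g \<Longrightarrow> C_k_on k U (\<lambda>x. f x + g x)"
proof (induction k arbitrary: f g)
  case (Suc k)
  show ?case
  proof (rule C_k_on_SucI[OF assms])
    show "((\<lambda>x. f x + g x) has_derivative (\<lambda>h. frechet_derivative f (at x) h + frechet_derivative g (at x) h)) (at x)"
      if "x \<in> U" for x
      by (intro has_derivative_add C_k_on_frechet[OF Suc.prems(1) that] C_k_on_frechet[OF Suc.prems(2) that])
    show "C_k_on k U (\<lambda>x. frechet_derivative f (at x) b + frechet_derivative g (at x) b)" if "b \<in> Basis" for b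
      using Suc.IH[of "partial b f" "partial b g"] Suc.prems that by (simp add: partial_def[abs_def])
  qed
qed (auto intro: continuous_intros)

lemma C_k_on_mult:
  assumes "open U"
  shows "C_k_on k U f \<Longrightarrow> C_k_on k U g \<Longrightarrow> C_k_on k U (\<lambda>x. f x * g x)"
proof (induction k arbitrary: f g)
  case (Suc k)
  show ?case
  proof (rule C_k_on_SucI[OF assms])
    show "((\<lambda>x. f x * g x) has_derivative
        (\<lambda>h. f x * frechet_derivative g (at x) h + frechet_derivative f (at x) h * g x)) (at x)"
      if "x \<in> U" for x
      by (intro has_derivative_mult C_k_on_frechet[OF Suc.prems(1) that] C_k_on_frechet[OF Suc.prems(2) that])
    show "C_k_on k U (\<lambda>x. f x * frechet_derivative g (at x) b + frechet_derivative f (at x) b * g x)"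
      if "b \<in> Basis" for b
      using C_k_on_add[OF assms, of k, OF Suc.IH[of f "partial b g"] Suc.IH[of "partial b f" g]]
        Suc.prems that C_k_on_Suc_lower[OF Suc.prems(1)] C_k_on_Suc_lower[OF Suc.prems(2)]
      by (simp add: partial_def[abs_def])
  qed
qed (auto intro: continuous_intros)

lemma C_k_on_cmult:
  "open U \<Longrightarrow> C_k_on k U f \<Longrightarrow> C_k_on k U (\<lambda>x. c * f x)"
  using C_k_on_mult[of U k "\<lambda>x. c" f] C_k_on_const by blast

lemma C_k_on_diff:
  "open U \<Longrightarrow> C_k_on k U f \<Longrightarrow> C_k_on k U g \<Longrightarrow> C_k_on k U (\<lambda>x. f x - g x)"
  using C_k_on_add[of U k f "\<lambda>x. (-1) * g x"] C_k_on_cmult[of U k g "-1"] by simp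

lemma C_k_on_compose:
  fixes H :: "real \<Rightarrow> real"
  assumes "open U" "\<And>x. x \<in> U \<Longrightarrow> f x \<in> V"
  shows "C_k_on k V H \<Longrightarrow> C_k_on k U f \<Longrightarrow> C_k_on k U (\<lambda>x. H (f x))"
proof (induction k arbitrary: H)
  case 0
  then show ?case using assms(2) by (auto intro: continuous_on_compose2)
next
  case (Suc k)
  show ?case
  proof (rule C_k_on_SucI[OF assms(1)])
    fix x assume x: "x \<in> U"
    have f: "(f has_derivative frechet_derivative f (at x)) (at x)"
      and H: "(H has_derivative frechet_derivative H (at (f x))) (at (f x))"
      using C_k_on_frechet[OF Suc.prems(2) x] C_k_on_frechet[OF Suc.prems(1) assms(2)[OF x]] by auto
    have "linear (frechet_derivative H (at (f x)))" using has_derivative_linear[OF H] .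
    then have "frechet_derivative H (at (f x)) h = partial 1 H (f x) * h" for h
      using linear_cmul[of "frechet_derivative H (at (f x))" h 1] by (simp add: partial_def mult.commute)
    with has_derivative_compose[OF f H]
    show "((\<lambda>x. H (f x)) has_derivative (\<lambda>h. partial 1 H (f x) * frechet_derivative f (at x) h)) (at x)"
      by simp
  next
    fix b :: 'a assume b: "b \<in> Basis"
    have "C_k_on k U (\<lambda>x. partial 1 H (f x))"
      using Suc.IH[of "partial 1 H"] Suc.prems C_k_on_Suc_lower[OF Suc.prems(2)] by simp
    then show "C_k_on k U (\<lambda>x. partial 1 H (f x) * frechet_derivative f (at x) b)"
      using C_k_on_mult[OF assms(1), of k _ "partial b f"] Suc.prems b by (simp add: partial_def[abs_def])
  qed
qed

lemma C_k_on_realI: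
  fixes H :: "real \<Rightarrow> real"
  assumes "open V" "\<And>t. t \<in> V \<Longrightarrow> (H has_real_derivative H' t) (at t)" "C_k_on k V H'"
  shows "C_k_on (Suc k) V H"
proof (rule C_k_on_SucI[OF assms(1)])
  show "(H has_derivative (\<lambda>h. H' t * h)) (at t)" if "t \<in> V" for t
    using assms(2)[OF that] by (simp add: has_field_derivative_def)
qed (use assms(3) in auto)

lemma C_k_on_inner: "C_k_on k U (\<lambda>x. (x - p) \<bullet> a)"
proof (cases k)
  case (Suc j)
  have d: "((\<lambda>x. (x - p) \<bullet> a) has_derivative (\<lambda>h. h \<bullet> a)) (at x)" for x
    by (auto intro!: derivative_eq_intros)
  have "partial b (\<lambda>x. (x - p) \<bullet> a) = (\<lambda>x. b \<bullet> a)" for b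
    using partial_eq[OF d] by auto
  then show ?thesis unfolding Suc using d by (auto simp: differentiable_def intro: C_k_on_const)
qed (auto intro!: continuous_intros)

lemma C_k_on_norm_sq: "open U \<Longrightarrow> C_k_on k U (\<lambda>x. (x - p) \<bullet> (x - p))"
proof (cases k)
  case (Suc j)
  assume U: "open U"
  show ?thesis unfolding Suc
  proof (rule C_k_on_SucI[OF U])
    show "((\<lambda>x. (x - p) \<bullet> (x - p)) has_derivative (\<lambda>h. 2 * ((x - p) \<bullet> h))) (at x)" for x
      by (auto intro!: derivative_eq_intros simp: inner_commute)
  qed (intro C_k_on_cmult[OF U] C_k_on_inner)
qed (auto intro!: continuous_intros)

lemma C_k_on_powr: "C_k_on k {0<..} (\<lambda>t. t powr a)"
proof (induction k arbitrary: a)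
  case 0
  show ?case by (auto intro!: continuous_intros)
next
  case (Suc k)
  show ?case
  proof (rule C_k_on_realI)
    show "C_k_on k {0<..} (\<lambda>t. a * t powr (a - 1))" by (intro C_k_on_cmult Suc.IH) auto
    show "((\<lambda>t. t powr a) has_real_derivative a * t powr (a - 1)) (at t)" if "t \<in> {0<..}" for t
      using that by (auto intro!: derivative_eq_intros)
  qed auto
qed

lemma C_k_on_hessian:
  assumes "C_k_on (Suc (Suc k)) U f"
  shows "\<exists>A. has_hessian f (grad f) A U \<and> (\<forall>x\<in>U. lin_trace (A x) = laplacian f x)"
proof -
  define A where "A = (\<lambda>x h. \<Sum>b\<in>Basis. frechet_derivative (partial b f) (at x) h *\<^sub>R b)"
  have "has_hessian f (grad f) A U"
    unfolding has_hessian_def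
  proof (intro ballI conjI)
    fix x assume x: "x \<in> U"
    show "(f has_derivative (\<bullet>) (grad f x)) (at x)" using C_k_on_derivative[OF assms x] .
    have "(partial b f has_derivative frechet_derivative (partial b f) (at x)) (at x)" if "b \<in> Basis" for b
      by (rule C_k_on_frechet[of k U]) (use assms x that in auto)
    then have "((\<lambda>x. \<Sum>b\<in>Basis. partial b f x *\<^sub>R b) has_derivative A x) (at x)"
      unfolding A_def by (intro has_derivative_sum has_derivative_scaleR_left)
    then show "(grad f has_derivative A x) (at x)" unfolding grad_def[abs_def] .
  qed
  moreover have "lin_trace (A x) = laplacian f x" for x
  proof -
    have "A x b \<bullet> b = partial b (partial b f) x" if "b \<in> Basis" for b
      unfolding A_def inner_sum_left_Basis[OF that] partial_def ..
    then show ?thesis by (simp add: lin_trace_def laplacian_def)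
  qed
  ultimately show ?thesis by blast
qed

lemma laplacian_unique:
  assumes "open U" "x \<in> U" "has_hessian f F A U"
  shows "laplacian f x = lin_trace (A x)"
proof -
  have "partial b (partial b f) x = A x b \<bullet> b" if "b \<in> Basis" for b
  proof -
    have 1: "partial b f y = F y \<bullet> b" if "y \<in> U" for y
      using assms(3) that by (intro partial_eq) (auto simp: has_hessian_def)
    have "(F has_derivative A x) (at x)" using assms(2,3) by (auto simp: has_hessian_def)
    then have "((\<lambda>y. F y \<bullet> b) has_derivative (\<lambda>h. A x h \<bullet> b)) (at x)" by (auto intro!: derivative_eq_intros)
    then have "partial b (\<lambda>y. F y \<bullet> b) x = A x b \<bullet> b" by (rule partial_eq)
    then show ?thesis using partial_cong(1)[of U x "partial b f" "\<lambda>y. F y \<bullet> b" b] assms(1,2) 1 by simp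
  qed
  then show ?thesis by (simp add: lin_trace_def laplacian_def)
qed

text \<open>The span of these functions is closed under differentiation, so they are all smooth.\<close>

definition flat :: "nat \<Rightarrow> real \<Rightarrow> real" where
  "flat m t = (if t > 0 then inverse t ^ m * exp (- inverse t) else 0)"

lemma flat_derivative:
  "(flat m has_real_derivative (- real m) * flat (m+1) t + flat (m+2) t) (at t)"
proof (cases t "0::real" rule: linorder_cases)
  case less
  have "((\<lambda>t. 0) has_real_derivative 0) (at t)" by simp
  then have "(flat m has_real_derivative 0) (at t)"
    by (rule has_field_derivative_transform_within_open[of _ _ _ "{..<0}"]) (use less in \<open>auto simp: flat_def\<close>)
  then show ?thesis using less by (simp add: flat_def)
next
  case greater
  have i: "(inverse has_real_derivative - (inverse t * inverse t)) (at t)"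
    using greater by (auto intro!: derivative_eq_intros)
  have "((\<lambda>t. inverse t ^ m * exp (- inverse t)) has_real_derivative
      (- real m) * (inverse t ^ (m+1) * exp (- inverse t)) + inverse t ^ (m+2) * exp (- inverse t)) (at t)"
    by (rule DERIV_cong[OF DERIV_mult[OF DERIV_power[OF i] DERIV_fun_exp[OF DERIV_minus[OF i]]]])
      (cases m; simp add: algebra_simps)
  then have "(flat m has_real_derivative
      (- real m) * (inverse t ^ (m+1) * exp (- inverse t)) + inverse t ^ (m+2) * exp (- inverse t)) (at t)"
    by (rule has_field_derivative_transform_within_open[of _ _ _ "{0<..}"]) (use greater in \<open>auto simp: flat_def\<close>)
  then show ?thesis using greater by (simp add: flat_def)
next
  case equal
  \<comment> \<open>Under h = 1/s the quotient becomes s^(m+1) exp(-s), which tends to 0 at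
    infinity.\<close>
  have "((\<lambda>h. flat m h / h) \<longlongrightarrow> 0) (at_right 0)"
  proof -
    have "((\<lambda>s::real. s ^ Suc m / exp s) \<longlongrightarrow> 0) at_top" by (rule tendsto_power_div_exp_0)
    then have "((\<lambda>h::real. (inverse h) ^ Suc m / exp (inverse h)) \<longlongrightarrow> 0) (at_right 0)"
      by (rule filterlim_compose[OF _ filterlim_inverse_at_top_right])
    then show ?thesis
    proof (rule Lim_transform_eventually)
      show "eventually (\<lambda>h. (inverse h) ^ Suc m / exp (inverse h) = flat m h / h) (at_right (0::real))"
        unfolding eventually_at_right_field
        by (intro exI[of _ 1]) (auto simp: flat_def exp_minus field_simps)
    qed
  qed
  moreover have "((\<lambda>h. flat m h / h) \<longlongrightarrow> 0) (at_left 0)"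
  proof -
    have "eventually (\<lambda>h::real. h < 0) (at_left 0)" by (auto simp: eventually_at_filter)
    then have "eventually (\<lambda>h::real. 0 = flat m h / h) (at_left 0)"
      by eventually_elim (auto simp: flat_def)
    then show ?thesis by (rule Lim_transform_eventually[OF tendsto_const])
  qed
  ultimately have "((\<lambda>h. flat m h / h) \<longlongrightarrow> 0) (at 0)" by (simp add: filterlim_split_at)
  then show ?thesis using equal by (simp add: DERIV_def flat_def)
qed

lemma C_k_on_flat: "C_k_on k UNIV (flat m)"
proof (induction k arbitrary: m)
  case 0
  have "continuous_on UNIV (flat m)"
    using flat_derivative DERIV_isCont continuous_at_imp_continuous_on by blast
  then show ?case by simp
next
  case (Suc k)
  show ?case
    by (rule C_k_on_realI[OF open_UNIV flat_derivative]) (intro C_k_on_add C_k_on_cmult Suc.IH open_UNIV)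
qed

lemma flat_nonneg: "0 \<le> flat m t" and flat_pos: "0 < t \<Longrightarrow> 0 < flat m t" and flat_zero: "t \<le> 0 \<Longrightarrow> flat m t = 0"
  by (auto simp: flat_def)

text \<open>For t < 0 the interval is empty and the integral is 0; since \<open>B\<close> vanishes
  up to a positive \<open>a\<close>, this is the correct antiderivative on the whole line.\<close>

lemma antiderivative_from_zero:
  fixes B :: "real \<Rightarrow> real"
  assumes cont: "continuous_on UNIV B" and z: "\<And>t. t \<le> a \<Longrightarrow> B t = 0" and a: "a > 0"
  shows "((\<lambda>t. integral {0..t} B) has_real_derivative B t) (at t)"
proof (cases "t > 0")
  case True
  have "((\<lambda>t. integral {0..t} B) has_real_derivative B t) (at t within {0..t+1})"
    using True by (intro integral_has_real_derivative continuous_on_subset[OF cont]) auto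
  moreover have "at t within {0..t+1} = at t" using True by (intro at_within_interior) auto
  ultimately show ?thesis by simp
next
  case False
  have "((\<lambda>t. 0) has_real_derivative 0) (at t)" by simp
  then have "((\<lambda>t. integral {0..t} B) has_real_derivative 0) (at t)"
  proof (rule has_field_derivative_transform_within_open[of _ _ _ "{..<a}"])
    fix x assume x: "x \<in> {..<a}"
    have "integral {0..x} B = integral {0..x} (\<lambda>t. 0)"
      using z x by (intro integral_cong) auto
    then show "0 = integral {0..x} B" by simp
  qed (use False a in auto)
  then show ?thesis using z[of t] False a by simp
qed

section \<open>Integration by parts and the equation in the sense of distributions\<close>

lemma lborel_integral_translate:
  fixes f :: "'a::euclidean_space \<Rightarrow> real"
  assumes [measurable]: "f \<in> borel_measurable borel"
  shows "(LINT x|lborel. f (x + c)) = (LINT x|lborel. f x)"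
proof -
  have "(LINT x|lborel. f x) = (LINT x|distr lborel borel ((+) c). f x)" by (simp add: lborel_distr_plus)
  also have "\<dots> = (LINT x|lborel. f (c + x))" by (rule integral_distr) auto
  finally show ?thesis by (simp add: add.commute)
qed

lemma integrable_compact_support:
  fixes f :: "'a::euclidean_space \<Rightarrow> real"
  assumes "continuous_on UNIV f" "\<And>x. x \<notin> cball p r \<Longrightarrow> f x = 0"
  shows "integrable lborel f"
proof -
  have "integrable lborel (\<lambda>x. indicator (cball p r) x *\<^sub>R f x)"
    by (rule borel_integrable_compact) (auto intro: continuous_on_subset[OF assms(1)])
  moreover have "(\<lambda>x. indicator (cball p r) x *\<^sub>R f x) = f"
  proof
    show "indicator (cball p r) x *\<^sub>R f x = f x" for x
      using assms(2)[of x] by (cases "x \<in> cball p r") auto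
  qed
  ultimately show ?thesis by simp
qed

lemma integral_positive:
  fixes f :: "'a::euclidean_space \<Rightarrow> real"
  assumes cont: "continuous_on UNIV f" and "integrable lborel f" "\<And>x. 0 \<le> f x" "0 < f x0"
  shows "0 < (LINT x|lborel. f x)"
proof (rule ccontr)
  assume "\<not> 0 < (LINT x|lborel. f x)"
  moreover have "0 \<le> (LINT x|lborel. f x)" using assms(3) by simp
  ultimately have "(LINT x|lborel. f x) = 0" by simp
  then have "AE x in lborel. f x = 0"
    using integral_nonneg_eq_0_iff_AE[OF assms(2)] assms(3) by auto
  then have "AE x in lborel. x \<notin> {x. f x \<noteq> 0}" by auto
  moreover have o: "open {x. f x \<noteq> 0}"
  proof -
    have "{x. f x \<noteq> 0} = f -` (- {0})" by auto
    then show ?thesis using cont open_Compl[OF closed_singleton[of "0::real"]]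
      by (metis continuous_on_open_vimage open_UNIV Int_UNIV_right)
  qed
  ultimately have "{x. f x \<noteq> 0} \<in> null_sets lborel"
    by (subst (asm) AE_iff_null_sets[symmetric]) auto
  then have "negligible {x. f x \<noteq> 0}" by (simp add: negligible_iff_null_sets null_sets_completionI)
  then show False using open_not_negligible[OF o] assms(4) by force
qed

lemma partial_line:
  assumes "C_k_on 1 UNIV f" "b \<in> Basis"
  shows "((\<lambda>t. f (x + t *\<^sub>R b)) has_real_derivative partial b f (x + t *\<^sub>R b)) (at t)"
proof -
  have f: "(f has_derivative frechet_derivative f (at (x + t *\<^sub>R b))) (at (x + t *\<^sub>R b))"
    by (rule C_k_on_frechet[of 0 UNIV]) (use assms in auto)
  have g: "((\<lambda>t. x + t *\<^sub>R b) has_derivative (\<lambda>s. s *\<^sub>R b)) (at t)"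
    by (auto intro!: derivative_eq_intros)
  have "linear (frechet_derivative f (at (x + t *\<^sub>R b)))" using has_derivative_linear[OF f] .
  then have "frechet_derivative f (at (x + t *\<^sub>R b)) (s *\<^sub>R b) = partial b f (x + t *\<^sub>R b) * s" for s
    by (simp add: linear_cmul partial_def)
  with has_derivative_compose[OF g f] show ?thesis by (simp add: has_field_derivative_def)
qed

text \<open>By translation invariance the integrals of the difference quotients vanish.\<close>

lemma integral_partial_zero:
  fixes f :: "'a::euclidean_space \<Rightarrow> real"
  assumes C1: "C_k_on 1 UNIV f" and supp: "\<And>x. x \<notin> cball p r \<Longrightarrow> f x = 0" and b: "b \<in> Basis"
  shows "(LINT x|lborel. partial b f x) = 0" "integrable lborel (partial b f)"
    "x \<notin> cball p r \<Longrightarrow> partial b f x = 0"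
proof -
  have cg: "continuous_on UNIV (partial b f)" using C1 b by auto
  have "C_k_on 0 UNIV f" using C_k_on_lower[OF C1] by blast
  then have cf: "continuous_on UNIV f" by simp
  have z: "partial b f x = 0" if "x \<notin> cball p r" for x
  proof -
    have "partial b f x = partial b (\<lambda>x. 0) x"
      by (rule partial_cong(1)[of "- cball p r"]) (use that supp in auto)
    then show ?thesis using partial_eq[OF has_derivative_const] by simp
  qed
  then show "x \<notin> cball p r \<Longrightarrow> partial b f x = 0" .
  show "integrable lborel (partial b f)" by (rule integrable_compact_support[OF cg z])
  have "compact (partial b f ` cball p r)"
    by (intro compact_continuous_image continuous_on_subset[OF cg]) auto
  then obtain M0 where M0: "\<And>x. x \<in> cball p r \<Longrightarrow> \<bar>partial b f x\<bar> \<le> M0"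
    using compact_imp_bounded bounded_iff by (metis imageI real_norm_def)
  define M where "M = max M0 0"
  have M: "\<bar>partial b f x\<bar> \<le> M" "M \<ge> 0" for x
    using M0[of x] z[of x] by (cases "x \<in> cball p r"; force simp: M_def)+
  define h where "h = (\<lambda>k. inverse (real (Suc k)))"
  have h: "h k > 0" "h k \<le> 1" for k by (auto simp: h_def field_simps)
  define Q where "Q = (\<lambda>k x. (f (x + h k *\<^sub>R b) - f x) / h k)"
  have nb: "norm b = 1" using b by simp
  have [measurable]: "f \<in> borel_measurable borel" using cf by (rule borel_measurable_continuous_onI)
  have int_f: "integrable lborel f" by (rule integrable_compact_support[OF cf supp])
  have int0: "(LINT x|lborel. Q k x) = 0" for k
  proof -
    have "integrable lborel (\<lambda>x. f (x + h k *\<^sub>R b))"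
    proof (rule integrable_compact_support[of _ p "r + 1"])
      show "continuous_on UNIV (\<lambda>x. f (x + h k *\<^sub>R b))"
        by (rule continuous_on_compose2[OF cf]) (auto intro!: continuous_intros)
      fix x assume x: "x \<notin> cball p (r + 1)"
      have "dist p x \<le> dist p (x + h k *\<^sub>R b) + dist (x + h k *\<^sub>R b) x" by (rule dist_triangle)
      also have "dist (x + h k *\<^sub>R b) x = h k" using nb h[of k] by (simp add: dist_norm)
      finally show "f (x + h k *\<^sub>R b) = 0" using x h[of k] by (intro supp) auto
    qed
    then show ?thesis unfolding Q_def using int_f lborel_integral_translate[of f "h k *\<^sub>R b"] by simp
  qed
  have "(\<lambda>k. LINT x|lborel. Q k x) \<longlonglongrightarrow> (LINT x|lborel. partial b f x)"
  proof (rule integral_dominated_convergence)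
    show "partial b f \<in> borel_measurable lborel" using borel_measurable_continuous_onI[OF cg] by simp
    show "\<And>k. Q k \<in> borel_measurable lborel" unfolding Q_def by measurable
    \<comment> \<open>All steps \<open>h k\<close> are at most 1, so every difference quotient
      vanishes outside the ball of radius \<open>r + 1\<close>, and the mean value theorem bounds it
      by \<open>M\<close>.\<close>
    show "integrable lborel (\<lambda>x. indicator (cball p (r + 1)) x *\<^sub>R M)"
      by (rule borel_integrable_compact) auto
    have "(\<lambda>k. Q k x) \<longlonglongrightarrow> partial b f x" for x
    proof -
      have "((\<lambda>s. (f (x + s *\<^sub>R b) - f x) / s) \<longlongrightarrow> partial b f x) (at 0)"
        using partial_line[OF C1 b, of x 0] by (simp add: DERIV_def)
      moreover have "filterlim h (at 0) sequentially"
        unfolding filterlim_at using h LIMSEQ_inverse_real_of_nat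
        by (auto simp: h_def)
      ultimately show ?thesis unfolding Q_def by (rule filterlim_compose)
    qed
    then show "AE x in lborel. (\<lambda>k. Q k x) \<longlonglongrightarrow> partial b f x" by simp
    have "norm (Q k x) \<le> indicator (cball p (r + 1)) x *\<^sub>R M" for k x
    proof (cases "x \<in> cball p (r + 1)")
      case True
      have "\<exists>z. 0 < z \<and> z < h k \<and> f (x + h k *\<^sub>R b) - f (x + 0 *\<^sub>R b) = (h k - 0) * partial b f (x + z *\<^sub>R b)"
        using h[of k] partial_line[OF C1 b] by (intro MVT2[where f = "\<lambda>t. f (x + t *\<^sub>R b)"]) auto
      then obtain z where "f (x + h k *\<^sub>R b) - f x = h k * partial b f (x + z *\<^sub>R b)" by auto
      then have "Q k x = partial b f (x + z *\<^sub>R b)" using h[of k] by (simp add: Q_def)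
      then show ?thesis using M True by simp
    next
      case False
      have "dist p x \<le> dist p (x + h k *\<^sub>R b) + dist (x + h k *\<^sub>R b) x" by (rule dist_triangle)
      also have "dist (x + h k *\<^sub>R b) x = h k" using nb h[of k] by (simp add: dist_norm)
      finally have "f (x + h k *\<^sub>R b) = 0" using False h[of k] by (intro supp) auto
      moreover have "f x = 0" using False by (intro supp) auto
      ultimately show ?thesis using False by (simp add: Q_def)
    qed
    then show "\<And>k. AE x in lborel. norm (Q k x) \<le> indicator (cball p (r + 1)) x *\<^sub>R M" by simp
  qed
  then have "(\<lambda>k. 0::real) \<longlonglongrightarrow> (LINT x|lborel. partial b f x)" unfolding int0 .
  then show "(LINT x|lborel. partial b f x) = 0" using LIMSEQ_unique tendsto_const by metis
qed

section \<open>Green's identity and harmonicity off the origin\<close>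

lemma test_functionI:
  assumes "\<And>k. C_k_on k UNIV \<phi>" "\<And>y. y \<notin> cball x r \<Longrightarrow> \<phi> y = 0" "cball x r \<subseteq> \<Omega>"
  shows "test_function \<Omega> \<phi>"
proof -
  have "{y. \<phi> y \<noteq> 0} \<subseteq> cball x r" using assms(2) by blast
  then have c: "closure {y. \<phi> y \<noteq> 0} \<subseteq> cball x r" by (simp add: closure_minimal)
  then have "compact (closure {y. \<phi> y \<noteq> 0})"
    by (meson bounded_cball bounded_subset closed_closure compact_eq_bounded_closed)
  moreover have "smooth_on UNIV \<phi>" unfolding smooth_on_def using assms(1) by blast
  ultimately show ?thesis unfolding test_function_def using c assms(3) by blast
qed

lemma laplacian_zero_outside:
  assumes "\<And>y. y \<notin> cball x r \<Longrightarrow> \<phi> y = 0" "y \<notin> cball x r"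
  shows "laplacian \<phi> y = 0"
proof -
  have z: "partial b \<psi> y = 0" if "\<And>y. y \<notin> cball x r \<Longrightarrow> \<psi> y = 0" "y \<notin> cball x r" for b and \<psi> :: "'a \<Rightarrow> real" and y
  proof -
    have "partial b \<psi> y = partial b (\<lambda>x. 0) y"
      by (rule partial_cong(1)[of "- cball x r"]) (use that in auto)
    then show ?thesis using partial_eq[OF has_derivative_const] by simp
  qed
  then show ?thesis unfolding laplacian_def using assms by (intro sum.neutral ballI z) auto
qed

lemma continuous_on_laplacian:
  assumes "C_k_on 2 U f"
  shows "continuous_on U (laplacian f)"
  unfolding laplacian_def[abs_def] using assms by (intro continuous_on_sum) (auto simp: numeral_2_eq_2)

text \<open>\<open>G\<close> is controlled only in the larger ball. The components
  \<open>V b\<close> are nevertheless continuously differentiable everywhere, because \<phi>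
  vanishes outside the smaller ball. Their divergence is the difference of the two integrands and
  integrates to zero.\<close>

lemma greens_identity:
  fixes G \<phi> :: "'a::euclidean_space \<Rightarrow> real"
  assumes G: "C_k_on 2 (ball x R') G" and \<phi>: "C_k_on 2 UNIV \<phi>"
    and supp: "\<And>y. y \<notin> cball x R \<Longrightarrow> \<phi> y = 0" and R: "R < R'"
  shows "(LINT y|lborel. G y * laplacian \<phi> y) = (LINT y|lborel. \<phi> y * laplacian G y)"
    "integrable lborel (\<lambda>y. \<phi> y * laplacian G y)" "continuous_on UNIV (\<lambda>y. \<phi> y * laplacian G y)"
proof -
  have un: "UNIV = ball x R' \<union> - cball x R" using R by (auto simp: not_le)
  have oc: "open (- cball x R)" by auto
  define V where "V = (\<lambda>b y. G y * partial b \<phi> y - \<phi> y * partial b G y)"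
  have supp1: "partial b \<phi> y = 0" if "y \<notin> cball x R" for b y
  proof -
    have "partial b \<phi> y = partial b (\<lambda>x. 0) y"
      by (rule partial_cong(1)[OF oc]) (use that supp in auto)
    then show ?thesis using partial_eq[OF has_derivative_const] by simp
  qed
  have V0: "V b y = 0" if "y \<notin> cball x R" for b y using supp supp1 that by (simp add: V_def)
  have \<phi>': "C_k_on 2 (ball x R') \<phi>" using C_k_on_subset[OF \<phi>] by blast
  have C1: "C_k_on 1 (ball x R') G" "C_k_on 1 (ball x R') \<phi>"
    using C_k_on_lower[OF G, of 1] C_k_on_lower[OF \<phi>', of 1] by auto
  have C1b: "C_k_on 1 (ball x R') (partial b G)" "C_k_on 1 (ball x R') (partial b \<phi>)" if "b \<in> Basis" for b
    using G \<phi>' that by (auto simp: numeral_2_eq_2)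
  have V1: "C_k_on 1 UNIV (V b)" if b: "b \<in> Basis" for b
  proof -
    have "C_k_on 1 (ball x R') (V b)" unfolding V_def
      by (intro C_k_on_diff C_k_on_mult C1 C1b b open_ball)
    moreover have "C_k_on 1 (- cball x R) (V b)"
      using C_k_on_cong[OF oc, of "V b" "\<lambda>_. 0" 1] V0 C_k_on_const[of 1 "- cball x R" 0] by blast
    ultimately show ?thesis unfolding un by (intro C_k_on_Un) auto
  qed
  have dV: "partial b (V b) y = G y * partial b (partial b \<phi>) y - \<phi> y * partial b (partial b G) y"
    if b: "b \<in> Basis" for b y
  proof (cases "y \<in> ball x R'")
    case True
    have d: "(f has_derivative frechet_derivative f (at y)) (at y)" if "C_k_on 1 (ball x R') f" for f :: "'a \<Rightarrow> real"
      using C_k_on_frechet[of 0 _ f, OF _ True] that by simp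
    have "(V b has_derivative (\<lambda>h. (G y * frechet_derivative (partial b \<phi>) (at y) h + frechet_derivative G (at y) h * partial b \<phi> y)
        - (\<phi> y * frechet_derivative (partial b G) (at y) h + frechet_derivative \<phi> (at y) h * partial b G y))) (at y)"
      unfolding V_def by (intro has_derivative_diff has_derivative_mult d C1 C1b b)
    from partial_eq[OF this] show ?thesis by (simp add: partial_def[symmetric])
  next
    case False
    then have y: "y \<notin> cball x R" using R by auto
    have "partial b (V b) y = 0" using integral_partial_zero(3)[OF V1[OF b] V0 b y] .
    moreover have "partial b (partial b \<phi>) y = 0"
    proof -
      have "partial b (partial b \<phi>) y = partial b (\<lambda>x. 0) y"
        by (rule partial_cong(1)[OF oc]) (use y supp1 in auto)
      then show ?thesis using partial_eq[OF has_derivative_const] by simp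
    qed
    ultimately show ?thesis using supp[OF y] by simp
  qed
  have sumV: "(\<Sum>b\<in>Basis. partial b (V b) y) = G y * laplacian \<phi> y - \<phi> y * laplacian G y" for y
    unfolding laplacian_def by (simp add: dV sum_subtractf sum_distrib_left)
  have i1: "integrable lborel (\<lambda>y. G y * laplacian \<phi> y - \<phi> y * laplacian G y)"
    unfolding sumV[symmetric] by (intro Bochner_Integration.integrable_sum integral_partial_zero(2)[OF V1 V0])
  have i0: "(LINT y|lborel. G y * laplacian \<phi> y - \<phi> y * laplacian G y) = 0"
    unfolding sumV[symmetric]
    using integral_partial_zero[OF V1 V0] by (subst Bochner_Integration.integral_sum) auto
  show c: "continuous_on UNIV (\<lambda>y. \<phi> y * laplacian G y)"
    unfolding un
  proof (rule continuous_on_open_Un)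
    show "continuous_on (ball x R') (\<lambda>y. \<phi> y * laplacian G y)"
      using continuous_on_laplacian[OF G] C_k_on_lower[OF \<phi>', of 0] by (intro continuous_intros) auto
    have "continuous_on (- cball x R) (\<lambda>y. \<phi> y * laplacian G y) \<longleftrightarrow> continuous_on (- cball x R) (\<lambda>y. 0::real)"
      by (rule continuous_on_cong) (use supp in auto)
    then show "continuous_on (- cball x R) (\<lambda>y. \<phi> y * laplacian G y)" by simp
  qed auto
  show i2: "integrable lborel (\<lambda>y. \<phi> y * laplacian G y)"
    by (rule integrable_compact_support[OF c, of x R]) (use supp in simp)
  show "(LINT y|lborel. G y * laplacian \<phi> y) = (LINT y|lborel. \<phi> y * laplacian G y)"
    using Bochner_Integration.integral_add[OF i1 i2] i0 by simp
qed

text \<open>A nonzero Laplacian would keep its sign in a small ball missing the origin. For a bump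
  in that ball the Dirac term is zero, while moving the Laplacian onto \<open>G\<close> leaves a
  nonzero integral.\<close>

lemma distribution_harmonic:
  fixes u G :: "'a::euclidean_space \<Rightarrow> real"
  assumes eq: "neg_laplacian_eq_dirac \<Omega> u m" and "open \<Omega>" and U: "open U" "\<Omega> - {0} \<subseteq> U"
    and G: "\<And>k. C_k_on k U G" and uG: "\<And>x. x \<in> \<Omega> - {0} \<Longrightarrow> u x = G x" and x: "x \<in> \<Omega> - {0}"
  shows "laplacian G x = 0"
proof -
  \<comment> \<open>Used with \<sigma> = 1 and \<sigma> = -1, to treat both signs at once.\<close>
  have False if \<sigma>: "\<sigma> * laplacian G x > 0" for \<sigma> :: real
  proof -
    have "open (\<Omega> - {0})" using assms(2) by auto
    then obtain r1 where r1: "r1 > 0" "ball x r1 \<subseteq> \<Omega> - {0}" using x open_contains_ball by blast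
    have "isCont (\<lambda>y. \<sigma> * laplacian G y) x"
      using continuous_on_laplacian[OF G] U x continuous_on_eq_continuous_at[OF U(1)]
      by (intro continuous_intros) auto
    then obtain r2 where r2: "r2 > 0"
      "\<And>y. dist y x < r2 \<Longrightarrow> dist (\<sigma> * laplacian G y) (\<sigma> * laplacian G x) < \<sigma> * laplacian G x"
      unfolding continuous_at_eps_delta using \<sigma> by blast
    define R' where "R' = min r1 r2"
    define R where "R = R' / 2"
    have R: "0 < R" "R < R'" using r1 r2 by (auto simp: R_def R'_def)
    have bR': "ball x R' \<subseteq> \<Omega> - {0}" by (rule order_trans[OF _ r1(2)]) (auto simp: R'_def)
    have pos: "0 < \<sigma> * laplacian G y" if "y \<in> ball x R'" for y
    proof -
      have "dist y x < r2" using that by (simp add: R'_def dist_commute)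
      from r2(2)[OF this] show ?thesis unfolding dist_real_def by linarith
    qed
    define \<phi> where "\<phi> = (\<lambda>y::'a. flat 0 (R\<^sup>2 - (y - x) \<bullet> (y - x)))"
    have sq: "(y - x) \<bullet> (y - x) = (dist x y)\<^sup>2" for y
      by (simp add: dot_square_norm dist_norm norm_minus_commute)
    have C\<phi>: "C_k_on k UNIV \<phi>" for k unfolding \<phi>_def
      by (rule C_k_on_compose[where V = UNIV]) (auto intro!: C_k_on_flat C_k_on_diff C_k_on_const C_k_on_norm_sq)
    have supp: "\<phi> y = 0" if "y \<notin> cball x R" for y
    proof -
      have "R\<^sup>2 \<le> (dist x y)\<^sup>2" using that R by (intro power_mono) auto
      then show ?thesis unfolding \<phi>_def sq by (intro flat_zero) simp
    qed
    have cR: "cball x R \<subseteq> \<Omega> - {0}" using R bR' by force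
    have GR': "C_k_on 2 (ball x R') G" using C_k_on_subset[OF G] bR' U(2) by blast
    have green: "(LINT y|lborel. G y * laplacian \<phi> y) = (LINT y|lborel. \<phi> y * laplacian G y)"
      "integrable lborel (\<lambda>y. \<phi> y * laplacian G y)" "continuous_on UNIV (\<lambda>y. \<phi> y * laplacian G y)"
      using greens_identity[OF GR' C\<phi>, of R] supp R(2) by blast+
    have "test_function \<Omega> \<phi>" by (rule test_functionI[OF C\<phi> supp]) (use cR in auto)
    then have "- (LINT y:\<Omega>|lborel. u y * laplacian \<phi> y) = m * \<phi> 0"
      using eq unfolding neg_laplacian_eq_dirac_def by blast
    moreover have "\<phi> 0 = 0" using cR by (intro supp) blast
    moreover have "(LINT y:\<Omega>|lborel. u y * laplacian \<phi> y) = (LINT y|lborel. G y * laplacian \<phi> y)"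
      unfolding set_lebesgue_integral_def
    proof (rule Bochner_Integration.integral_cong[OF refl])
      fix y
      show "indicator \<Omega> y *\<^sub>R (u y * laplacian \<phi> y) = G y * laplacian \<phi> y"
      proof (cases "y \<in> cball x R")
        case True
        then have "y \<in> \<Omega> - {0}" using cR by blast
        then show ?thesis using uG[of y] by simp
      next
        case False
        then have "laplacian \<phi> y = 0" using laplacian_zero_outside[of x R \<phi> y] supp by blast
        then show ?thesis by simp
      qed
    qed
    ultimately have zero: "(LINT y|lborel. \<phi> y * laplacian G y) = 0" using green(1) by simp
    have "0 < (LINT y|lborel. \<sigma> * (\<phi> y * laplacian G y))"
    proof (rule integral_positive[of _ x])
      show "continuous_on UNIV (\<lambda>y. \<sigma> * (\<phi> y * laplacian G y))"
        by (rule continuous_on_mult_left[OF green(3)])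
      show "integrable lborel (\<lambda>y. \<sigma> * (\<phi> y * laplacian G y))" using green(2) by simp
      have "0 < \<phi> x" unfolding \<phi>_def using R by (intro flat_pos) simp
      then have "0 < \<phi> x * (\<sigma> * laplacian G x)" using \<sigma> by simp
      then show "0 < \<sigma> * (\<phi> x * laplacian G x)" by (simp add: mult.left_commute)
      show "0 \<le> \<sigma> * (\<phi> y * laplacian G y)" for y
      proof (cases "y \<in> ball x R'")
        case True
        have "0 \<le> \<phi> y" by (simp add: \<phi>_def flat_nonneg)
        then have "0 \<le> \<phi> y * (\<sigma> * laplacian G y)" using pos[OF True] by simp
        then show ?thesis by (simp add: mult.left_commute)
      next
        case False
        then have "y \<notin> cball x R" using R by auto
        then show ?thesis using supp by simp
      qed
    qed
    then show False using zero by simp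
  qed
  from this[of 1] this[of "-1"] show ?thesis
    by (cases "laplacian G x" "0::real" rule: linorder_cases) auto
qed

section \<open>Shell averages and the lower bound at the pole\<close>

text \<open>Vanishing below 1/2, and not only beyond 1, keeps the kernels clear of the singularity
  of powers of t at 0.\<close>

definition bump :: "real \<Rightarrow> real" where
  "bump t = flat 0 (t - 1/2) * flat 0 (1 - t)"

definition smooth_step :: "real \<Rightarrow> real" where
  "smooth_step t = integral {0..t} bump"

lemma C_k_on_bump: "C_k_on k UNIV bump"
  unfolding bump_def[abs_def]
proof (intro C_k_on_mult open_UNIV)
  have i: "C_k_on k UNIV (\<lambda>t::real. t)" using C_k_on_inner[of k UNIV 0 "1::real"] unfolding inner_real_def by simp
  show "C_k_on k UNIV (\<lambda>t. flat 0 (t - 1/2))"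
    by (rule C_k_on_compose[where V = UNIV]) (auto intro!: C_k_on_flat C_k_on_diff C_k_on_const i)
  show "C_k_on k UNIV (\<lambda>t. flat 0 (1 - t))"
    by (rule C_k_on_compose[where V = UNIV]) (auto intro!: C_k_on_flat C_k_on_diff C_k_on_const i)
qed

lemma continuous_bump: "continuous_on UNIV bump"
  using C_k_on_bump[of 0] by simp

lemma bump_nonneg: "0 \<le> bump t" and bump_zero: "t \<le> 1/2 \<or> 1 \<le> t \<Longrightarrow> bump t = 0"
  and bump_pos: "0 < bump (3/4)"
  by (auto simp: bump_def flat_nonneg flat_zero intro!: mult_pos_pos flat_pos)

lemma smooth_step_derivative: "(smooth_step has_real_derivative bump t) (at t)"
  unfolding smooth_step_def[abs_def]
  by (rule antiderivative_from_zero[OF continuous_bump, of "1/2"]) (auto intro: bump_zero)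

lemma C_k_on_smooth_step: "C_k_on k UNIV smooth_step"
proof -
  have "C_k_on (Suc k) UNIV smooth_step"
    by (rule C_k_on_realI[OF open_UNIV smooth_step_derivative C_k_on_bump])
  then show ?thesis by (rule C_k_on_Suc_lower)
qed

lemma smooth_step_mono: "s \<le> t \<Longrightarrow> smooth_step s \<le> smooth_step t"
  by (rule DERIV_nonneg_imp_nondecreasing) (use smooth_step_derivative bump_nonneg in blast)+

lemma smooth_step_zero: "t \<le> 1/2 \<Longrightarrow> smooth_step t = 0"
proof -
  assume "t \<le> 1/2"
  then have "smooth_step t = integral {0..t} (\<lambda>t. 0)" unfolding smooth_step_def
    by (intro integral_cong) (auto intro: bump_zero)
  then show ?thesis by simp
qed

lemma smooth_step_const: "1 \<le> t \<Longrightarrow> smooth_step t = smooth_step 1"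
proof (rule antisym)
  assume t: "1 \<le> t"
  then show "smooth_step 1 \<le> smooth_step t" by (rule smooth_step_mono)
  show "smooth_step t \<le> smooth_step 1"
    by (rule DERIV_nonpos_imp_nonincreasing[OF t]) (use smooth_step_derivative bump_zero in fastforce)
qed

text \<open>
  As a function of \<open>|x|\<^sup>2\<close>, \<open>shell_kernel n s\<close> is a mollifier supported in the ball of radius \<open>s\<close>.
  The differences of two such mollifiers are Laplacians of test functions, which are nonnegative
  because the larger mollifier is obtained from the smaller one by sweeping mass outwards.
\<close>

definition shell_kernel :: "real \<Rightarrow> real \<Rightarrow> real \<Rightarrow> real" where
  "shell_kernel n s t = 4 * (t powr (1 - n/2) * (bump (t / s\<^sup>2) / s\<^sup>2))"

lemma continuous_shell_kernel:
  assumes "s > 0"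
  shows "continuous_on UNIV (shell_kernel n s)"
proof -
  have un: "UNIV = {0<..} \<union> {..<s\<^sup>2/2}" 
  proof -
    have "0 < s\<^sup>2" using assms by simp
    then have "t \<in> {0<..} \<union> {..<s\<^sup>2/2}" for t
      unfolding Un_iff greaterThan_iff lessThan_iff by linarith
    then show ?thesis by blast
  qed
  have c: "continuous_on S (\<lambda>t. bump (t / s\<^sup>2))" for S
    by (rule continuous_on_compose2[OF continuous_bump]) (use assms in \<open>auto intro!: continuous_intros\<close>)
  show ?thesis
    unfolding un
  proof (rule continuous_on_open_Un)
    show "continuous_on {0<..} (shell_kernel n s)" unfolding shell_kernel_def
      by (intro continuous_intros c) (use assms in auto)
    \<comment> \<open>The bump factor vanishes here, which covers t \<le> 0, where
      \<open>powr\<close> takes only conventional values.\<close>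
    have "shell_kernel n s t = 0" if "t < s\<^sup>2/2" for t
      using that assms by (simp add: shell_kernel_def bump_zero field_simps)
    then have "continuous_on {..<s\<^sup>2/2} (shell_kernel n s) \<longleftrightarrow> continuous_on {..<s\<^sup>2/2} (\<lambda>t. 0::real)"
      by (intro continuous_on_cong) auto
    then show "continuous_on {..<s\<^sup>2/2} (shell_kernel n s)" by simp
  qed auto
qed

lemma shell_kernel_nonneg: "0 \<le> shell_kernel n s t"
  by (simp add: shell_kernel_def bump_nonneg)

lemma shell_kernel_zero: "s > 0 \<Longrightarrow> s\<^sup>2 \<le> t \<Longrightarrow> shell_kernel n s t = 0"
  by (simp add: shell_kernel_def bump_zero)

lemma shell_kernel_pos: "s > 0 \<Longrightarrow> 0 < shell_kernel n s ((3/4) * s\<^sup>2)"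
  using bump_pos by (simp add: shell_kernel_def)

text \<open>The radial Laplacian is 4 t^(1-n/2) (t^(n/2) P')', which explains the weight in
  \<open>shell_kernel\<close>: it cancels the volume density. Integrating once gives P' = - t^(-n/2)
  q with \<open>q\<close> a difference of two steps. It is nonnegative because s \<le> R, so
  \<open>P\<close> decreases to 0 and is nonnegative.\<close>

lemma shell_kernel_potential:
  assumes s: "0 < s" "s \<le> R"
  shows "\<exists>P P' P''. (\<forall>k. C_k_on k UNIV P) \<and> (\<forall>t. 0 \<le> P t) \<and> (\<forall>t\<ge>R\<^sup>2. P t = 0) \<and>
     (\<forall>t. (P has_real_derivative P' t) (at t)) \<and> (\<forall>t. (P' has_real_derivative P'' t) (at t)) \<and>
     (\<forall>t\<ge>0. 2 * n * P' t + 4 * t * P'' t = shell_kernel n R t - shell_kernel n s t)"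
proof -
  have R: "R > 0" using s by simp
  define q where "q = (\<lambda>t. smooth_step (t / s\<^sup>2) - smooth_step (t / R\<^sup>2))"
  define q' where "q' = (\<lambda>t. bump (t / s\<^sup>2) / s\<^sup>2 - bump (t / R\<^sup>2) / R\<^sup>2)"
  have ds: "((\<lambda>t. smooth_step (t / a)) has_real_derivative bump (t / a) / a) (at t)" if "a > 0" for a t
  proof -
    have "((\<lambda>t. t / a) has_real_derivative 1 / a) (at t)" by (rule DERIV_cdivide[OF DERIV_ident])
    from DERIV_chain2[OF smooth_step_derivative this] show ?thesis by simp
  qed
  have dq: "(q has_real_derivative q' t) (at t)" for t
    unfolding q_def q'_def using s R by (intro DERIV_diff ds) auto
  have sR: "s\<^sup>2 \<le> R\<^sup>2" "0 < s\<^sup>2" "0 < R\<^sup>2" using s R by (auto intro: power_mono)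
  have half: "t / s\<^sup>2 \<le> 1/2 \<and> t / R\<^sup>2 \<le> 1/2" if "t \<le> s\<^sup>2/2" for t
    using that sR by (simp add: divide_le_eq)
  have q0: "q t = 0" "q' t = 0" if "t \<le> s\<^sup>2/2" for t
    using half[OF that] by (simp_all add: q_def q'_def smooth_step_zero bump_zero)
  have q1: "q t = 0" if "t \<ge> R\<^sup>2" for t
  proof -
    have "1 \<le> t / s\<^sup>2" "1 \<le> t / R\<^sup>2" using that sR by (simp_all add: le_divide_eq)
    from smooth_step_const[OF this(1)] smooth_step_const[OF this(2)] show ?thesis unfolding q_def by linarith
  qed
  have qnn: "0 \<le> q t" for t
  proof (cases "t \<ge> 0")
    case True
    then have "t / R\<^sup>2 \<le> t / s\<^sup>2" using sR by (intro divide_left_mono) auto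
    then show ?thesis using smooth_step_mono by (simp add: q_def)
  next
    case False
    then have "t \<le> s\<^sup>2/2" using sR by linarith
    then show ?thesis using q0 by simp
  qed
  define p where "p = (\<lambda>t. t powr (- n/2) * q t)"
  define p' where "p' = (\<lambda>t. (- n/2) * t powr (- n/2 - 1) * q t + t powr (- n/2) * q' t)"
  have dp: "(p has_real_derivative p' t) (at t)" for t
  proof (cases "t > 0")
    case True
    then show ?thesis unfolding p_def p'_def
      by (auto intro!: derivative_eq_intros dq)
  next
    case False
    then have ts: "t < s\<^sup>2/2" using sR by linarith
    have "((\<lambda>t. 0) has_real_derivative 0) (at t)" by simp
    then have "(p has_real_derivative 0) (at t)"
      by (rule has_field_derivative_transform_within_open[of _ _ _ "{..<s\<^sup>2/2}"])
        (use ts q0 in \<open>auto simp: p_def\<close>)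
    moreover have "p' t = 0" using ts q0[of t] by (simp add: p'_def)
    ultimately show ?thesis by simp
  qed
  have Cp: "C_k_on k UNIV p" for k
  proof -
    have un: "UNIV = {0<..} \<union> {..<s\<^sup>2/2}"
    proof -
      have "t \<in> {0<..} \<union> {..<s\<^sup>2/2}" for t
        unfolding Un_iff greaterThan_iff lessThan_iff using sR(2) by linarith
      then show ?thesis by blast
    qed
    have lin: "C_k_on k UNIV (\<lambda>t::real. t / a)" for a
      using C_k_on_cmult[OF open_UNIV C_k_on_inner[of k UNIV 0 "1::real"], of "1/a"] unfolding inner_real_def by simp
    have "C_k_on k UNIV (\<lambda>t. smooth_step (t / a))" for a
      by (rule C_k_on_compose[where H = smooth_step and V = UNIV, OF open_UNIV UNIV_I C_k_on_smooth_step lin])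
    then have "C_k_on k UNIV q" unfolding q_def by (intro C_k_on_diff open_UNIV)
    then have "C_k_on k {0<..} q" by (rule C_k_on_subset) simp
    then have 1: "C_k_on k {0<..} p" unfolding p_def by (intro C_k_on_mult C_k_on_powr) auto
    have "C_k_on k {..<s\<^sup>2/2} p"
      by (subst C_k_on_cong[of _ _ "\<lambda>_. 0"]) (use q0 C_k_on_const in \<open>auto simp: p_def\<close>)
    with 1 show ?thesis unfolding un by (intro C_k_on_Un) auto
  qed
  have pnn: "0 \<le> p t" for t using qnn by (simp add: p_def)
  \<comment> \<open>The constant makes \<open>P\<close> vanish at \<open>R\<^sup>2\<close>; beyond
    it \<open>q = 0\<close>, so \<open>P\<close> stays zero.\<close>
  define P where "P = (\<lambda>t. integral {0..R\<^sup>2} p - integral {0..t} p)"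
  have cp: "continuous_on UNIV p" using Cp[of 0] by simp
  have dP: "(P has_real_derivative - p t) (at t)" for t
  proof -
    have "((\<lambda>t. integral {0..t} p) has_real_derivative p t) (at t)"
      by (rule antiderivative_from_zero[OF cp, of "s\<^sup>2/2"]) (use q0 sR in \<open>auto simp: p_def\<close>)
    then show ?thesis unfolding P_def by (auto intro!: derivative_eq_intros)
  qed
  have CP: "C_k_on k UNIV P" for k
  proof -
    have "C_k_on k UNIV (\<lambda>t. (-1) * p t)" by (rule C_k_on_cmult[OF open_UNIV Cp])
    then have "C_k_on (Suc k) UNIV P" by (intro C_k_on_realI[OF open_UNIV dP]) simp
    then show ?thesis by (rule C_k_on_Suc_lower)
  qed
  have mono: "P b \<le> P a" if "a \<le> b" for a b
    by (rule DERIV_nonpos_imp_nonincreasing[OF that]) (use dP pnn in force)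
  have PR: "P (R\<^sup>2) = 0" by (simp add: P_def)
  have P0: "P t = 0" if "t \<ge> R\<^sup>2" for t
  proof -
    have "P (R\<^sup>2) \<le> P t"
    proof (rule DERIV_nonneg_imp_nondecreasing[OF that])
      fix x assume "R\<^sup>2 \<le> x"
      then have "p x = 0" using q1 by (simp add: p_def)
      then show "\<exists>y. (P has_real_derivative y) (at x) \<and> 0 \<le> y" using dP[of x] by auto
    qed
    then show ?thesis using mono[OF that] PR by simp
  qed
  have Pnn: "0 \<le> P t" for t using mono[of t "R\<^sup>2"] P0[of t] PR by (cases "t \<le> R\<^sup>2") auto
  have dP': "((\<lambda>t. - p t) has_real_derivative - p' t) (at t)" for t
    using dp by (auto intro!: derivative_eq_intros)
  have "2 * n * (- p t) + 4 * t * (- p' t) = shell_kernel n R t - shell_kernel n s t" if "t \<ge> 0" for t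
  proof (cases "t = 0")
    case True
    then show ?thesis using q0[of 0] sR by (simp add: p_def shell_kernel_def)
  next
    case False
    then have t: "t > 0" using that by simp
    have e1: "t * t powr (- n/2 - 1) = t powr (- n/2)" using t by (simp add: powr_diff)
    have e2: "t * t powr (- n/2) = t powr (1 - n/2)"
      using t powr_add[of t 1 "- n/2"] by simp
    have "4 * t * (- p' t) = 2 * n * (t * t powr (- n/2 - 1)) * q t - 4 * (t * t powr (- n/2)) * q' t"
      by (simp add: p'_def algebra_simps)
    also have "\<dots> = 2 * n * p t - 4 * t powr (1 - n/2) * q' t" unfolding e1 e2 by (simp add: p_def)
    finally show ?thesis by (simp add: shell_kernel_def q'_def algebra_simps)
  qed
  note kernels = this
  show ?thesis
    by (intro exI[of _ P] exI[of _ "\<lambda>t. - p t"] exI[of _ "\<lambda>t. - p' t"] conjI allI impI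
        CP Pnn P0 dP dP' kernels)
qed

text \<open>A super-mean-value property: testing with the potential centered at \<open>x\<close>
  shows that the average of \<open>u\<close> against the large kernel is at most the one against the
  small kernel. The former is bounded below uniformly in \<open>x\<close>, as \<open>u\<close> is
  locally integrable and the kernel bounded; the latter is at most \<open>(G x + 1) * c0\<close> for
  a small kernel, by continuity.\<close>

lemma distribution_bounded_below:
  fixes u G :: "'a::euclidean_space \<Rightarrow> real"
  assumes eq: "neg_laplacian_eq_dirac \<Omega> u m" and "0 \<le> m" and "open \<Omega>" "0 \<in> \<Omega>" and U: "open U" "\<Omega> - {0} \<subseteq> U"
    and G: "continuous_on U G" and uG: "\<And>x. x \<in> \<Omega> - {0} \<Longrightarrow> u x = G x"
  shows "\<exists>r>0. \<exists>C. \<forall>x\<in>ball 0 r - {0}. C \<le> G x"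
proof -
  let ?n = "real DIM('a)"
  obtain R0 where R0: "R0 > 0" "cball 0 R0 \<subseteq> \<Omega>" using assms(3,4) open_contains_cball by blast
  \<comment> \<open>Halved so that all balls \<open>cball x R\<close> with |x| < R lie in one
    compact subset \<open>K\<close> of \<Omega>.\<close>
  define R where "R = R0 / 2"
  have R: "R > 0" using R0 by (simp add: R_def)
  define K where "K = cball (0::'a) (2 * R)"
  have K: "K \<subseteq> \<Omega>" using R0 by (simp add: K_def R_def)
  define \<eta> where "\<eta> = (\<lambda>s x (y::'a). shell_kernel ?n s ((y - x) \<bullet> (y - x)))"
  have sq: "(y - x) \<bullet> (y - x) = (dist x y)\<^sup>2" for x y :: 'a
    by (simp add: dot_square_norm dist_norm norm_minus_commute)
  have \<eta>0: "\<eta> s x y = 0" if "s > 0" "y \<notin> cball x s" for s x y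
  proof -
    have "s\<^sup>2 \<le> (dist x y)\<^sup>2" using that by (intro power_mono) auto
    then show ?thesis unfolding \<eta>_def sq using shell_kernel_zero[OF that(1)] by simp
  qed
  have \<eta>nn: "0 \<le> \<eta> s x y" for s x y by (simp add: \<eta>_def shell_kernel_nonneg)
  have \<eta>c: "continuous_on UNIV (\<eta> s x)" if "s > 0" for s x
    unfolding \<eta>_def by (rule continuous_on_compose2[OF continuous_shell_kernel[OF that]]) (auto intro!: continuous_intros)
  have \<eta>i: "integrable lborel (\<eta> s x)" if "s > 0" for s x
    by (rule integrable_compact_support[OF \<eta>c[OF that] \<eta>0[OF that]])
  define c0 where "c0 = (LINT y|lborel. \<eta> R 0 y)"
  have c0: "c0 > 0"
  proof -
    obtain b :: 'a where b: "b \<in> Basis" using nonempty_Basis by blast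
    \<comment> \<open>The kernel is known to be positive at t = (3/4) R^2, that is, at distance
      \<open>a * R\<close> from the center.\<close>
    define a :: real where "a = sqrt (3/4)"
    define y where "y = (a * R) *\<^sub>R b"
    have "a\<^sup>2 = 3/4" unfolding a_def by (rule real_sqrt_pow2) simp
    moreover have "(y - 0) \<bullet> (y - 0) = a\<^sup>2 * R\<^sup>2" using b by (simp add: y_def power2_eq_square)
    ultimately have "(y - 0) \<bullet> (y - 0) = (3/4) * R\<^sup>2" by simp
    then have "0 < \<eta> R 0 y" unfolding \<eta>_def using shell_kernel_pos[OF R, of ?n] by metis
    then show ?thesis unfolding c0_def by (intro integral_positive[OF \<eta>c[OF R] \<eta>i[OF R] \<eta>nn])
  qed
  have c0x: "(LINT y|lborel. \<eta> R x y) = c0" for x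
  proof -
    have "(\<lambda>y. \<eta> R 0 y) \<in> borel_measurable borel" using \<eta>c[OF R] by (rule borel_measurable_continuous_onI)
    from lborel_integral_translate[OF this, of "-x"] show ?thesis by (simp add: c0_def \<eta>_def)
  qed
  have "compact (shell_kernel ?n R ` {0..R\<^sup>2})"
    by (intro compact_continuous_image continuous_on_subset[OF continuous_shell_kernel[OF R]]) auto
  then obtain M0 where M0: "\<And>t. t \<in> {0..R\<^sup>2} \<Longrightarrow> \<bar>shell_kernel ?n R t\<bar> \<le> M0"
    using compact_imp_bounded bounded_iff by (metis imageI real_norm_def)
  define M where "M = max M0 0"
  have M: "\<bar>\<eta> R x y\<bar> \<le> M" for x y
  proof (cases "y \<in> cball x R")
    case True
    then have "(dist x y)\<^sup>2 \<le> R\<^sup>2" by (intro power_mono) auto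
    then show ?thesis using M0[of "(dist x y)\<^sup>2"] by (simp add: \<eta>_def sq M_def)
  qed (use \<eta>0[OF R] in \<open>auto simp: M_def\<close>)
  have Ki: "integrable lborel (\<lambda>y. indicator K y *\<^sub>R u y)"
    using eq K unfolding neg_laplacian_eq_dirac_def locally_integrable_on_def set_integrable_def
    by (auto simp: K_def)
  define u0 where "u0 = (\<lambda>y. indicator K y *\<^sub>R u y)"
  have u0i: "integrable lborel u0" using Ki by (simp add: u0_def)
  define C where "C = M * (LINT y|lborel. \<bar>u0 y\<bar>)"
  have main: "- C / c0 - 1 \<le> G x" if x: "x \<in> ball 0 R - {0}" for x
  proof -
    have xK: "cball x R \<subseteq> K"
    proof
      fix y assume "y \<in> cball x R"
      then show "y \<in> K" using x dist_triangle[of 0 y x] unfolding K_def by auto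
    qed
    have "x \<in> K" using xK R by auto
    then have xU: "x \<in> U" using K U(2) x by auto
    have "isCont G x" using G U(1) xU continuous_on_eq_continuous_at by blast
    then obtain \<delta> where \<delta>: "\<delta> > 0" "\<And>y. dist y x < \<delta> \<Longrightarrow> dist (G y) (G x) < 1"
      unfolding continuous_at_eps_delta by (metis zero_less_one)
    obtain s1 where s1: "0 < s1" "s1 < \<delta>" "s1 < R" using field_lbound_gt_zero[OF \<delta>(1) R] by blast
    \<comment> \<open>With \<open>s < norm x\<close> the small kernel avoids the origin, so
      \<open>u\<close> may be replaced by \<open>G\<close> on its support;
      \<open>s < \<delta>\<close> makes \<open>G\<close> vary by less than 1 there.\<close>
    obtain s where s: "0 < s" "s < s1" "s < norm x" using field_lbound_gt_zero[OF s1(1), of "norm x"] x by auto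
    have sR: "s \<le> R" using s s1 by simp
    obtain P P' P'' where P: "\<And>k. C_k_on k UNIV P" "\<And>t. 0 \<le> P t" "\<And>t. t \<ge> R\<^sup>2 \<Longrightarrow> P t = 0"
      "\<And>t. (P has_real_derivative P' t) (at t)" "\<And>t. (P' has_real_derivative P'' t) (at t)"
      "\<And>t. t \<ge> 0 \<Longrightarrow> 2 * ?n * P' t + 4 * t * P'' t = shell_kernel ?n R t - shell_kernel ?n s t"
      using shell_kernel_potential[OF s(1) sR, of ?n] by blast
    define \<phi> where "\<phi> = (\<lambda>y. P ((y - x) \<bullet> (y - x)))"
    have C\<phi>: "C_k_on k UNIV \<phi>" for k unfolding \<phi>_def
      by (rule C_k_on_compose[where V = UNIV]) (auto intro!: P(1) C_k_on_norm_sq)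
    have supp: "\<phi> y = 0" if "y \<notin> cball x R" for y
    proof -
      have "R\<^sup>2 \<le> (dist x y)\<^sup>2" using that R by (intro power_mono) auto
      then show ?thesis unfolding \<phi>_def sq by (rule P(3))
    qed
    have lap: "laplacian \<phi> y = \<eta> R x y - \<eta> s x y" for y
    proof -
      note h = has_hessian_radial[of UNIV P P' x P'', OF P(4) P(5)]
      from laplacian_unique[OF open_UNIV UNIV_I h(1), of y] h(2)[of y] P(6)[of "(y - x) \<bullet> (y - x)"]
      show ?thesis by (simp add: \<phi>_def \<eta>_def)
    qed
    have "test_function \<Omega> \<phi>" by (rule test_functionI[OF C\<phi> supp]) (use xK K in auto)
    then have e1: "- (LINT y:\<Omega>|lborel. u y * laplacian \<phi> y) = m * \<phi> 0"
      using eq unfolding neg_laplacian_eq_dirac_def by blast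
    have e2: "0 \<le> m * \<phi> 0" using assms(2) P(2) by (simp add: \<phi>_def)
    have e3: "(LINT y:\<Omega>|lborel. u y * laplacian \<phi> y) = (LINT y|lborel. u0 y * \<eta> R x y - u0 y * \<eta> s x y)"
      unfolding set_lebesgue_integral_def
    proof (rule Bochner_Integration.integral_cong[OF refl])
      fix y
      show "indicator \<Omega> y *\<^sub>R (u y * laplacian \<phi> y) = u0 y * \<eta> R x y - u0 y * \<eta> s x y"
      proof (cases "y \<in> cball x R")
        case True
        then have "y \<in> K" "y \<in> \<Omega>" using xK K by auto
        then show ?thesis by (simp add: lap u0_def algebra_simps)
      next
        case False
        then have "y \<notin> cball x s" using sR by auto
        then show ?thesis using \<eta>0[OF R False] \<eta>0[OF s(1)] by (simp add: lap)
      qed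
    qed
    have iR: "integrable lborel (\<lambda>y. u0 y * \<eta> R x y)"
    proof (rule Bochner_Integration.integrable_bound)
      show "integrable lborel (\<lambda>y. M * \<bar>u0 y\<bar>)" using u0i by simp
      show "(\<lambda>y. u0 y * \<eta> R x y) \<in> borel_measurable lborel"
        using borel_measurable_integrable[OF u0i] borel_measurable_integrable[OF \<eta>i[OF R]] by measurable
      have "norm (u0 y * \<eta> R x y) \<le> norm (M * \<bar>u0 y\<bar>)" for y
        using mult_left_mono[OF M[of x y], of "\<bar>u0 y\<bar>"] by (simp add: abs_mult mult.commute M_def)
      then show "AE y in lborel. norm (u0 y * \<eta> R x y) \<le> norm (M * \<bar>u0 y\<bar>)" by simp
    qed
    have ws: "u0 y * \<eta> s x y = G y * \<eta> s x y" "G y * \<eta> s x y \<le> (G x + 1) * \<eta> s x y"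
      "\<bar>G y * \<eta> s x y\<bar> \<le> (\<bar>G x\<bar> + 1) * \<eta> s x y" for y
    proof -
      have "u0 y * \<eta> s x y = G y * \<eta> s x y \<and> G y * \<eta> s x y \<le> (G x + 1) * \<eta> s x y \<and>
        \<bar>G y * \<eta> s x y\<bar> \<le> (\<bar>G x\<bar> + 1) * \<eta> s x y"
      proof (cases "y \<in> cball x s")
        case True
        then have "y \<in> cball x R" using sR by auto
        then have "y \<in> K" using xK by blast
        moreover have "y \<noteq> 0" using True s by (auto simp: dist_commute)
        ultimately have "u0 y = G y" using K uG[of y] by (auto simp: u0_def)
        moreover have "dist (G y) (G x) < 1" using True s s1 by (intro \<delta>(2)) (auto simp: dist_commute)
        then have "G y \<le> G x + 1" "\<bar>G y\<bar> \<le> \<bar>G x\<bar> + 1" unfolding dist_real_def by linarith+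
        ultimately show ?thesis using \<eta>nn by (auto simp: abs_mult intro!: mult_right_mono)
      qed (use \<eta>0[OF s(1)] in auto)
      then show "u0 y * \<eta> s x y = G y * \<eta> s x y" "G y * \<eta> s x y \<le> (G x + 1) * \<eta> s x y"
        "\<bar>G y * \<eta> s x y\<bar> \<le> (\<bar>G x\<bar> + 1) * \<eta> s x y" by auto
    qed
    have i_s: "integrable lborel (\<lambda>y. u0 y * \<eta> s x y)"
    proof (rule Bochner_Integration.integrable_bound)
      show "integrable lborel (\<lambda>y. (\<bar>G x\<bar> + 1) * \<eta> s x y)" using \<eta>i[OF s(1)] by simp
      show "(\<lambda>y. u0 y * \<eta> s x y) \<in> borel_measurable lborel"
        using borel_measurable_integrable[OF u0i] borel_measurable_integrable[OF \<eta>i[OF s(1)]] by measurable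
      have "norm (u0 y * \<eta> s x y) \<le> norm ((\<bar>G x\<bar> + 1) * \<eta> s x y)" for y
        using ws(3)[of y] unfolding ws(1) by (simp add: abs_mult \<eta>nn)
      then show "AE y in lborel. norm (u0 y * \<eta> s x y) \<le> norm ((\<bar>G x\<bar> + 1) * \<eta> s x y)" by simp
    qed
    have le: "(LINT y|lborel. u0 y * \<eta> R x y) \<le> (LINT y|lborel. u0 y * \<eta> s x y)"
      using e1 e2 e3 Bochner_Integration.integral_diff[OF iR i_s] by simp
    have "- C \<le> (LINT y|lborel. u0 y * \<eta> R x y)"
    proof -
      have "(LINT y|lborel. - (M * \<bar>u0 y\<bar>)) \<le> (LINT y|lborel. u0 y * \<eta> R x y)"
      proof (rule integral_mono[OF _ iR])
        show "integrable lborel (\<lambda>y. - (M * \<bar>u0 y\<bar>))" using u0i by simp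
        fix y
        have "\<bar>u0 y * \<eta> R x y\<bar> \<le> M * \<bar>u0 y\<bar>"
          using mult_left_mono[OF M[of x y], of "\<bar>u0 y\<bar>"] by (simp add: abs_mult mult.commute)
        then show "- (M * \<bar>u0 y\<bar>) \<le> u0 y * \<eta> R x y" by linarith
      qed
      then show ?thesis by (simp add: C_def)
    qed
    also note le
    also have "(LINT y|lborel. u0 y * \<eta> s x y) \<le> (LINT y|lborel. (G x + 1) * \<eta> s x y)"
    proof (rule integral_mono[OF i_s])
      show "integrable lborel (\<lambda>y. (G x + 1) * \<eta> s x y)" using \<eta>i[OF s(1)] by simp
      show "u0 y * \<eta> s x y \<le> (G x + 1) * \<eta> s x y" for y unfolding ws(1) by (rule ws(2))
    qed
    also have "\<dots> = (G x + 1) * c0"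
    proof -
      \<comment> \<open>The two kernels have equal mass because their difference is the Laplacian of
        a compactly supported function, so neither mass is computed.\<close>
      have pb: "(LINT y|lborel. partial b (partial b \<phi>) y) = 0" "integrable lborel (partial b (partial b \<phi>))"
        if b: "b \<in> Basis" for b
      proof -
        have 1: "C_k_on 1 UNIV \<phi>" by (rule C\<phi>)
        have 2: "C_k_on 1 UNIV (partial b \<phi>)" using C\<phi>[of 2] b by (simp add: numeral_2_eq_2)
        note 3 = integral_partial_zero(3)[OF 1 supp b]
        show "(LINT y|lborel. partial b (partial b \<phi>) y) = 0" "integrable lborel (partial b (partial b \<phi>))"
          using integral_partial_zero(1,2)[OF 2 3 b] by auto
      qed
      have "(LINT y|lborel. laplacian \<phi> y) = 0"
        unfolding laplacian_def using pb by (subst Bochner_Integration.integral_sum) auto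
      then have "(LINT y|lborel. \<eta> R x y) = (LINT y|lborel. \<eta> s x y)"
        unfolding lap using \<eta>i[OF R] \<eta>i[OF s(1)] by simp
      then show ?thesis using c0x by simp
    qed
    finally have "- C / c0 \<le> G x + 1" using pos_divide_le_eq[OF c0, of "- C" "G x + 1"] by simp
    then show ?thesis by simp
  qed
  then show ?thesis using R by blast
qed

section \<open>The boundary as a level set\<close>

lemma has_hessian_line_increasing:
  assumes "has_hessian f F A S" "s < t"
    and "\<And>\<tau>. s \<le> \<tau> \<Longrightarrow> \<tau> \<le> t \<Longrightarrow> y + \<tau> *\<^sub>R a \<in> S \<and> F (y + \<tau> *\<^sub>R a) \<bullet> a > 0"
  shows "f (y + s *\<^sub>R a) < f (y + t *\<^sub>R a)"
  by (rule DERIV_pos_imp_increasing[where f = "\<lambda>\<tau>. f (y + \<tau> *\<^sub>R a)", OF assms(2)])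
    (use has_hessian_line(1)[OF assms(1)] assms(3) in blast)

lemma has_hessian_line_decreasing:
  assumes "has_hessian f F A S" "s < t"
    and "\<And>\<tau>. s \<le> \<tau> \<Longrightarrow> \<tau> \<le> t \<Longrightarrow> y + \<tau> *\<^sub>R a \<in> S \<and> F (y + \<tau> *\<^sub>R a) \<bullet> a < 0"
  shows "f (y + t *\<^sub>R a) < f (y + s *\<^sub>R a)"
  by (rule DERIV_neg_imp_decreasing[where f = "\<lambda>\<tau>. f (y + \<tau> *\<^sub>R a)", OF assms(2)])
    (use has_hessian_line(1)[OF assms(1)] assms(3) in blast)

context green_domain
begin

text \<open>Near \<open>x\<close> both \<open>\<rho>\<close> and \<open>G\<close> are strictly
  monotone, in opposite senses, along lines parallel to the gradient \<open>F x\<close>. Each such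
  line meets the boundary at one nearby point, where \<rho> = 0 and G = c, so the signs of
  \<open>\<rho>\<close> and \<open>c - G\<close> agree on either side of it.\<close>

lemma boundary_level_set:
  assumes sb: "smooth_boundary \<Omega>" and x: "x \<in> frontier \<Omega>"
    and uG: "\<And>y. y \<in> closure \<Omega> - {0} \<Longrightarrow> u y = G y"
    and g: "(u has_derivative (\<lambda>h. g \<bullet> h)) (at x within closure \<Omega>)" "g \<noteq> 0"
  shows "F x = g" "\<exists>r>0. \<forall>y\<in>ball x r. (y \<in> \<Omega> \<longleftrightarrow> c < G y) \<and> (y \<in> frontier \<Omega> \<longleftrightarrow> G y = c)"
proof -
  obtain V \<rho> where V: "x \<in> V" "local_defining_function \<Omega> V \<rho>"
    using sb x unfolding smooth_boundary_def by blast
  then have oV: "open V" and sm: "smooth_on V \<rho>" and \<nu>0: "grad \<rho> x \<noteq> 0"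
    and \<Omega>V: "\<And>y. y \<in> V \<Longrightarrow> y \<in> \<Omega> \<longleftrightarrow> \<rho> y < 0"
    unfolding local_defining_function_def by blast+
  obtain V' g0 where V': "open V'" "V \<subseteq> V'" "\<And>k. C_k_on k V' g0" "\<And>y. y \<in> V \<Longrightarrow> g0 y = \<rho> y"
    using sm unfolding smooth_on_def by blast
  have "C_k_on 2 V \<rho>"
    using C_k_on_cong[OF oV, of g0 \<rho> 2] V'(4) C_k_on_subset[OF V'(3) V'(2), of 2] by blast
  then obtain B where B: "has_hessian \<rho> (grad \<rho>) B V"
    using C_k_on_hessian[of 0 V \<rho>] by (auto simp: numeral_2_eq_2)
  have cont\<rho>: "isCont \<rho> y" "isCont (grad \<rho>) y" if "y \<in> V" for y
    using has_hessian_continuous_on[OF B] oV that continuous_on_eq_continuous_at by blast+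
  have xU: "x \<in> U" and xnz: "x \<noteq> 0" using frontier_U[OF x] frontier_nz[OF x] by auto
  have \<rho>_frontier: "\<rho> z = 0" if z: "z \<in> frontier \<Omega>" "z \<in> V" for z
  proof (rule antisym)
    show "0 \<le> \<rho> z" using \<Omega>V[OF z(2)] z(1) frontier_iff by force
    show "\<rho> z \<le> 0"
    proof (rule ccontr)
      assume "\<not> \<rho> z \<le> 0"
      then obtain s where s: "s > 0" "\<And>y. dist y z < s \<Longrightarrow> dist (\<rho> y) (\<rho> z) < \<rho> z"
        using cont\<rho>(1)[OF z(2)] unfolding continuous_at_eps_delta by (meson not_le)
      obtain s' where s': "s' > 0" "ball z s' \<subseteq> V" using oV z(2) open_contains_ball by blast
      obtain y where y: "y \<in> \<Omega>" "dist y z < min s s'"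
        using z(1) s(1) s'(1) closure_approachable[of z \<Omega>] frontier_iff by (metis min_less_iff_conj)
      then have "y \<in> V" using s'(2) by (auto simp: dist_commute)
      then have "\<rho> y < 0" using \<Omega>V y(1) by blast
      moreover have "dist (\<rho> y) (\<rho> z) < \<rho> z" using s(2) y(2) by auto
      ultimately show False unfolding dist_real_def by linarith
    qed
  qed
  define \<nu> where "\<nu> = grad \<rho> x"
  have inward: "\<exists>\<delta>>0. \<forall>t. 0 < t \<and> t < \<delta> \<longrightarrow> x + t *\<^sub>R h \<in> \<Omega> \<and> x + t *\<^sub>R h \<noteq> 0" if h: "\<nu> \<bullet> h < 0" for h
  proof -
    have "((\<lambda>t. \<rho> (x + t *\<^sub>R h)) has_real_derivative \<nu> \<bullet> h) (at 0)"
      using has_hessian_line(1)[OF B, of x 0 h] V(1) by (simp add: \<nu>_def)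
    from DERIV_neg_dec_right[OF this h] obtain \<delta> where
      \<delta>: "\<delta> > 0" "\<And>t. 0 < t \<Longrightarrow> t < \<delta> \<Longrightarrow> \<rho> x > \<rho> (x + t *\<^sub>R h)" by auto
    have "open (V - {0})" using oV by auto
    then obtain r where r: "r > 0" "ball x r \<subseteq> V - {0}" using V(1) xnz open_contains_ball by blast
    have hn: "norm h > 0" using h by auto
    show ?thesis
    proof (intro exI[of _ "min \<delta> (r / norm h)"] conjI allI impI)
      fix t assume t: "0 < t \<and> t < min \<delta> (r / norm h)"
      then have "x + t *\<^sub>R h \<in> ball x r" using hn by (simp add: dist_norm field_simps)
      then have v: "x + t *\<^sub>R h \<in> V - {0}" using r(2) by blast
      then show "x + t *\<^sub>R h \<noteq> 0" by blast
      have "\<rho> (x + t *\<^sub>R h) < 0" using \<delta>(2)[of t] t \<rho>_frontier[OF x V(1)] by simp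
      then show "x + t *\<^sub>R h \<in> \<Omega>" using \<Omega>V v by blast
    qed (use \<delta> r hn in auto)
  qed
  define a where "a = F x"
  have xcl: "x \<in> closure \<Omega>" using x frontier_iff by blast
  \<comment> \<open>On an inward half-line \<open>u\<close> and \<open>G\<close> coincide, hence so
    do their one-sided derivatives; the sign comes from \<open>G \<ge> c\<close> with equality at
    \<open>x\<close>.\<close>
  have agree: "a \<bullet> h = g \<bullet> h" and nonneg: "0 \<le> a \<bullet> h" if h: "\<nu> \<bullet> h < 0" for h
  proof -
    obtain \<delta> where \<delta>: "\<delta> > 0" "\<And>t. 0 < t \<Longrightarrow> t < \<delta> \<Longrightarrow> x + t *\<^sub>R h \<in> \<Omega> \<and> x + t *\<^sub>R h \<noteq> 0"
      using inward[OF h] by blast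
    have D: "((\<lambda>t. G (x + t *\<^sub>R h)) has_real_derivative a \<bullet> h) (at 0)"
      using has_hessian_line(1)[OF hess, of x 0 h] xU by (simp add: a_def)
    have inS: "x + t *\<^sub>R h \<in> closure \<Omega> - {0}" if "t \<in> {0..<\<delta>}" for t
      using \<delta>(2)[of t] that xcl xnz closure_subset by (cases "t = 0") auto
    have "((\<lambda>t. u (x + t *\<^sub>R h)) has_derivative (\<lambda>t. g \<bullet> (t *\<^sub>R h))) (at 0 within {0..<\<delta>})"
    proof (rule has_derivative_in_compose[where f = "\<lambda>t. x + t *\<^sub>R h" and f' = "\<lambda>t. t *\<^sub>R h" and g = u and g' = "\<lambda>k. g \<bullet> k"])
      show "((\<lambda>t. x + t *\<^sub>R h) has_derivative (\<lambda>t. t *\<^sub>R h)) (at 0 within {0..<\<delta>})"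
        by (auto intro!: derivative_eq_intros)
      show "(u has_derivative (\<lambda>k. g \<bullet> k)) (at (x + 0 *\<^sub>R h) within (\<lambda>t. x + t *\<^sub>R h) ` {0..<\<delta>})"
        using g(1) inS by (auto intro: has_derivative_subset)
    qed
    then have "((\<lambda>t. G (x + t *\<^sub>R h)) has_derivative (\<lambda>t. g \<bullet> (t *\<^sub>R h))) (at 0 within {0..<\<delta>})"
      by (rule has_derivative_transform[rotated 2]) (use \<delta>(1) inS uG in auto)
    then have "((\<lambda>t. G (x + t *\<^sub>R h)) has_vector_derivative g \<bullet> h) (at 0 within {0..<\<delta>})"
      by (simp add: has_vector_derivative_def)
    moreover have "((\<lambda>t. G (x + t *\<^sub>R h)) has_vector_derivative a \<bullet> h) (at 0 within {0..<\<delta>})"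
      using D has_field_derivative_at_within has_real_derivative_iff_has_vector_derivative by blast
    moreover have "at 0 within {0..<\<delta>} \<noteq> bot"
      using \<delta>(1) by (simp add: trivial_limit_within islimpt_Ico)
    ultimately show "a \<bullet> h = g \<bullet> h" by (metis vector_derivative_unique_within)
    show "0 \<le> a \<bullet> h"
    proof (rule derivative_lower_bound[where \<phi> = "\<lambda>t. G (x + t *\<^sub>R h) - c", OF _ _ \<delta>(1)])
      show "((\<lambda>t. G (x + t *\<^sub>R h) - c) has_real_derivative a \<bullet> h) (at 0)"
        using DERIV_diff[OF D DERIV_const[of c]] by simp
      show "G (x + 0 *\<^sub>R h) - c = 0" using boundary_value[OF x] by simp
      fix t assume "0 < t" "t < \<delta>"
      then show "0 * t \<le> G (x + t *\<^sub>R h) - c" using G_ge[of "x + t *\<^sub>R h"] inS[of t] by simp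
    qed
  qed
  have \<nu>n: "\<nu> \<bullet> \<nu> > 0" using \<nu>0 by (simp add: \<nu>_def)
  \<comment> \<open>\<open>v\<close> is orthogonal to an open half-space of directions. This gives
    \<open>v \<bullet> \<nu> = 0\<close>, so \<open>- \<nu> + v\<close> is inward too and tests
    \<open>v\<close> against itself.\<close>
  define v where "v = a - g"
  have v: "v \<bullet> h = 0" if "\<nu> \<bullet> h < 0" for h using agree[OF that] by (simp add: v_def inner_diff_left)
  have v\<nu>: "v \<bullet> \<nu> = 0" using v[of "- \<nu>"] \<nu>n by simp
  have "\<nu> \<bullet> (- \<nu> + v) < 0" using \<nu>n v\<nu> unfolding inner_add_right inner_minus_right by (simp add: inner_commute)
  from v[OF this] have "v \<bullet> v = 0" using v\<nu> by (simp add: inner_add_right inner_diff_right)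
  then have "v = 0" by simp
  then have ag: "a = g" by (simp add: v_def)
  then show "F x = g" by (simp add: a_def)
  have an: "a \<bullet> a > 0" using ag g(2) by simp
  \<comment> \<open>Otherwise \<open>- \<nu> - a\<close> would be an inward direction along which
    \<open>G\<close> has negative derivative.\<close>
  have \<nu>a: "\<nu> \<bullet> a < 0"
  proof (rule ccontr)
    assume "\<not> \<nu> \<bullet> a < 0"
    then have "\<nu> \<bullet> (- \<nu> - a) < 0" "a \<bullet> (- \<nu> - a) < 0"
      using \<nu>n an unfolding inner_diff_right inner_minus_right inner_commute[of a \<nu>] by linarith+
    then show False using nonneg by force
  qed
  have "isCont (\<lambda>y. grad \<rho> y \<bullet> a) x" using cont\<rho>(2)[OF V(1)] by (intro continuous_intros)
  moreover have "0 < - (\<nu> \<bullet> a)" using \<nu>a by simp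
  ultimately obtain s1 where s1: "s1 > 0" "\<And>y. dist y x < s1 \<Longrightarrow> dist (grad \<rho> y \<bullet> a) (\<nu> \<bullet> a) < - (\<nu> \<bullet> a)"
    unfolding continuous_at_eps_delta \<nu>_def by blast
  have "isCont (\<lambda>y. F y \<bullet> a) x" using isCont_F[OF xU] by (intro continuous_intros)
  then obtain s2 where s2: "s2 > 0" "\<And>y. dist y x < s2 \<Longrightarrow> dist (F y \<bullet> a) (F x \<bullet> a) < a \<bullet> a"
    unfolding continuous_at_eps_delta using an by blast
  have "open (V \<inter> U)" using oV open_U by auto
  then obtain s3 where s3: "s3 > 0" "ball x s3 \<subseteq> V \<inter> U" using V(1) xU open_contains_ball by blast
  define r1 where "r1 = min s3 (min s1 s2)"
  have r1: "r1 > 0" using s1 s2 s3 by (simp add: r1_def)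
  have near: "y \<in> V \<and> y \<in> U \<and> grad \<rho> y \<bullet> a < 0 \<and> F y \<bullet> a > 0" if "y \<in> ball x r1" for y
  proof -
    have "dist y x < s1" "dist y x < s2" "y \<in> ball x s3" using that by (auto simp: r1_def dist_commute)
    then have "grad \<rho> y \<bullet> a < 0" "F y \<bullet> a > 0"
      using s1(2)[of y] s2(2)[of y] unfolding dist_real_def a_def[symmetric] by linarith+
    then show ?thesis using \<open>y \<in> ball x s3\<close> s3(2) by blast
  qed
  have na: "norm a > 0" using an by auto
  define \<delta> where "\<delta> = r1 / (2 * norm a)"
  have \<delta>: "\<delta> > 0" "\<delta> * norm a = r1 / 2" using r1 na by (auto simp: \<delta>_def)
  have seg: "y + t *\<^sub>R a \<in> ball x r1" if "y \<in> ball x (r1/2)" "- \<delta> \<le> t" "t \<le> \<delta>" for y t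
  proof -
    have "\<bar>t\<bar> * norm a \<le> \<delta> * norm a" using that by (intro mult_right_mono) auto
    then have "dist y (y + t *\<^sub>R a) \<le> r1 / 2" using \<delta>(2) by (simp add: dist_norm)
    then show ?thesis using that(1) dist_triangle[of x "y + t *\<^sub>R a" y] by simp
  qed
  have inc: "G (y + s *\<^sub>R a) < G (y + t *\<^sub>R a)" and dec: "\<rho> (y + t *\<^sub>R a) < \<rho> (y + s *\<^sub>R a)"
    if "y \<in> ball x (r1/2)" "- \<delta> \<le> s" "s < t" "t \<le> \<delta>" for y s t
  proof -
    show "G (y + s *\<^sub>R a) < G (y + t *\<^sub>R a)"
      by (rule has_hessian_line_increasing[OF hess that(3)]) (use near seg[OF that(1)] that in force)
    show "\<rho> (y + t *\<^sub>R a) < \<rho> (y + s *\<^sub>R a)"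
      by (rule has_hessian_line_decreasing[OF B that(3)]) (use near seg[OF that(1)] that in force)
  qed
  have \<rho>x: "\<rho> x = 0" by (rule \<rho>_frontier[OF x V(1)])
  have xb: "x \<in> ball x (r1/2)" using r1 by simp
  have e1: "\<rho> (x + \<delta> *\<^sub>R a) < 0" using dec[OF xb, of 0 \<delta>] \<delta> \<rho>x by simp
  have e2: "\<rho> (x + (- \<delta>) *\<^sub>R a) > 0" using dec[OF xb, of "- \<delta>" 0] \<delta> \<rho>x by simp
  have shift: "isCont (\<lambda>y. \<rho> (y + t *\<^sub>R a)) x" if "- \<delta> \<le> t" "t \<le> \<delta>" for t
  proof (rule isCont_o2[where f = "\<lambda>y. y + t *\<^sub>R a" and g = \<rho>])
    show "isCont (\<lambda>y. y + t *\<^sub>R a) x" by (intro continuous_intros)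
    show "isCont \<rho> (x + t *\<^sub>R a)" by (rule cont\<rho>(1)) (use near seg[OF xb that] in blast)
  qed
  have "isCont (\<lambda>y. \<rho> (y + \<delta> *\<^sub>R a)) x" "isCont (\<lambda>y. \<rho> (y + (- \<delta>) *\<^sub>R a)) x"
    using \<delta>(1) by (auto intro!: shift simp del: scaleR_minus_left)
  note shifted = this
  have "0 < - \<rho> (x + \<delta> *\<^sub>R a)" using e1 by simp
  then obtain t1 where t1: "t1 > 0"
    "\<And>y. dist y x < t1 \<Longrightarrow> dist (\<rho> (y + \<delta> *\<^sub>R a)) (\<rho> (x + \<delta> *\<^sub>R a)) < - \<rho> (x + \<delta> *\<^sub>R a)"
    using shifted(1) unfolding continuous_at_eps_delta by blast
  obtain t2 where t2: "t2 > 0"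
    "\<And>y. dist y x < t2 \<Longrightarrow> dist (\<rho> (y + (- \<delta>) *\<^sub>R a)) (\<rho> (x + (- \<delta>) *\<^sub>R a)) < \<rho> (x + (- \<delta>) *\<^sub>R a)"
    using shifted(2) e2 unfolding continuous_at_eps_delta by blast
  show "\<exists>r>0. \<forall>y\<in>ball x r. (y \<in> \<Omega> \<longleftrightarrow> c < G y) \<and> (y \<in> frontier \<Omega> \<longleftrightarrow> G y = c)"
  proof (intro exI[of _ "min (r1/2) (min t1 t2)"] conjI ballI)
    show "0 < min (r1/2) (min t1 t2)" using r1 t1 t2 by simp
    fix y assume "y \<in> ball x (min (r1/2) (min t1 t2))"
    then have y: "y \<in> ball x (r1/2)" "dist y x < t1" "dist y x < t2" by (auto simp: dist_commute)
    have y1: "\<rho> (y + \<delta> *\<^sub>R a) < 0" using t1(2)[OF y(2)] unfolding dist_real_def by linarith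
    have y2: "\<rho> (y + (- \<delta>) *\<^sub>R a) > 0" using t2(2)[OF y(3)] unfolding dist_real_def by linarith
    have yV: "y \<in> V" using near seg[OF y(1), of 0] \<delta>(1) by auto
    \<comment> \<open>The sign change of \<rho> along this segment is inherited by continuity from
      the parallel segment through \<open>x\<close>.\<close>
    have "\<exists>t\<ge>- \<delta>. t \<le> \<delta> \<and> \<rho> (y + t *\<^sub>R a) = 0"
    proof (rule IVT2')
      show "continuous_on {- \<delta>..\<delta>} (\<lambda>t. \<rho> (y + t *\<^sub>R a))"
      proof (rule continuous_on_compose2[OF has_hessian_continuous_on(1)[OF B]])
        show "continuous_on {- \<delta>..\<delta>} (\<lambda>t. y + t *\<^sub>R a)" by (intro continuous_intros)
        show "(\<lambda>t. y + t *\<^sub>R a) ` {- \<delta>..\<delta>} \<subseteq> V" using near seg[OF y(1)] by auto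
      qed
    qed (use y1 y2 \<delta> in auto)
    then obtain t0 where t0: "- \<delta> \<le> t0" "t0 \<le> \<delta>" "\<rho> (y + t0 *\<^sub>R a) = 0" by blast
    define z where "z = y + t0 *\<^sub>R a"
    have t0\<delta>: "t0 < \<delta>" using t0 y1 by (cases "t0 = \<delta>") auto
    have zV: "z \<in> V" using near seg[OF y(1) t0(1,2)] by (simp add: z_def)
    have zf: "z \<in> frontier \<Omega>"
      unfolding frontier_iff
    proof
      show "z \<notin> \<Omega>" using \<Omega>V[OF zV] t0(3) by (simp add: z_def)
      show "z \<in> closure \<Omega>"
        unfolding closure_approachable
      proof (intro allI impI)
        fix \<epsilon> :: real assume "\<epsilon> > 0"
        then obtain s where s: "0 < s" "s < \<delta> - t0" "s < \<epsilon> / norm a"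
          using field_lbound_gt_zero[of "\<delta> - t0" "\<epsilon> / norm a"] t0\<delta> na by auto
        have eq: "z + s *\<^sub>R a = y + (t0 + s) *\<^sub>R a" by (simp add: z_def algebra_simps)
        have "\<rho> (z + s *\<^sub>R a) < 0" using dec[OF y(1), of t0 "t0 + s"] t0 s unfolding eq by simp
        moreover have "z + s *\<^sub>R a \<in> V" unfolding eq using near seg[OF y(1), of "t0 + s"] t0 s by auto
        ultimately have "z + s *\<^sub>R a \<in> \<Omega>" using \<Omega>V by blast
        moreover have "dist (z + s *\<^sub>R a) z < \<epsilon>" using s na by (simp add: dist_norm field_simps)
        ultimately show "\<exists>y\<in>\<Omega>. dist y z < \<epsilon>" by blast
      qed
    qed
    have Gz: "G (y + t0 *\<^sub>R a) = c" using boundary_value[OF zf] by (simp add: z_def)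
    have "(y \<in> \<Omega> \<longleftrightarrow> c < G y) \<and> (y \<in> frontier \<Omega> \<longleftrightarrow> G y = c)"
    proof (cases t0 "0::real" rule: linorder_cases)
      case less
      have "c < G y" using inc[OF y(1), of t0 0] less t0 Gz \<delta> by simp
      moreover have "\<rho> y < 0" using dec[OF y(1), of t0 0] less t0 \<delta> by simp
      then have "y \<in> \<Omega>" using \<Omega>V[OF yV] by simp
      ultimately show ?thesis using frontier_iff by auto
    next
      case equal
      then have "z = y" by (simp add: z_def)
      then show ?thesis using zf Gz equal frontier_iff by auto
    next
      case greater
      have "G y < c" using inc[OF y(1), of 0 t0] greater t0 Gz \<delta> by simp
      moreover have "0 < \<rho> y" using dec[OF y(1), of 0 t0] greater t0 \<delta> by simp
      then have "y \<notin> \<Omega>" "y \<notin> frontier \<Omega>" using \<Omega>V[OF yV] \<rho>_frontier[OF _ yV] by auto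
      ultimately show ?thesis by auto
    qed
    then show "y \<in> \<Omega> \<longleftrightarrow> c < G y" "y \<in> frontier \<Omega> \<longleftrightarrow> G y = c" by auto
  qed
qed

end

theorem theorem1p8:
  fixes \<Omega> :: "(real ^ 'n) set" and u :: "real ^ 'n \<Rightarrow> real" and d c :: real
  assumes "CARD('n) \<ge> 3"
    and "open \<Omega>" and "connected \<Omega>" and "bounded \<Omega>" and "smooth_boundary \<Omega>" and "0 \<in> \<Omega>"
    and "d > 0"
    and "smooth_on (closure \<Omega> - {0}) u"
    and "neg_laplacian_eq_dirac \<Omega> u (d * hypersurface_area (frontier \<Omega>))"
    and "\<forall>x\<in>frontier \<Omega>. u x = c"
    and "\<forall>x\<in>frontier \<Omega>. \<exists>g. (u has_derivative (\<lambda>h. g \<bullet> h)) (at x within closure \<Omega>) \<and> norm g = d"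
    and "(SUP x\<in>frontier \<Omega>. mean_curvature \<Omega> x / (real CARD('n) - 1))
           \<ge> (hypersurface_area (sphere (0 :: real ^ 'n) 1) / hypersurface_area (frontier \<Omega>))
               powr (1 / (real CARD('n) - 1))"
  shows "\<exists>a r. r > 0 \<and> \<Omega> = ball a r \<and>
           (\<exists>f :: real \<Rightarrow> real. \<forall>x\<in>closure \<Omega> - {0}. u x = f (dist a x))"
proof -
  \<comment> \<open>The extension \<open>G\<close> has two-sided derivatives on the boundary, where
    those of \<open>u\<close> are one-sided; the argument is carried out for
    \<open>G\<close>.\<close>
  obtain U G where U: "open U" "closure \<Omega> - {0} \<subseteq> U" and G: "\<And>k. C_k_on k U G"
    and Gu: "\<And>x. x \<in> closure \<Omega> - {0} \<Longrightarrow> G x = u x"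
    using assms(8) unfolding smooth_on_def by blast
  have "C_k_on (Suc (Suc 0)) U G" by (rule G)
  then obtain A where A: "has_hessian G (grad G) A U" "\<And>x. x \<in> U \<Longrightarrow> lin_trace (A x) = laplacian G x"
    using C_k_on_hessian by blast
  have sub: "\<Omega> - {0} \<subseteq> closure \<Omega> - {0}" using closure_subset by blast
  have \<Omega>U: "\<Omega> - {0} \<subseteq> U" using sub U(2) by blast
  have uG: "u x = G x" if "x \<in> \<Omega> - {0}" for x using Gu sub that by force
  have fr: "x \<in> closure \<Omega> - {0}" if "x \<in> frontier \<Omega>" for x
    using that assms(2,6) by (auto simp: frontier_def interior_open)
  interpret green_domain \<Omega> U G "grad G" A c
  proof
    show "DIM(real ^ 'n) \<ge> 3" using assms(1) by simp
    show "lin_trace (A x) = 0" if "x \<in> \<Omega> - {0}" for x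
      using A(2)[of x] distribution_harmonic[OF assms(9,2) U(1) \<Omega>U G uG that] \<Omega>U that by auto
    have "continuous_on U G" using G[of 0] by simp
    \<comment> \<open>A nonnegative Dirac mass is what orders the shell averages in
      \<open>distribution_bounded_below\<close>.\<close>
    moreover have "0 \<le> d * hypersurface_area (frontier \<Omega>)"
      using assms(7) by (simp add: hypersurface_area_def)
    ultimately show "\<exists>r>0. \<exists>C. \<forall>x\<in>ball 0 r - {0}. C \<le> G x"
      using distribution_bounded_below[OF assms(9) _ assms(2,6) U(1) \<Omega>U _ uG] by blast
    show "G x = c" if "x \<in> frontier \<Omega>" for x using Gu[OF fr[OF that]] assms(10) that by simp
  qed (use assms U A in auto)
  have level: "norm (grad G x) = d \<and>
      (\<exists>r>0. \<forall>y\<in>ball x r. (y \<in> \<Omega> \<longleftrightarrow> c < G y) \<and> (y \<in> frontier \<Omega> \<longleftrightarrow> G y = c))"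
    if x: "x \<in> frontier \<Omega>" for x
  proof -
    obtain g where g: "(u has_derivative (\<lambda>h. g \<bullet> h)) (at x within closure \<Omega>)" "norm g = d"
      using assms(11) x by blast
    then have "g \<noteq> 0" using assms(7) by auto
    from boundary_level_set[OF assms(5) x Gu[symmetric] g(1) this] show ?thesis using g(2) by auto
  qed
  interpret overdetermined \<Omega> U G "grad G" A c d
    by unfold_locales (use level assms(7) in auto)
  obtain r where r: "r > 0" "\<Omega> = ball 0 r"
    and sym: "\<And>x y. x \<in> closure \<Omega> - {0} \<Longrightarrow> y \<in> closure \<Omega> - {0} \<Longrightarrow> norm x = norm y \<Longrightarrow> G x = G y"
    using symmetry by blast
  \<comment> \<open>The profile is read off at an arbitrary point of norm \<open>t\<close>;
    \<open>sym\<close> makes the value independent of the choice.\<close>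
  define f where "f = (\<lambda>t. G (SOME y. y \<in> closure \<Omega> - {0} \<and> norm y = t))"
  have "u x = f (dist 0 x)" if x: "x \<in> closure \<Omega> - {0}" for x
  proof -
    let ?y = "SOME y. y \<in> closure \<Omega> - {0} \<and> norm y = norm x"
    have "?y \<in> closure \<Omega> - {0} \<and> norm ?y = norm x" by (rule someI[of _ x]) (use x in simp)
    then have "G ?y = G x" using sym x by blast
    then show ?thesis using Gu[OF x] by (simp add: f_def)
  qed
  then show ?thesis using r by blast
qed

end
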